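(* Let $(M,\nabla,g,\xi)$ be a simply connected selfsimilar Hessian manifold of dimension $n$, let $(I,\omega)$ be the corresponding Kähler structure on $TM\simeq M\times\mathbb{R}^n$, let $G$ be the group of affine isometries of $(M,\nabla,g)$ preserving $\xi$, let $\theta$ be the induced affine action of $G$ on $\mathbb{R}^n$, let $\pi:M\times\mathbb{R}^n\to M$ be the natural projection, and set $\omega_{c.K.}=\pi^*\left(g(\xi,\xi)^{-1}\right)\omega$. Then: (i) The pair $(I,\omega_{c.K.})$ is a $G\ltimes_\theta\mathbb{R}^n$-invariant conformally Kähler structure on $M\times\mathbb{R}^n$. (ii) If the field $\xi$ is complete, then $(I,\omega_{c.K.})$ is $(\mathbb{R}\times G)\ltimes_{\tilde\theta}\mathbb{R}^n$-invariant, where $\tilde\theta$ is the affine action of $\mathbb{R}\times G$ on $\mathbb{R}^n$ induced by its action $(t,a)\mapsto\exp(t\xi)\circ\phi_a$ on $M$, $\phi$ being the action of $G$ on $M$. (iii) If the field $\xi$ is complete and $G$ acts transitively on the level surface $S=\{g(\xi,\xi)=1\}\subset M$, then $(M\times\mathbb{R}^n,I,\omega_{c.K.})$ is a homogeneous conformally Kähler manifold for the group $(\mathbb{R}\times G)\ltimes_{\tilde\theta}\mathbb{R}^n$.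
   Context: A flat affine manifold $(M,\nabla)$ is a smooth manifold with a flat torsion-free connection $\nabla$. A Hessian manifold $(M,\nabla,g)$ is a flat affine manifold with a Riemannian metric $g$ that in flat local coordinates is locally $g=\frac{\partial^2\varphi}{\partial x^i\partial x^j}dx^i dx^j$ for some local function $\varphi$. A vector field is affine if its (local) flow preserves $\nabla$. A selfsimilar Hessian manifold $(M,\nabla,g,\xi)$ is a Hessian manifold with an affine vector field $\xi$ satisfying $\mathcal{L}_\xi g=2g$, where $\mathcal{L}$ is the Lie derivative. An affine isometry is a diffeomorphism of $M$ preserving $\nabla$ and $g$. Development map: for $(M,\nabla)$ simply connected of dimension $n$ there is a local affine diffeomorphism $\mathrm{dev}:M\to\mathbb{R}^n$; if a group $H$ acts on $M$ by affine automorphisms via $\phi$, there is an induced affine action $\theta$ of $H$ on $\mathbb{R}^n$ with $\mathrm{dev}\circ\phi_a=\theta_a\circ\mathrm{dev}$ for all $a\in H$. The connection gives $TM\simeq M\times\mathbb{R}^n$, identifying $w\in T_mM$ with $(m,d\,\mathrm{dev}_m(w))$. The group $H\ltimes_\theta\mathbb{R}^n$ is $H\times\mathbb{R}^n$ with the product $(a,u)(b,w)=(ab,\,u+L_a w)$, where $L_a$ is the linear part of $\theta_a$; it acts on $M\times\mathbb{R}^n$ by $\psi_{a\ltimes_\theta u}(m\times v)=\phi_a(m)\times(\theta_a(v)+u)$. This is applied both to $H=G$ and, when $\xi$ is complete, to $H=\mathbb{R}\times G$ (the flow of $\xi$ commutes with $G$ since $G$ preserves $\xi$). Invariance refers to these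 actions. Structure on $TM$: a flat chart $x^1,\dots,x^n$ gives coordinates $x^1,\dots,x^n,y^1,\dots,y^n$ on $TM$; $I(\partial/\partial x^i)=\partial/\partial y^i$ (equivalently, writing tangent vectors of $M\times\mathbb{R}^n$ as $X\times Y\in\mathbb{R}^n\times\mathbb{R}^n$ via $d\,\mathrm{dev}$, $I(X\times Y)=(-Y)\times X$), and $g^{\mathrm r}(X,Y)=(\pi^*g)(X,Y)+(\pi^*g)(IX,IY)$. It is known that $(I,g^{\mathrm r})$ is Kähler when $g$ is Hessian; $\omega$ is its Kähler form. A (globally) conformally Kähler structure on a manifold $N$ is a pair $(I,f\omega)$ with $(I,\omega)$ a Kähler structure on $N$ and $f$ a positive function on $N$. It is homogeneous for a group if that group acts transitively on $N$ preserving $I$ and $f\omega$.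
   Formalization: The field ξ is assumed to vanish nowhere, since otherwise g(ξ,ξ)^{-1} and hence ω_{c.K.} are undefined (e.g. Euclidean ℝⁿ with the Euler field, which vanishes at the origin). *)

theory Defs
  imports "HOL-Analysis.Analysis" "HOL-Algebra.Group_Action"
begin

text \<open>
  A manifold is a Hausdorff, second countable type \<open>'m\<close> (all of it) with a smooth atlas of charts
  \<open>(U, c)\<close> modelled on a Euclidean space \<open>'e\<close>; the values of \<open>c\<close> outside \<open>U\<close> are irrelevant.
  The atlas need not be maximal, it merely generates the smooth structure.
\<close>

type_synonym ('m, 'e) chart = "'m set \<times> ('m \<Rightarrow> 'e)"

primrec Ck_on :: "nat \<Rightarrow> 'a::real_normed_vector set \<Rightarrow> ('a \<Rightarrow> 'b::real_normed_vector) \<Rightarrow> bool" where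
  "Ck_on 0 S f \<longleftrightarrow> continuous_on S f"
| "Ck_on (Suc k) S f \<longleftrightarrow>
     (\<forall>x\<in>S. f differentiable (at x)) \<and> (\<forall>v. Ck_on k S (\<lambda>x. frechet_derivative f (at x) v))"

definition smooth_on :: "'a::real_normed_vector set \<Rightarrow> ('a \<Rightarrow> 'b::real_normed_vector) \<Rightarrow> bool" where
  "smooth_on S f \<longleftrightarrow> (\<forall>k. Ck_on k S f)"

definition chart_inv :: "('m, 'e) chart \<Rightarrow> 'e \<Rightarrow> 'm" where
  "chart_inv C = inv_into (fst C) (snd C)"

definition smooth_manifold ::
  "('m::{t2_space,second_countable_topology}, 'e::euclidean_space) chart set \<Rightarrow> bool" where
  "smooth_manifold A \<longleftrightarrow>
     (\<Union>C\<in>A. fst C) = UNIV \<and>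
     (\<forall>C\<in>A. open (fst C) \<and> open (snd C ` fst C) \<and>
        homeomorphism (fst C) (snd C ` fst C) (snd C) (chart_inv C)) \<and>
     (\<forall>C\<in>A. \<forall>D\<in>A. smooth_on (snd C ` (fst C \<inter> fst D)) (snd D \<circ> chart_inv C))"

definition std_atlas :: "('e, 'e) chart set" where
  "std_atlas = {(UNIV, id)}"

definition prod_atlas :: "('m, 'e) chart set \<Rightarrow> ('n, 'f) chart set \<Rightarrow> ('m \<times> 'n, 'e \<times> 'f) chart set" where
  "prod_atlas A B = {(fst C \<times> fst D, map_prod (snd C) (snd D)) |C D. C \<in> A \<and> D \<in> B}"

text \<open>Here and below the set \<open>W\<close> is meant to be open.\<close>

definition smooth_map_on ::
  "('m::topological_space, 'e::euclidean_space) chart set \<Rightarrow>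
   ('n::topological_space, 'f::euclidean_space) chart set \<Rightarrow> 'm set \<Rightarrow> ('m \<Rightarrow> 'n) \<Rightarrow> bool" where
  "smooth_map_on A B W f \<longleftrightarrow>
     continuous_on W f \<and>
     (\<forall>C\<in>A. \<forall>D\<in>B.
        smooth_on (snd C ` (fst C \<inter> W \<inter> f -` fst D)) (snd D \<circ> f \<circ> chart_inv C))"

definition diffeo_on ::
  "('m::topological_space, 'e::euclidean_space) chart set \<Rightarrow>
   ('n::topological_space, 'f::euclidean_space) chart set \<Rightarrow> 'm set \<Rightarrow> ('m \<Rightarrow> 'n) \<Rightarrow> bool" where
  "diffeo_on A B W f \<longleftrightarrow>
     open W \<and> open (f ` W) \<and> inj_on f W \<and>
     smooth_map_on A B W f \<and> smooth_map_on B A (f ` W) (inv_into W f)"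

text \<open>
  The tangent space at \<open>p\<close> is the model space \<open>'e\<close>, a tangent vector being given by its
  components in one distinguished chart \<open>chart_at A p\<close> around \<open>p\<close>.  The choice of that chart may
  vary discontinuously with \<open>p\<close>; hence smoothness of tensor fields is always tested in
  the charts of the atlas, after transforming with the differential \<open>tangent_map\<close>.
\<close>

definition chart_at :: "('m, 'e) chart set \<Rightarrow> 'm \<Rightarrow> ('m, 'e) chart" where
  "chart_at A p = (SOME C. C \<in> A \<and> p \<in> fst C)"

definition tangent_map ::
  "('m, 'e::euclidean_space) chart set \<Rightarrow> ('n, 'f::euclidean_space) chart set \<Rightarrow>
   ('m \<Rightarrow> 'n) \<Rightarrow> 'm \<Rightarrow> 'e \<Rightarrow> 'f" where
  "tangent_map A B f p =
     frechet_derivative (snd (chart_at B (f p)) \<circ> f \<circ> chart_inv (chart_at A p))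
       (at (snd (chart_at A p) p))"

text \<open>The vector field with constant components \<open>u\<close> in the coordinates \<open>C\<close>; for a basis
  vector \<open>u\<close> it is a coordinate field \<open>\<partial>/\<partial>x\<^sup>i\<close>.\<close>

definition coord_field ::
  "('m, 'e::euclidean_space) chart set \<Rightarrow> ('m, 'e) chart \<Rightarrow> 'e \<Rightarrow> 'm \<Rightarrow> 'e" where
  "coord_field A C u p = tangent_map std_atlas A (chart_inv C) (snd C p) u"

definition local_rep ::
  "('m, 'e::euclidean_space) chart set \<Rightarrow> ('m, 'e) chart \<Rightarrow> ('m \<Rightarrow> 'e) \<Rightarrow> 'e \<Rightarrow> 'e" where
  "local_rep A C X x = tangent_map A std_atlas (snd C) (chart_inv C x) (X (chart_inv C x))"

definition smooth_field_on ::
  "('m, 'e::euclidean_space) chart set \<Rightarrow> 'm set \<Rightarrow> ('m \<Rightarrow> 'e) \<Rightarrow> bool" where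
  "smooth_field_on A W X \<longleftrightarrow> (\<forall>C\<in>A. smooth_on (snd C ` (fst C \<inter> W)) (local_rep A C X))"

definition dir_deriv ::
  "('m, 'e::euclidean_space) chart set \<Rightarrow> ('m \<Rightarrow> real) \<Rightarrow> 'm \<Rightarrow> 'e \<Rightarrow> real" where
  "dir_deriv A f p v = tangent_map A std_atlas f p v"

text \<open>The coordinate formula for \<open>[X, Y]\<close> at \<open>p\<close>, evaluated in the distinguished chart at \<open>p\<close>, whose
  components are by convention the elements of the tangent space at \<open>p\<close>.\<close>

definition lie_bracket ::
  "('m, 'e::euclidean_space) chart set \<Rightarrow> ('m \<Rightarrow> 'e) \<Rightarrow> ('m \<Rightarrow> 'e) \<Rightarrow> 'm \<Rightarrow> 'e" where
  "lie_bracket A X Y p =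
     (let C = chart_at A p; x = snd C p; X' = local_rep A C X; Y' = local_rep A C Y
      in frechet_derivative Y' (at x) (X' x) - frechet_derivative X' (at x) (Y' x))"

definition smooth_bilinear_field ::
  "('m::topological_space, 'e::euclidean_space) chart set \<Rightarrow> ('m \<Rightarrow> 'e \<Rightarrow> 'e \<Rightarrow> real) \<Rightarrow> bool" where
  "smooth_bilinear_field A h \<longleftrightarrow>
     (\<forall>p. bilinear (h p)) \<and>
     (\<forall>W X Y. open W \<and> smooth_field_on A W X \<and> smooth_field_on A W Y \<longrightarrow>
        smooth_map_on A std_atlas W (\<lambda>p. h p (X p) (Y p)))"

definition smooth_endomorphism_field ::
  "('m::topological_space, 'e::euclidean_space) chart set \<Rightarrow> ('m \<Rightarrow> 'e \<Rightarrow> 'e) \<Rightarrow> bool" where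
  "smooth_endomorphism_field A T \<longleftrightarrow>
     (\<forall>p. linear (T p)) \<and>
     (\<forall>W X. open W \<and> smooth_field_on A W X \<longrightarrow> smooth_field_on A W (\<lambda>p. T p (X p)))"

definition pullback_form ::
  "('m, 'e::euclidean_space) chart set \<Rightarrow> ('n, 'f::euclidean_space) chart set \<Rightarrow> ('m \<Rightarrow> 'n) \<Rightarrow>
   ('n \<Rightarrow> 'f \<Rightarrow> 'f \<Rightarrow> real) \<Rightarrow> 'm \<Rightarrow> 'e \<Rightarrow> 'e \<Rightarrow> real" where
  "pullback_form A B f h p u v = h (f p) (tangent_map A B f p u) (tangent_map A B f p v)"

definition riemannian_metric ::
  "('m::topological_space, 'e::euclidean_space) chart set \<Rightarrow> ('m \<Rightarrow> 'e \<Rightarrow> 'e \<Rightarrow> real) \<Rightarrow> bool" where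
  "riemannian_metric A g \<longleftrightarrow>
     smooth_bilinear_field A g \<and>
     (\<forall>p u v. g p u v = g p v u) \<and> (\<forall>p u. u \<noteq> 0 \<longrightarrow> g p u u > 0)"

definition lie_derivative ::
  "('m, 'e::euclidean_space) chart set \<Rightarrow> ('m \<Rightarrow> 'e) \<Rightarrow> ('m \<Rightarrow> 'e \<Rightarrow> 'e \<Rightarrow> real) \<Rightarrow>
   ('m \<Rightarrow> 'e) \<Rightarrow> ('m \<Rightarrow> 'e) \<Rightarrow> 'm \<Rightarrow> real" where
  "lie_derivative A X h Y Z p =
     dir_deriv A (\<lambda>q. h q (Y q) (Z q)) p (X p)
     - h p (lie_bracket A X Y p) (Z p) - h p (Y p) (lie_bracket A X Z p)"

text \<open>A connection sends a vector field \<open>Y\<close> on an open set, a point \<open>p\<close> of it, and a tangent vector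
  \<open>v\<close> at \<open>p\<close> to the covariant derivative of \<open>Y\<close> along \<open>v\<close>, written \<open>nabla Y p v\<close>.  It acts on
  fields defined on arbitrary open sets and depends only on their germs.\<close>

type_synonym ('m, 'e) conn = "('m \<Rightarrow> 'e) \<Rightarrow> 'm \<Rightarrow> 'e \<Rightarrow> 'e"

definition affine_connection ::
  "('m::topological_space, 'e::euclidean_space) chart set \<Rightarrow> ('m, 'e) conn \<Rightarrow> bool" where
  "affine_connection A nabla \<longleftrightarrow>
     (\<forall>W Y p. open W \<and> smooth_field_on A W Y \<and> p \<in> W \<longrightarrow>
        linear (nabla Y p) \<and>
        (\<forall>Z. (\<forall>q\<in>W. Y q = Z q) \<longrightarrow> nabla Y p = nabla Z p) \<and>
        (\<forall>Z v. smooth_field_on A W Z \<longrightarrow>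
           nabla (\<lambda>q. Y q + Z q) p v = nabla Y p v + nabla Z p v) \<and>
        (\<forall>f v. smooth_map_on A std_atlas W f \<longrightarrow>
           nabla (\<lambda>q. f q *\<^sub>R Y q) p v = dir_deriv A f p v *\<^sub>R Y p + f p *\<^sub>R nabla Y p v)) \<and>
     (\<forall>W X Y. open W \<and> smooth_field_on A W X \<and> smooth_field_on A W Y \<longrightarrow>
        smooth_field_on A W (\<lambda>p. nabla Y p (X p)))"

definition torsion_free ::
  "('m::topological_space, 'e::euclidean_space) chart set \<Rightarrow> ('m, 'e) conn \<Rightarrow> bool" where
  "torsion_free A nabla \<longleftrightarrow>
     (\<forall>W X Y. open W \<and> smooth_field_on A W X \<and> smooth_field_on A W Y \<longrightarrow>
        (\<forall>p\<in>W. nabla Y p (X p) - nabla X p (Y p) = lie_bracket A X Y p))"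

definition flat_connection ::
  "('m::topological_space, 'e::euclidean_space) chart set \<Rightarrow> ('m, 'e) conn \<Rightarrow> bool" where
  "flat_connection A nabla \<longleftrightarrow>
     (\<forall>W X Y Z. open W \<and> smooth_field_on A W X \<and> smooth_field_on A W Y \<and> smooth_field_on A W Z \<longrightarrow>
        (\<forall>p\<in>W. nabla (\<lambda>q. nabla Z q (Y q)) p (X p) - nabla (\<lambda>q. nabla Z q (X q)) p (Y p)
                 - nabla Z p (lie_bracket A X Y p) = 0))"

definition flat_affine_manifold ::
  "('m::{t2_space,second_countable_topology}, 'e::euclidean_space) chart set \<Rightarrow> ('m, 'e) conn \<Rightarrow> bool" where
  "flat_affine_manifold A nabla \<longleftrightarrow>
     smooth_manifold A \<and> affine_connection A nabla \<and> torsion_free A nabla \<and> flat_connection A nabla"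

definition std_connection :: "('e::euclidean_space, 'e) conn" where
  "std_connection Y p v = frechet_derivative Y (at p) v"

definition flat_chart ::
  "('m::topological_space, 'e::euclidean_space) chart set \<Rightarrow> ('m, 'e) conn \<Rightarrow> ('m, 'e) chart \<Rightarrow> bool" where
  "flat_chart A nabla C \<longleftrightarrow>
     diffeo_on A std_atlas (fst C) (snd C) \<and>
     (\<forall>u. \<forall>p\<in>fst C. \<forall>v. nabla (coord_field A C u) p v = 0)"

text \<open>Preservation of connections is expressed through pairs of vector fields \<open>Y\<close>, \<open>Y'\<close> related by
  the differential of \<open>f\<close>, so that the push-forward of \<open>Y\<close> need not be written out.\<close>

definition affine_diffeo_on ::
  "('m::topological_space, 'e::euclidean_space) chart set \<Rightarrow> ('m, 'e) conn \<Rightarrow>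
   ('n::topological_space, 'f::euclidean_space) chart set \<Rightarrow> ('n, 'f) conn \<Rightarrow>
   'm set \<Rightarrow> ('m \<Rightarrow> 'n) \<Rightarrow> bool" where
  "affine_diffeo_on A nabla B nabla' W f \<longleftrightarrow>
     diffeo_on A B W f \<and>
     (\<forall>V Y Y'. open V \<and> V \<subseteq> W \<and> smooth_field_on A V Y \<and> smooth_field_on B (f ` V) Y' \<and>
        (\<forall>p\<in>V. tangent_map A B f p (Y p) = Y' (f p)) \<longrightarrow>
        (\<forall>p\<in>V. \<forall>v. tangent_map A B f p (nabla Y p v) = nabla' Y' (f p) (tangent_map A B f p v)))"

definition development ::
  "('m::topological_space, 'e::euclidean_space) chart set \<Rightarrow> ('m, 'e) conn \<Rightarrow> ('m \<Rightarrow> 'e) \<Rightarrow> bool" where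
  "development A nabla dev \<longleftrightarrow>
     (\<forall>p. \<exists>U. p \<in> U \<and> affine_diffeo_on A nabla std_atlas std_connection U dev)"

definition integral_curve ::
  "('m::topological_space, 'e::euclidean_space) chart set \<Rightarrow> ('m \<Rightarrow> 'e) \<Rightarrow> real set \<Rightarrow> (real \<Rightarrow> 'm) \<Rightarrow> bool" where
  "integral_curve A X T c \<longleftrightarrow>
     smooth_map_on std_atlas A T c \<and> (\<forall>t\<in>T. tangent_map std_atlas A c t 1 = X (c t))"

definition local_flow ::
  "('m::topological_space, 'e::euclidean_space) chart set \<Rightarrow> ('m \<Rightarrow> 'e) \<Rightarrow> real \<Rightarrow> 'm set \<Rightarrow>
   (real \<Rightarrow> 'm \<Rightarrow> 'm) \<Rightarrow> bool" where
  "local_flow A X \<epsilon> W F \<longleftrightarrow>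
     0 < \<epsilon> \<and> open W \<and>
     smooth_map_on (prod_atlas std_atlas A) A ({-\<epsilon><..<\<epsilon>} \<times> W) (\<lambda>(t, p). F t p) \<and>
     (\<forall>p\<in>W. F 0 p = p \<and> integral_curve A X {-\<epsilon><..<\<epsilon>} (\<lambda>t. F t p))"

text \<open>The flow is unique as a germ, so it does not matter that the local flow below is only required to
  exist and not quantified universally.\<close>

definition affine_field ::
  "('m::topological_space, 'e::euclidean_space) chart set \<Rightarrow> ('m, 'e) conn \<Rightarrow> ('m \<Rightarrow> 'e) \<Rightarrow> bool" where
  "affine_field A nabla X \<longleftrightarrow>
     smooth_field_on A UNIV X \<and>
     (\<forall>p. \<exists>\<epsilon> W F. p \<in> W \<and> local_flow A X \<epsilon> W F \<and>
        (\<forall>t\<in>{-\<epsilon><..<\<epsilon>}. affine_diffeo_on A nabla A nabla W (F t)))"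

definition complete_field ::
  "('m::topological_space, 'e::euclidean_space) chart set \<Rightarrow> ('m \<Rightarrow> 'e) \<Rightarrow> bool" where
  "complete_field A X \<longleftrightarrow> (\<forall>p. \<exists>c. c 0 = p \<and> integral_curve A X UNIV c)"

text \<open>Meaningful for complete fields, whose integral curves on the whole line are unique.\<close>

definition exp_flow ::
  "('m::topological_space, 'e::euclidean_space) chart set \<Rightarrow> ('m \<Rightarrow> 'e) \<Rightarrow> real \<Rightarrow> 'm \<Rightarrow> 'm" where
  "exp_flow A X t p = (THE c. c 0 = p \<and> integral_curve A X UNIV c) t"

definition hessian_manifold ::
  "('m::{t2_space,second_countable_topology}, 'e::euclidean_space) chart set \<Rightarrow> ('m, 'e) conn \<Rightarrow>
   ('m \<Rightarrow> 'e \<Rightarrow> 'e \<Rightarrow> real) \<Rightarrow> bool" where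
  "hessian_manifold A nabla g \<longleftrightarrow>
     flat_affine_manifold A nabla \<and> riemannian_metric A g \<and>
     (\<forall>p. \<exists>C \<phi>. p \<in> fst C \<and> flat_chart A nabla C \<and> smooth_on (snd C ` fst C) \<phi> \<and>
        (\<forall>q\<in>fst C. \<forall>u v. g q (coord_field A C u q) (coord_field A C v q) =
           frechet_derivative (\<lambda>x. frechet_derivative \<phi> (at x) v) (at (snd C q)) u))"

definition selfsimilar_hessian_manifold ::
  "('m::{t2_space,second_countable_topology}, 'e::euclidean_space) chart set \<Rightarrow> ('m, 'e) conn \<Rightarrow>
   ('m \<Rightarrow> 'e \<Rightarrow> 'e \<Rightarrow> real) \<Rightarrow> ('m \<Rightarrow> 'e) \<Rightarrow> bool" where
  "selfsimilar_hessian_manifold A nabla g \<xi> \<longleftrightarrow>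
     hessian_manifold A nabla g \<and> affine_field A nabla \<xi> \<and>
     (\<forall>W Y Z. open W \<and> smooth_field_on A W Y \<and> smooth_field_on A W Z \<longrightarrow>
        (\<forall>p\<in>W. lie_derivative A \<xi> g Y Z p = 2 * g p (Y p) (Z p)))"

definition isometry_group ::
  "('m::topological_space, 'e::euclidean_space) chart set \<Rightarrow> ('m, 'e) conn \<Rightarrow>
   ('m \<Rightarrow> 'e \<Rightarrow> 'e \<Rightarrow> real) \<Rightarrow> ('m \<Rightarrow> 'e) \<Rightarrow> ('m \<Rightarrow> 'm) monoid" where
  "isometry_group A nabla g \<xi> =
     \<lparr>carrier = {f. surj f \<and> affine_diffeo_on A nabla A nabla UNIV f \<and>
                    pullback_form A A f g = g \<and>
                    (\<forall>p. tangent_map A A f p (\<xi> p) = \<xi> (f p))},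
      mult = (\<circ>), one = id\<rparr>"

definition real_add_group :: "real monoid" where
  "real_add_group = \<lparr>carrier = UNIV, mult = (+), one = 0\<rparr>"

definition flow_action ::
  "('m::topological_space, 'e::euclidean_space) chart set \<Rightarrow> ('m \<Rightarrow> 'e) \<Rightarrow> real \<times> ('m \<Rightarrow> 'm) \<Rightarrow> 'm \<Rightarrow> 'm" where
  "flow_action A \<xi> = (\<lambda>(t, a). exp_flow A \<xi> t \<circ> a)"

definition linear_part :: "('e::real_vector \<Rightarrow> 'e) \<Rightarrow> 'e \<Rightarrow> 'e" where
  "linear_part T v = T v - T 0"

definition affine_map :: "('e::real_vector \<Rightarrow> 'e) \<Rightarrow> bool" where
  "affine_map T \<longleftrightarrow> linear (linear_part T)"

text \<open>Uniqueness holds because the image of a development map is open.\<close>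

definition induced_affine :: "('m \<Rightarrow> 'e::real_vector) \<Rightarrow> ('m \<Rightarrow> 'm) \<Rightarrow> 'e \<Rightarrow> 'e" where
  "induced_affine dev f = (THE T. affine_map T \<and> dev \<circ> f = T \<circ> dev)"

definition semidirect ::
  "'h monoid \<Rightarrow> ('h \<Rightarrow> 'e::real_vector \<Rightarrow> 'e) \<Rightarrow> ('h \<times> 'e) monoid" where
  "semidirect H \<theta> =
     \<lparr>carrier = carrier H \<times> UNIV,
      mult = (\<lambda>(a, u) (b, w). (a \<otimes>\<^bsub>H\<^esub> b, u + linear_part (\<theta> a) w)),
      one = (\<one>\<^bsub>H\<^esub>, 0)\<rparr>"

definition semidirect_action ::
  "('h \<Rightarrow> 'm \<Rightarrow> 'm) \<Rightarrow> ('h \<Rightarrow> 'e::real_vector \<Rightarrow> 'e) \<Rightarrow> 'h \<times> 'e \<Rightarrow> 'm \<times> 'e \<Rightarrow> 'm \<times> 'e" where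
  "semidirect_action \<phi> \<theta> = (\<lambda>(a, u) (m, v). (\<phi> a m, \<theta> a v + u))"

text \<open>Integrability means that around every point there are coordinates in which \<open>I\<close> is a constant
  linear complex structure \<open>J\<close>, i.e. coordinates with values in the complex vector space
  \<open>('f, J)\<close> that are holomorphic for \<open>I\<close>.\<close>

definition complex_structure ::
  "('n::topological_space, 'f::euclidean_space) chart set \<Rightarrow> ('n \<Rightarrow> 'f \<Rightarrow> 'f) \<Rightarrow> bool" where
  "complex_structure B I \<longleftrightarrow>
     smooth_endomorphism_field B I \<and> (\<forall>p v. I p (I p v) = - v) \<and>
     (\<forall>p. \<exists>U (c :: 'n \<Rightarrow> 'f) J. p \<in> U \<and> diffeo_on B std_atlas U c \<and> linear J \<and> (\<forall>x. J (J x) = - x) \<and>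
        (\<forall>q\<in>U. \<forall>v. tangent_map B std_atlas c q (I q v) = J (tangent_map B std_atlas c q v)))"

definition closed_2form ::
  "('n::topological_space, 'f::euclidean_space) chart set \<Rightarrow> ('n \<Rightarrow> 'f \<Rightarrow> 'f \<Rightarrow> real) \<Rightarrow> bool" where
  "closed_2form B \<omega> \<longleftrightarrow>
     smooth_bilinear_field B \<omega> \<and> (\<forall>p u v. \<omega> p u v = - \<omega> p v u) \<and>
     (\<forall>W X Y Z. open W \<and> smooth_field_on B W X \<and> smooth_field_on B W Y \<and> smooth_field_on B W Z \<longrightarrow>
        (\<forall>p\<in>W.
           dir_deriv B (\<lambda>q. \<omega> q (Y q) (Z q)) p (X p)
         - dir_deriv B (\<lambda>q. \<omega> q (X q) (Z q)) p (Y p)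
         + dir_deriv B (\<lambda>q. \<omega> q (X q) (Y q)) p (Z p)
         - \<omega> p (lie_bracket B X Y p) (Z p)
         + \<omega> p (lie_bracket B X Z p) (Y p)
         - \<omega> p (lie_bracket B Y Z p) (X p) = 0))"

text \<open>Sign convention: the Kaehler form of a Hermitian metric \<open>h\<close> is \<open>\<omega>(X, Y) = h(IX, Y)\<close>, so that
  \<open>h(X, Y) = \<omega>(X, IY)\<close>.\<close>

definition kaehler_structure ::
  "('n::{t2_space,second_countable_topology}, 'f::euclidean_space) chart set \<Rightarrow>
   ('n \<Rightarrow> 'f \<Rightarrow> 'f) \<Rightarrow> ('n \<Rightarrow> 'f \<Rightarrow> 'f \<Rightarrow> real) \<Rightarrow> bool" where
  "kaehler_structure B I \<omega> \<longleftrightarrow>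
     smooth_manifold B \<and> complex_structure B I \<and> closed_2form B \<omega> \<and>
     (\<forall>p u v. \<omega> p (I p u) (I p v) = \<omega> p u v) \<and> (\<forall>p u. u \<noteq> 0 \<longrightarrow> \<omega> p u (I p u) > 0)"

definition conformally_kaehler ::
  "('n::{t2_space,second_countable_topology}, 'f::euclidean_space) chart set \<Rightarrow>
   ('n \<Rightarrow> 'f \<Rightarrow> 'f) \<Rightarrow> ('n \<Rightarrow> 'f \<Rightarrow> 'f \<Rightarrow> real) \<Rightarrow> bool" where
  "conformally_kaehler B I \<eta> \<longleftrightarrow>
     (\<exists>\<omega> f. kaehler_structure B I \<omega> \<and> smooth_map_on B std_atlas UNIV f \<and> (\<forall>p. f p > 0) \<and>
        \<eta> = (\<lambda>p u v. f p * \<omega> p u v))"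

definition invariant_structure ::
  "('n::topological_space, 'f::euclidean_space) chart set \<Rightarrow> 'h monoid \<Rightarrow> ('h \<Rightarrow> 'n \<Rightarrow> 'n) \<Rightarrow>
   ('n \<Rightarrow> 'f \<Rightarrow> 'f) \<Rightarrow> ('n \<Rightarrow> 'f \<Rightarrow> 'f \<Rightarrow> real) \<Rightarrow> bool" where
  "invariant_structure B H \<psi> I \<eta> \<longleftrightarrow>
     group_action H UNIV \<psi> \<and>
     (\<forall>h\<in>carrier H.
        diffeo_on B B UNIV (\<psi> h) \<and>
        (\<forall>p v. tangent_map B B (\<psi> h) p (I p v) = I (\<psi> h p) (tangent_map B B (\<psi> h) p v)) \<and>
        pullback_form B B (\<psi> h) \<eta> = \<eta>)"

definition homogeneous_conformally_kaehler ::
  "('n::{t2_space,second_countable_topology}, 'f::euclidean_space) chart set \<Rightarrow> 'h monoid \<Rightarrow>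
   ('h \<Rightarrow> 'n \<Rightarrow> 'n) \<Rightarrow> ('n \<Rightarrow> 'f \<Rightarrow> 'f) \<Rightarrow> ('n \<Rightarrow> 'f \<Rightarrow> 'f \<Rightarrow> real) \<Rightarrow> bool" where
  "homogeneous_conformally_kaehler B H \<psi> I \<eta> \<longleftrightarrow>
     conformally_kaehler B I \<eta> \<and> invariant_structure B H \<psi> I \<eta> \<and> transitive_action H UNIV \<psi>"

text \<open>The tangent bundle is \<open>'m \<times> 'e\<close>, a tangent vector \<open>w\<close> at \<open>m\<close> corresponding to
  \<open>(m, d dev\<^sub>m(w))\<close>.\<close>

definition tb_atlas :: "('m, 'e) chart set \<Rightarrow> ('m \<times> 'e, 'e \<times> 'e) chart set" where
  "tb_atlas A = prod_atlas A std_atlas"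

text \<open>\<open>tb_frame A dev z\<close> writes a tangent vector of \<open>'m \<times> 'e\<close> at \<open>z\<close> as \<open>X \<times> Y\<close>; in these
  terms \<open>I(X \<times> Y) = (-Y) \<times> X\<close>.\<close>

definition tb_frame ::
  "('m, 'e::euclidean_space) chart set \<Rightarrow> ('m \<Rightarrow> 'e) \<Rightarrow> 'm \<times> 'e \<Rightarrow> 'e \<times> 'e \<Rightarrow> 'e \<times> 'e" where
  "tb_frame A dev = tangent_map (tb_atlas A) std_atlas (map_prod dev id)"

definition tb_complex ::
  "('m, 'e::euclidean_space) chart set \<Rightarrow> ('m \<Rightarrow> 'e) \<Rightarrow> 'm \<times> 'e \<Rightarrow> 'e \<times> 'e \<Rightarrow> 'e \<times> 'e" where
  "tb_complex A dev z w = inv_into UNIV (tb_frame A dev z) ((\<lambda>(X, Y). (- Y, X)) (tb_frame A dev z w))"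

definition tb_metric ::
  "('m, 'e::euclidean_space) chart set \<Rightarrow> ('m \<Rightarrow> 'e) \<Rightarrow> ('m \<Rightarrow> 'e \<Rightarrow> 'e \<Rightarrow> real) \<Rightarrow>
   'm \<times> 'e \<Rightarrow> 'e \<times> 'e \<Rightarrow> 'e \<times> 'e \<Rightarrow> real" where
  "tb_metric A dev g z v w =
     pullback_form (tb_atlas A) A fst g z v w +
     pullback_form (tb_atlas A) A fst g z (tb_complex A dev z v) (tb_complex A dev z w)"

definition tb_form ::
  "('m, 'e::euclidean_space) chart set \<Rightarrow> ('m \<Rightarrow> 'e) \<Rightarrow> ('m \<Rightarrow> 'e \<Rightarrow> 'e \<Rightarrow> real) \<Rightarrow>
   'm \<times> 'e \<Rightarrow> 'e \<times> 'e \<Rightarrow> 'e \<times> 'e \<Rightarrow> real" where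
  "tb_form A dev g z v w = tb_metric A dev g z (tb_complex A dev z v) w"

definition tb_cK_form ::
  "('m, 'e::euclidean_space) chart set \<Rightarrow> ('m \<Rightarrow> 'e) \<Rightarrow> ('m \<Rightarrow> 'e \<Rightarrow> 'e \<Rightarrow> real) \<Rightarrow> ('m \<Rightarrow> 'e) \<Rightarrow>
   'm \<times> 'e \<Rightarrow> 'e \<times> 'e \<Rightarrow> 'e \<times> 'e \<Rightarrow> real" where
  "tb_cK_form A dev g \<xi> z v w =
     inverse (g (fst z) (\<xi> (fst z)) (\<xi> (fst z))) * tb_form A dev g z v w"

end

theory Submission
  imports Defs
begin

text \<open>
  In the frames given by the differential of \<open>dev\<close>, the connection is the ordinary derivative.  Hence
  a diffeomorphism is affine if and only if its differential is a constant matrix in these frames, and it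
  then covers an affine map of the model space.  Let \<open>H\<close> be the matrix of \<open>g\<close> in the frames.  The
  Hessian condition says that the derivative of \<open>H\<close> is totally symmetric, which is exactly the
  closedness of \<open>\<omega>(X \<times> Y, X' \<times> Y') = H(X, Y') - H(Y, X')\<close>.

  If an affine diffeomorphism preserves \<open>\<xi>\<close> and multiplies \<open>g\<close> by a constant \<open>c\<close>, then its lifts to the
  tangent bundle commute with \<open>I\<close> and multiply both \<open>\<omega>\<close> and \<open>g(\<xi>, \<xi>)\<close> by \<open>c\<close>, so that they preserve the
  quotient.  For isometries \<open>c = 1\<close>.  The flow at time \<open>t\<close> is affine, being a composition of
  local affine flows, and has \<open>c = exp (2 t)\<close> because the Lie derivative of \<open>g\<close> is \<open>2 g\<close>.  Along
  the flow every point reaches the level surface \<open>g(\<xi>, \<xi>) = 1\<close>, and the translations act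
  transitively on the fibres of the tangent bundle.
\<close>

section \<open>Smooth functions between Euclidean spaces\<close>

text \<open>The obstacle is that a tangent vector is stored by its components in a chart picked
  point by point, so the components of a smooth field may jump. The differential of
  \<open>dev\<close> is one frame for the whole manifold, and a field is smooth exactly when its
  frame components are. The product of \<open>dev\<close> with the identity does the same for the
  tangent bundle, so the calculus is developed once, for an abstract local diffeomorphism to a
  vector space.

  The flow \<open>exp_flow\<close> is a definite description of integral curves and says nothing
  about the dependence on the starting point. Uniqueness of integral curves identifies it with the
  local affine flows; smoothness at all times is then a consequence of affinity.

  A lift acts on the developed base point and on the fibre through one and the same affine map, up
  to a translation. Its matrix is therefore twice the same linear part, which is why it commutes
  with the rotation that defines \<open>I\<close>. Simple connectedness enters as connectedness,
  which makes locally constant matrices constant.\<close>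

lemma Ck_on_subset: "Ck_on k S f \<Longrightarrow> T \<subseteq> S \<Longrightarrow> Ck_on k T f"
  by (induction k arbitrary: f) (auto intro: continuous_on_subset)

lemma Ck_on_SucD: "Ck_on (Suc k) S f \<Longrightarrow> Ck_on k S f"
proof (induction k arbitrary: f)
  case 0
  then show ?case
    by (auto intro!: continuous_at_imp_continuous_on differentiable_imp_continuous_within)
next
  case (Suc k)
  then show ?case by (metis Ck_on.simps(2))
qed

text \<open>On an open set equality of values is equality of germs, so the derivatives agree as well
  and the induction can pass to them.\<close>

lemma Ck_on_cong:
  assumes "open S" "\<And>x. x \<in> S \<Longrightarrow> f x = g x" "Ck_on k S f"
  shows "Ck_on k S g"
  using assms(2,3)
proof (induction k arbitrary: f g)
  case 0
  then show ?case by (simp cong: continuous_on_cong)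
next
  case (Suc k)
  have d: "f differentiable (at x)" "g differentiable (at x)"
    "frechet_derivative f (at x) = frechet_derivative g (at x)" if "x \<in> S" for x
  proof -
    show f: "f differentiable (at x)" using Suc.prems that by auto
    show "g differentiable (at x)"
      using f has_derivative_transform_within_open[OF _ assms(1) that] Suc.prems(1)
      unfolding differentiable_def by blast
    show "frechet_derivative f (at x) = frechet_derivative g (at x)"
      using frechet_derivative_transform_within_open[OF f assms(1) that] Suc.prems(1) by blast
  qed
  have "Ck_on k S (\<lambda>x. frechet_derivative g (at x) v)" for v
    using Suc.IH[of "\<lambda>x. frechet_derivative f (at x) v" "\<lambda>x. frechet_derivative g (at x) v"]
      d Suc.prems by auto
  then show ?case using d by auto
qed

text \<open>The derivatives in \<open>Ck_on\<close> are taken in the whole space and not within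
  \<open>S\<close>, so the condition at a point can be checked on any open neighbourhood and
  \<open>S\<close> may be arbitrary.\<close>

lemma Ck_on_local:
  assumes "\<And>x. x \<in> S \<Longrightarrow> \<exists>U. open U \<and> x \<in> U \<and> Ck_on k U f"
  shows "Ck_on k S f"
  using assms
proof (induction k arbitrary: f)
  case 0
  then show ?case
    by (metis Ck_on.simps(1) continuous_at_imp_continuous_on continuous_on_eq_continuous_at)
next
  case (Suc k)
  have "Ck_on k S (\<lambda>x. frechet_derivative f (at x) v)" for v
    using Suc.prems by (intro Suc.IH) (metis Ck_on.simps(2))
  moreover have "f differentiable (at x)" if "x \<in> S" for x
    using Suc.prems[OF that] by auto
  ultimately show ?case by auto
qed

lemma Ck_on_const: "Ck_on k S (\<lambda>x. c)"
  by (induction k arbitrary: c) (auto simp: frechet_derivative_const)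

lemma Ck_on_bounded_linear_id:
  assumes "bounded_linear L"
  shows "Ck_on k S L"
proof (cases k)
  case 0
  then show ?thesis using assms by (simp add: linear_continuous_on)
next
  case (Suc j)
  have d: "(L has_derivative L) (at x)" for x
    using assms by (rule bounded_linear_imp_has_derivative)
  then have "frechet_derivative L (at x) = L" for x using frechet_derivative_at by metis
  then show ?thesis using d by (auto simp: Suc Ck_on_const differentiable_def)
qed

lemma Ck_on_bounded_linear:
  assumes "open S" "bounded_linear L" "Ck_on k S f"
  shows "Ck_on k S (\<lambda>x. L (f x))"
  using assms(3)
proof (induction k arbitrary: f)
  case 0
  then show ?case using bounded_linear.continuous_on[OF assms(2)] by simp
next
  case (Suc k)
  have d: "((\<lambda>x. L (f x)) has_derivative (\<lambda>v. L (frechet_derivative f (at x) v))) (at x)"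
    if "x \<in> S" for x
    using bounded_linear.has_derivative[OF assms(2)] Suc.prems that frechet_derivative_works
    by (metis Ck_on.simps(2))
  then have e: "frechet_derivative (\<lambda>x. L (f x)) (at x) = (\<lambda>v. L (frechet_derivative f (at x) v))"
    if "x \<in> S" for x using frechet_derivative_at that by metis
  have "Ck_on k S (\<lambda>x. frechet_derivative (\<lambda>x. L (f x)) (at x) v)" for v
    by (rule Ck_on_cong[OF assms(1) _ Suc.IH[of "\<lambda>x. frechet_derivative f (at x) v"]])
      (use e Suc.prems in auto)
  then show ?case using d by (auto simp: differentiable_def)
qed

lemma Ck_on_add:
  assumes "open S" "Ck_on k S f" "Ck_on k S g"
  shows "Ck_on k S (\<lambda>x. f x + g x)"
  using assms(2,3)
proof (induction k arbitrary: f g)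
  case 0
  then show ?case by (simp add: continuous_on_add)
next
  case (Suc k)
  have d: "((\<lambda>x. f x + g x) has_derivative
      (\<lambda>v. frechet_derivative f (at x) v + frechet_derivative g (at x) v)) (at x)" if "x \<in> S" for x
    by (rule has_derivative_add) (use Suc.prems that in \<open>simp_all add: frechet_derivative_works\<close>)
  then have e: "frechet_derivative (\<lambda>x. f x + g x) (at x) =
      (\<lambda>v. frechet_derivative f (at x) v + frechet_derivative g (at x) v)" if "x \<in> S" for x
    using frechet_derivative_at that by metis
  have "Ck_on k S (\<lambda>x. frechet_derivative (\<lambda>x. f x + g x) (at x) v)" for v
    by (rule Ck_on_cong[OF assms(1) _ Suc.IH[of "\<lambda>x. frechet_derivative f (at x) v"
      "\<lambda>x. frechet_derivative g (at x) v"]]) (use e Suc.prems in auto)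
  then show ?case using d by (auto simp: differentiable_def)
qed

lemma Ck_on_sum:
  assumes "open S" "finite I" "\<And>i. i \<in> I \<Longrightarrow> Ck_on k S (f i)"
  shows "Ck_on k S (\<lambda>x. \<Sum>i\<in>I. f i x)"
  using assms(2,3) by (induction I) (auto intro: Ck_on_const Ck_on_add assms(1))

lemma Ck_on_bilinear:
  assumes "open S" "bounded_bilinear B" "Ck_on k S f" "Ck_on k S g"
  shows "Ck_on k S (\<lambda>x. B (f x) (g x))"
  using assms(3,4)
proof (induction k arbitrary: f g)
  case 0
  then show ?case by (simp add: bounded_bilinear.continuous_on[OF assms(2)])
next
  case (Suc k)
  have d: "((\<lambda>x. B (f x) (g x)) has_derivative
      (\<lambda>v. B (f x) (frechet_derivative g (at x) v) + B (frechet_derivative f (at x) v) (g x))) (at x)"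
    if "x \<in> S" for x
    by (rule bounded_bilinear.FDERIV[OF assms(2)])
      (use Suc.prems that in \<open>simp_all add: frechet_derivative_works\<close>)
  have e: "frechet_derivative (\<lambda>x. B (f x) (g x)) (at x) =
      (\<lambda>v. B (f x) (frechet_derivative g (at x) v) + B (frechet_derivative f (at x) v) (g x))"
    if "x \<in> S" for x
    by (rule frechet_derivative_at[OF d[OF that], symmetric])
  have "Ck_on k S (\<lambda>x. B (f x) (frechet_derivative g (at x) v) + B (frechet_derivative f (at x) v) (g x))"
    for v
    by (rule Ck_on_add[OF assms(1)
          Suc.IH[of f "\<lambda>x. frechet_derivative g (at x) v"]
          Suc.IH[of "\<lambda>x. frechet_derivative f (at x) v" g]])
      (use Suc.prems Ck_on_SucD[OF Suc.prems(1)] Ck_on_SucD[OF Suc.prems(2)] in simp_all)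
  then have "Ck_on k S (\<lambda>x. frechet_derivative (\<lambda>x. B (f x) (g x)) (at x) v)" for v
    by (rule Ck_on_cong[OF assms(1), rotated]) (use e in auto)
  then show ?case using d by (auto simp: differentiable_def)
qed

text \<open>\<open>Ck_on\<close> controls derivatives in fixed directions, but the chain rule
  produces directions that vary with the point. Expanding the direction in the basis gives a finite
  sum of products of controlled functions.\<close>

lemma has_derivative_basis_sum:
  fixes f :: "'a::euclidean_space \<Rightarrow> 'b::real_normed_vector"
  assumes "f differentiable (at x)"
  shows "frechet_derivative f (at x) v = (\<Sum>b\<in>Basis. (v \<bullet> b) *\<^sub>R frechet_derivative f (at x) b)"
proof -
  interpret linear "frechet_derivative f (at x)" using assms by (rule linear_frechet_derivative)
  have "frechet_derivative f (at x) (\<Sum>b\<in>Basis. (v \<bullet> b) *\<^sub>R b) =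
    (\<Sum>b\<in>Basis. (v \<bullet> b) *\<^sub>R frechet_derivative f (at x) b)"
    by (simp add: sum scaleR)
  then show ?thesis by (simp add: euclidean_representation)
qed

text \<open>The induction varies \<open>g\<close> and keeps \<open>f\<close>: the derivative of the
  composition is a sum of components of the derivative of \<open>f\<close> times partial derivatives
  of \<open>g\<close> after \<open>f\<close>, and the latter are compositions of lower
  order.\<close>

lemma Ck_on_compose:
  fixes f :: "'a::real_normed_vector \<Rightarrow> 'b::euclidean_space"
  assumes "open S" "open T" "f ` S \<subseteq> T" "Ck_on k S f" "Ck_on k T g"
  shows "Ck_on k S (\<lambda>x. g (f x))"
  using assms(3-)
proof (induction k arbitrary: g)
  case 0
  then show ?case using continuous_on_compose2[of T g S f] by simp
next
  case (Suc k)
  have d: "((\<lambda>x. g (f x)) has_derivative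
      (\<lambda>v. frechet_derivative g (at (f x)) (frechet_derivative f (at x) v))) (at x)" if "x \<in> S" for x
    using has_derivative_compose[of f "frechet_derivative f (at x)" x UNIV g
        "frechet_derivative g (at (f x))"] Suc.prems that
    by (auto simp: frechet_derivative_works image_subset_iff)
  have e: "frechet_derivative (\<lambda>x. g (f x)) (at x) v =
      (\<Sum>b\<in>Basis. (frechet_derivative f (at x) v \<bullet> b) *\<^sub>R frechet_derivative g (at (f x)) b)"
    if "x \<in> S" for x v
  proof -
    have "g differentiable at (f x)" using Suc.prems that by auto
    then show ?thesis using frechet_derivative_at[OF d[OF that]] has_derivative_basis_sum by metis
  qed
  have "Ck_on k S (\<lambda>x. \<Sum>b\<in>Basis. (frechet_derivative f (at x) v \<bullet> b) *\<^sub>R frechet_derivative g (at (f x)) b)"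
    for v
  proof (intro Ck_on_sum assms(1) finite_Basis Ck_on_bilinear[OF _ bounded_bilinear_scaleR])
    fix b :: 'b
    show "Ck_on k S (\<lambda>x. frechet_derivative f (at x) v \<bullet> b)"
      using Suc.prems by (intro Ck_on_bounded_linear[OF assms(1) bounded_linear_inner_left]) auto
    show "Ck_on k S (\<lambda>x. frechet_derivative g (at (f x)) b)"
      using Suc.prems Ck_on_SucD[OF Suc.prems(2)]
      by (intro Suc.IH[of "\<lambda>y. frechet_derivative g (at y) b"]) auto
  qed
  then have "Ck_on k S (\<lambda>x. frechet_derivative (\<lambda>x. g (f x)) (at x) v)" for v
    by (rule Ck_on_cong[OF assms(1), rotated]) (use e in auto)
  then show ?case using d by (auto simp: differentiable_def)
qed

text \<open>The derivative of the reciprocal is a polynomial in the reciprocal, so the induction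
  closes on the same function.\<close>

lemma Ck_on_inverse: "Ck_on k {x::real. x \<noteq> 0} inverse"
proof (induction k)
  case 0
  then show ?case by (auto intro!: continuous_intros)
next
  case (Suc k)
  have S: "open {x::real. x \<noteq> 0}" by (simp add: open_Collect_neq continuous_on_id)
  have d: "(inverse has_derivative (\<lambda>v. - (inverse x * v * inverse x))) (at x)"
    if "x \<noteq> 0" for x :: real
    using that by (rule has_derivative_inverse')
  have "Ck_on k {x::real. x \<noteq> 0} (\<lambda>x. (- v) *\<^sub>R (inverse x * inverse x))" for v
    by (intro Ck_on_bilinear[OF S bounded_bilinear_scaleR] Ck_on_const
        Ck_on_bilinear[OF S bounded_bilinear_mult] Suc)
  then have "Ck_on k {x::real. x \<noteq> 0} (\<lambda>x. frechet_derivative inverse (at x) v)" for v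
    by (rule Ck_on_cong[OF S, rotated])
      (use frechet_derivative_at[OF d] in \<open>auto simp: mult_ac dest!: fun_cong[of _ _ v]\<close>)
  then show ?case using d by (auto simp: differentiable_def)
qed

lemma smooth_on_subset: "smooth_on S f \<Longrightarrow> T \<subseteq> S \<Longrightarrow> smooth_on T f"
  unfolding smooth_on_def using Ck_on_subset by blast

lemma smooth_on_cong:
  "open S \<Longrightarrow> (\<And>x. x \<in> S \<Longrightarrow> f x = g x) \<Longrightarrow> smooth_on S f \<Longrightarrow> smooth_on S g"
  unfolding smooth_on_def using Ck_on_cong by blast

lemma smooth_on_local:
  "(\<And>x. x \<in> S \<Longrightarrow> \<exists>U. open U \<and> x \<in> U \<and> smooth_on U f) \<Longrightarrow> smooth_on S f"
  unfolding smooth_on_def by (meson Ck_on_local)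

lemma smooth_on_const: "smooth_on S (\<lambda>x. c)"
  unfolding smooth_on_def using Ck_on_const by blast

lemma smooth_on_linear: "bounded_linear L \<Longrightarrow> smooth_on S L"
  unfolding smooth_on_def using Ck_on_bounded_linear_id by blast

lemma smooth_on_ident: "smooth_on S (\<lambda>x. x)"
  by (rule smooth_on_linear) (rule bounded_linear_ident)

lemma smooth_on_bounded_linear:
  "open S \<Longrightarrow> bounded_linear L \<Longrightarrow> smooth_on S f \<Longrightarrow> smooth_on S (\<lambda>x. L (f x))"
  unfolding smooth_on_def using Ck_on_bounded_linear by blast

lemma smooth_on_add:
  "open S \<Longrightarrow> smooth_on S f \<Longrightarrow> smooth_on S g \<Longrightarrow> smooth_on S (\<lambda>x. f x + g x)"
  unfolding smooth_on_def using Ck_on_add by blast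

lemma smooth_on_minus: "open S \<Longrightarrow> smooth_on S f \<Longrightarrow> smooth_on S (\<lambda>x. - f x)"
  by (rule smooth_on_bounded_linear[OF _ bounded_linear_minus[OF bounded_linear_ident]])

lemma smooth_on_diff:
  "open S \<Longrightarrow> smooth_on S f \<Longrightarrow> smooth_on S g \<Longrightarrow> smooth_on S (\<lambda>x. f x - g x)"
  using smooth_on_add[of S f "\<lambda>x. - g x"] smooth_on_minus by auto

lemma smooth_on_sum:
  "open S \<Longrightarrow> finite I \<Longrightarrow> (\<And>i. i \<in> I \<Longrightarrow> smooth_on S (f i)) \<Longrightarrow> smooth_on S (\<lambda>x. \<Sum>i\<in>I. f i x)"
  unfolding smooth_on_def using Ck_on_sum by blast

lemma smooth_on_bilinear:
  "open S \<Longrightarrow> bounded_bilinear B \<Longrightarrow> smooth_on S f \<Longrightarrow> smooth_on S g \<Longrightarrow>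
    smooth_on S (\<lambda>x. B (f x) (g x))"
  unfolding smooth_on_def using Ck_on_bilinear by blast

lemma smooth_on_compose:
  fixes f :: "'a::real_normed_vector \<Rightarrow> 'b::euclidean_space"
  shows "open S \<Longrightarrow> open T \<Longrightarrow> f ` S \<subseteq> T \<Longrightarrow> smooth_on S f \<Longrightarrow> smooth_on T g \<Longrightarrow>
    smooth_on S (\<lambda>x. g (f x))"
  unfolding smooth_on_def using Ck_on_compose by blast

lemma smooth_on_inverse:
  fixes f :: "'a::real_normed_vector \<Rightarrow> real"
  assumes "open S" "smooth_on S f" "\<And>x. x \<in> S \<Longrightarrow> f x \<noteq> 0"
  shows "smooth_on S (\<lambda>x. inverse (f x))"
  by (rule smooth_on_compose[OF assms(1) _ _ assms(2), of "{x. x \<noteq> 0}"])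
    (use assms(3) Ck_on_inverse in
      \<open>auto simp: smooth_on_def open_Collect_neq continuous_on_id\<close>)

lemma smooth_on_differentiable: "smooth_on S f \<Longrightarrow> x \<in> S \<Longrightarrow> f differentiable (at x)"
  unfolding smooth_on_def by (metis Ck_on.simps(2))

lemma smooth_on_has_derivative:
  "smooth_on S f \<Longrightarrow> x \<in> S \<Longrightarrow> (f has_derivative frechet_derivative f (at x)) (at x)"
  using smooth_on_differentiable frechet_derivative_works by blast

lemma smooth_on_continuous: "smooth_on S f \<Longrightarrow> continuous_on S f"
  unfolding smooth_on_def by (metis Ck_on.simps(1))

lemma smooth_on_frechet: "smooth_on S f \<Longrightarrow> smooth_on S (\<lambda>x. frechet_derivative f (at x) v)"
  unfolding smooth_on_def by (metis Ck_on.simps(2))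

lemma smooth_on_frechet_apply:
  fixes f :: "'a::euclidean_space \<Rightarrow> 'b::real_normed_vector"
  assumes "open S" "smooth_on S f" "smooth_on S v"
  shows "smooth_on S (\<lambda>x. frechet_derivative f (at x) (v x))"
proof (rule smooth_on_cong[OF assms(1)])
  show "smooth_on S (\<lambda>x. \<Sum>b\<in>Basis. (v x \<bullet> b) *\<^sub>R frechet_derivative f (at x) b)"
    by (intro smooth_on_sum assms(1) finite_Basis smooth_on_bilinear[OF _ bounded_bilinear_scaleR]
        smooth_on_bounded_linear[OF _ bounded_linear_inner_left] smooth_on_frechet assms)
qed (metis assms(2) has_derivative_basis_sum smooth_on_differentiable)

lemma smooth_on_Pair:
  assumes "open S" "smooth_on S f" "smooth_on S g"
  shows "smooth_on S (\<lambda>x. (f x, g x))"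
proof -
  have "bounded_linear (\<lambda>x. (x, 0))" "bounded_linear (\<lambda>x. (0, x))"
    by (auto intro: bounded_linear_Pair bounded_linear_ident bounded_linear_zero)
  from smooth_on_add[OF assms(1) smooth_on_bounded_linear[OF assms(1) this(1) assms(2)]
      smooth_on_bounded_linear[OF assms(1) this(2) assms(3)]]
  show ?thesis by simp
qed

text \<open>Compactness of a closed ball bounds the finitely many partial derivatives, their sum
  bounds the operator norm, and convexity of the ball gives the Lipschitz estimate. It supplies the
  constant for the uniqueness of integral curves.\<close>

lemma smooth_on_lipschitz:
  fixes f :: "'a::euclidean_space \<Rightarrow> 'b::real_normed_vector"
  assumes "open S" "smooth_on S f" "x0 \<in> S"
  obtains r K where "r > 0" "ball x0 r \<subseteq> S"
    "\<And>x y. x \<in> ball x0 r \<Longrightarrow> y \<in> ball x0 r \<Longrightarrow> norm (f x - f y) \<le> K * norm (x - y)"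
proof -
  obtain r where r: "r > 0" "cball x0 r \<subseteq> S" using assms open_contains_cball by blast
  have "\<exists>K. \<forall>x\<in>cball x0 r. norm (frechet_derivative f (at x) b) \<le> K" for b
  proof -
    have "continuous_on (cball x0 r) (\<lambda>x. frechet_derivative f (at x) b)"
      using smooth_on_continuous[OF smooth_on_frechet[OF assms(2)]] r(2) continuous_on_subset by blast
    then have "bounded ((\<lambda>x. frechet_derivative f (at x) b) ` cball x0 r)"
      by (simp add: compact_continuous_image compact_imp_bounded)
    then show ?thesis unfolding bounded_iff by auto
  qed
  then obtain K where K: "\<And>b x. x \<in> cball x0 r \<Longrightarrow> norm (frechet_derivative f (at x) b) \<le> K b"
    by metis
  have ball: "ball x0 r \<subseteq> cball x0 r" by (rule ball_subset_cball)
  have "norm (f x - f y) \<le> (\<Sum>b\<in>Basis. K b) * norm (x - y)"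
    if "x \<in> ball x0 r" "y \<in> ball x0 r" for x y
  proof (rule differentiable_bound[OF convex_ball _ _ that])
    fix z assume z: "z \<in> ball x0 r"
    then have zS: "z \<in> S" "z \<in> cball x0 r" using r ball by auto
    show "(f has_derivative frechet_derivative f (at z)) (at z within ball x0 r)"
      using smooth_on_has_derivative[OF assms(2) zS(1)] has_derivative_at_withinI by blast
    show "onorm (frechet_derivative f (at z)) \<le> (\<Sum>b\<in>Basis. K b)"
    proof (rule onorm_le)
      fix v
      have "norm (frechet_derivative f (at z) v) =
          norm (\<Sum>b\<in>Basis. (v \<bullet> b) *\<^sub>R frechet_derivative f (at z) b)"
        using has_derivative_basis_sum[OF smooth_on_differentiable[OF assms(2) zS(1)]] by metis
      also have "\<dots> \<le> (\<Sum>b\<in>Basis. norm v * K b)"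
      proof (rule sum_norm_le)
        fix b :: 'a assume "b \<in> Basis"
        then show "norm ((v \<bullet> b) *\<^sub>R frechet_derivative f (at z) b) \<le> norm v * K b"
          using K[OF zS(2), of b] Basis_le_norm[of b v] by (auto intro: mult_mono)
      qed
      finally show "norm (frechet_derivative f (at z) v) \<le> (\<Sum>b\<in>Basis. K b) * norm v"
        by (simp add: sum_distrib_left mult.commute)
    qed
  qed
  then show ?thesis using that[of r] r ball by blast
qed

section \<open>Symmetry of second derivatives\<close>

lemma smooth_on_has_vector_derivative_line:
  assumes "smooth_on S f" "y + s *\<^sub>R u \<in> S"
  shows "((\<lambda>s. f (y + s *\<^sub>R u)) has_vector_derivative frechet_derivative f (at (y + s *\<^sub>R u)) u) (at s)"
proof -
  have l: "((\<lambda>s. y + s *\<^sub>R u) has_derivative (\<lambda>h. h *\<^sub>R u)) (at s)"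
    by (auto intro!: derivative_eq_intros)
  have d: "f differentiable (at (y + s *\<^sub>R u))" by (rule smooth_on_differentiable[OF assms])
  interpret linear "frechet_derivative f (at (y + s *\<^sub>R u))" using d by (rule linear_frechet_derivative)
  show ?thesis
    unfolding has_vector_derivative_def
    using has_derivative_compose[OF l smooth_on_has_derivative[OF assms]] by (simp add: scaleR)
qed

text \<open>The second difference along \<open>u\<close> and \<open>v\<close> is a mean value of the iterated derivative, and it is
  symmetric in \<open>u\<close> and \<open>v\<close>.\<close>

lemma mixed_second_difference:
  fixes f :: "'a::real_normed_vector \<Rightarrow> real"
  assumes f: "smooth_on S f" and h: "h > 0"
    and S: "\<And>s t. 0 \<le> s \<Longrightarrow> s \<le> h \<Longrightarrow> 0 \<le> t \<Longrightarrow> t \<le> h \<Longrightarrow> x + s *\<^sub>R u + t *\<^sub>R v \<in> S"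
  obtains a b where "0 < a" "a < h" "0 < b" "b < h"
    "f (x + h *\<^sub>R u + h *\<^sub>R v) - f (x + h *\<^sub>R u) - f (x + h *\<^sub>R v) + f x =
      h * h * frechet_derivative (\<lambda>y. frechet_derivative f (at y) u) (at (x + a *\<^sub>R u + b *\<^sub>R v)) v"
proof -
  let ?d = "\<lambda>y. frechet_derivative f (at y) u"
  let ?\<phi> = "\<lambda>s. f ((x + h *\<^sub>R v) + s *\<^sub>R u) - f (x + s *\<^sub>R u)"
  have "\<exists>a>0. a < h \<and> ?\<phi> h - ?\<phi> 0 = (h - 0) * (?d ((x + h *\<^sub>R v) + a *\<^sub>R u) - ?d (x + a *\<^sub>R u))"
  proof (rule MVT2[OF h])
    fix s assume s: "0 \<le> s" "s \<le> h"
    have "(x + h *\<^sub>R v) + s *\<^sub>R u \<in> S" "x + s *\<^sub>R u \<in> S"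
      using S[OF s, of h] S[OF s, of 0] h by (simp_all add: add_ac)
    from this[THEN smooth_on_has_vector_derivative_line[OF f]]
    show "(?\<phi> has_real_derivative ?d ((x + h *\<^sub>R v) + s *\<^sub>R u) - ?d (x + s *\<^sub>R u)) (at s)"
      unfolding has_real_derivative_iff_has_vector_derivative by (rule has_vector_derivative_diff)
  qed
  then obtain a where a: "0 < a" "a < h"
    "?\<phi> h - ?\<phi> 0 = h * (?d ((x + h *\<^sub>R v) + a *\<^sub>R u) - ?d (x + a *\<^sub>R u))" by auto
  let ?e = "\<lambda>y. frechet_derivative ?d (at y) v"
  have "\<exists>b>0. b < h \<and> ?d ((x + a *\<^sub>R u) + h *\<^sub>R v) - ?d ((x + a *\<^sub>R u) + 0 *\<^sub>R v) =
      (h - 0) * ?e ((x + a *\<^sub>R u) + b *\<^sub>R v)"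
  proof (rule MVT2[OF h])
    fix t assume t: "0 \<le> t" "t \<le> h"
    show "((\<lambda>t. ?d ((x + a *\<^sub>R u) + t *\<^sub>R v)) has_real_derivative ?e ((x + a *\<^sub>R u) + t *\<^sub>R v)) (at t)"
      unfolding has_real_derivative_iff_has_vector_derivative
      by (rule smooth_on_has_vector_derivative_line[OF smooth_on_frechet[OF f]]) (use S t a in auto)
  qed
  then obtain b where b: "0 < b" "b < h"
    "?d (x + a *\<^sub>R u + h *\<^sub>R v) - ?d (x + a *\<^sub>R u) = h * ?e (x + a *\<^sub>R u + b *\<^sub>R v)" by auto
  show ?thesis by (rule that[OF a(1,2) b(1,2)]) (use a(3) b(3) in \<open>simp add: algebra_simps\<close>)
qed

text \<open>Both iterated derivatives are limits of the same second difference quotient as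
  \<open>h\<close> tends to 0 from the right.\<close>

lemma mixed_derivatives_commute_real:
  fixes f :: "'a::real_normed_vector \<Rightarrow> real"
  assumes "open S" "smooth_on S f" "x \<in> S"
  shows "frechet_derivative (\<lambda>y. frechet_derivative f (at y) u) (at x) v =
    frechet_derivative (\<lambda>y. frechet_derivative f (at y) v) (at x) u"
proof -
  let ?F = "\<lambda>u v y. frechet_derivative (\<lambda>y. frechet_derivative f (at y) u) (at y) v"
  obtain r where r: "r > 0" "ball x r \<subseteq> S" using assms open_contains_ball by blast
  \<comment> \<open>For sides below this bound the whole parallelogram spanned by \<open>u\<close>
    and \<open>v\<close> at \<open>x\<close> stays in the ball. The summand 1 keeps the denominator
    positive when both vectors vanish and makes the estimate strict.\<close>
  define \<delta> where "\<delta> = r / (1 + norm u + norm v)"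
  have pos: "1 + norm u + norm v > 0" by (smt (verit) norm_ge_zero)
  have \<delta>: "\<delta> > 0" using r pos by (simp add: \<delta>_def)
  have in_ball: "x + s *\<^sub>R u + t *\<^sub>R v \<in> ball x (e * (1 + norm u + norm v))"
    if "0 \<le> s" "s \<le> e" "0 \<le> t" "t \<le> e" "e > 0" for s t e
  proof -
    have "norm (s *\<^sub>R u + t *\<^sub>R v) \<le> s * norm u + t * norm v"
      using norm_triangle_ineq[of "s *\<^sub>R u" "t *\<^sub>R v"] that by simp
    also have "\<dots> \<le> e * norm u + e * norm v" using that by (intro add_mono mult_right_mono) auto
    also have "\<dots> < e * (1 + norm u + norm v)" using that by (simp add: algebra_simps)
    finally have "norm (s *\<^sub>R u + t *\<^sub>R v) < e * (1 + norm u + norm v)" .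
    moreover have "norm (s *\<^sub>R u + t *\<^sub>R v) = dist x (x + s *\<^sub>R u + t *\<^sub>R v)"
      by (metis add.assoc add_diff_cancel_left' dist_commute dist_norm)
    ultimately show ?thesis by simp
  qed
  have inS: "x + s *\<^sub>R u + t *\<^sub>R v \<in> S" if "0 \<le> s" "s \<le> h" "0 \<le> t" "t \<le> h" "0 < h" "h < \<delta>" for s t h
    using in_ball[of s \<delta> t] that r pos by (auto simp: \<delta>_def)
  have lim: "((\<lambda>h. (f (x + h *\<^sub>R u + h *\<^sub>R v) - f (x + h *\<^sub>R u) - f (x + h *\<^sub>R v) + f x) / (h * h))
      \<longlongrightarrow> ?F u v x) (at_right 0)" if uv: "\<And>s t h. 0 \<le> s \<Longrightarrow> s \<le> h \<Longrightarrow> 0 \<le> t \<Longrightarrow> t \<le> h \<Longrightarrow> 0 < h \<Longrightarrow> h < \<delta> \<Longrightarrow>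
        x + s *\<^sub>R u + t *\<^sub>R v \<in> S \<and> dist (x + s *\<^sub>R u + t *\<^sub>R v) x < h * C" for u v C
  proof (rule tendstoI)
    fix e :: real assume e: "e > 0"
    have "continuous_on S (?F u v)"
      by (intro smooth_on_continuous smooth_on_frechet assms)
    then obtain d where d: "d > 0" "\<And>y. y \<in> S \<Longrightarrow> dist y x < d \<Longrightarrow> dist (?F u v y) (?F u v x) < e"
      using assms(3) e unfolding continuous_on_iff by blast
    have "eventually (\<lambda>h. h < \<delta>) (at_right 0)" "eventually (\<lambda>h. h > 0) (at_right (0::real))"
      using \<delta> by (auto simp: eventually_at_right_less eventually_at_right_field)
    moreover have "((\<lambda>h. h * C) \<longlongrightarrow> 0) (at_right 0)" by (auto intro!: tendsto_eq_intros)
    from order_tendstoD(2)[OF this d(1)] have "eventually (\<lambda>h. h * C < d) (at_right 0)" .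
    ultimately show "\<forall>\<^sub>F h in at_right 0. dist ((f (x + h *\<^sub>R u + h *\<^sub>R v) - f (x + h *\<^sub>R u) - f (x + h *\<^sub>R v) + f x)
        / (h * h)) (?F u v x) < e"
    proof eventually_elim
      case (elim h)
      obtain a b where ab: "0 < a" "a < h" "0 < b" "b < h"
        "f (x + h *\<^sub>R u + h *\<^sub>R v) - f (x + h *\<^sub>R u) - f (x + h *\<^sub>R v) + f x =
          h * h * ?F u v (x + a *\<^sub>R u + b *\<^sub>R v)"
        by (rule mixed_second_difference[OF assms(2), of h x u v]) (use elim uv in auto)
      then show ?case using uv[of a h b] d(2)[of "x + a *\<^sub>R u + b *\<^sub>R v"] elim by simp
    qed
  qed
  have near: "dist (x + s *\<^sub>R u + t *\<^sub>R v) x < h * (1 + norm u + norm v)"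
    if "0 \<le> s" "s \<le> h" "0 \<le> t" "t \<le> h" "0 < h" for s t h
    using in_ball[OF that] by (simp add: dist_commute)
  have 1: "((\<lambda>h. (f (x + h *\<^sub>R u + h *\<^sub>R v) - f (x + h *\<^sub>R u) - f (x + h *\<^sub>R v) + f x) / (h * h))
      \<longlongrightarrow> ?F u v x) (at_right 0)"
    by (rule lim[where C = "1 + norm u + norm v"]) (use inS near in blast)
  have 2: "((\<lambda>h. (f (x + h *\<^sub>R v + h *\<^sub>R u) - f (x + h *\<^sub>R v) - f (x + h *\<^sub>R u) + f x) / (h * h))
      \<longlongrightarrow> ?F v u x) (at_right 0)"
  proof (rule lim[where C = "1 + norm u + norm v"])
    fix s t h :: real assume "0 \<le> s" "s \<le> h" "0 \<le> t" "t \<le> h" "0 < h" "h < \<delta>"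
    then show "x + s *\<^sub>R v + t *\<^sub>R u \<in> S \<and>
        dist (x + s *\<^sub>R v + t *\<^sub>R u) x < h * (1 + norm u + norm v)"
      using inS[of t h s] near[of t h s] by (simp add: add_ac)
  qed
  have eq: "(\<lambda>h. (f (x + h *\<^sub>R v + h *\<^sub>R u) - f (x + h *\<^sub>R v) - f (x + h *\<^sub>R u) + f x) / (h * h)) =
    (\<lambda>h. (f (x + h *\<^sub>R u + h *\<^sub>R v) - f (x + h *\<^sub>R u) - f (x + h *\<^sub>R v) + f x) / (h * h))"
    by (simp add: add_ac algebra_simps)
  show ?thesis using tendsto_unique[OF _ 1 2[unfolded eq]] by simp
qed

lemma frechet_derivative_bounded_linear:
  assumes "bounded_linear L" "f differentiable (at x)"
  shows "frechet_derivative (\<lambda>x. L (f x)) (at x) v = L (frechet_derivative f (at x) v)"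
proof -
  have "((\<lambda>x. L (f x)) has_derivative (\<lambda>v. L (frechet_derivative f (at x) v))) (at x)"
    using bounded_linear.has_derivative[OF assms(1)] assms(2) frechet_derivative_works by blast
  from frechet_derivative_at[OF this] show ?thesis by metis
qed

lemma mixed_derivatives_commute:
  fixes f :: "'a::real_normed_vector \<Rightarrow> 'b::euclidean_space"
  assumes S: "open S" and f: "smooth_on S f" and x: "x \<in> S"
  shows "frechet_derivative (\<lambda>y. frechet_derivative f (at y) u) (at x) v =
    frechet_derivative (\<lambda>y. frechet_derivative f (at y) v) (at x) u"
proof (rule euclidean_eqI)
  fix b :: 'b
  let ?L = "\<lambda>z::'b. z \<bullet> b"
  have L: "bounded_linear ?L" by (rule bounded_linear_inner_left)
  have e: "frechet_derivative (\<lambda>y. frechet_derivative (\<lambda>y. ?L (f y)) (at y) u) (at x) v =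
      ?L (frechet_derivative (\<lambda>y. frechet_derivative f (at y) u) (at x) v)" for u v
  proof -
    have "frechet_derivative (\<lambda>y. frechet_derivative (\<lambda>y. ?L (f y)) (at y) u) (at x) =
        frechet_derivative (\<lambda>y. ?L (frechet_derivative f (at y) u)) (at x)"
    proof (rule frechet_derivative_transform_within_open[OF _ S x])
      show "(\<lambda>y. frechet_derivative (\<lambda>y. ?L (f y)) (at y) u) differentiable at x"
        by (rule smooth_on_differentiable[OF smooth_on_frechet[OF smooth_on_bounded_linear[OF S L f]] x])
    qed (rule frechet_derivative_bounded_linear[OF L smooth_on_differentiable[OF f]])
    then show ?thesis
      using frechet_derivative_bounded_linear[OF L smooth_on_differentiable[OF smooth_on_frechet[OF f] x]]
      by simp
  qed
  show "?L (frechet_derivative (\<lambda>y. frechet_derivative f (at y) u) (at x) v) =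
      ?L (frechet_derivative (\<lambda>y. frechet_derivative f (at y) v) (at x) u)"
    using mixed_derivatives_commute_real[OF S smooth_on_bounded_linear[OF S L f] x] e by simp
qed


section \<open>The category of smooth manifolds\<close>

context
  fixes A :: "('m::{t2_space,second_countable_topology}, 'e::euclidean_space) chart set"
  assumes A: "smooth_manifold A"
begin

lemma manifold_charts:
  assumes "C \<in> A"
  shows open_chart_domain: "open (fst C)"
    and open_chart_image: "open (snd C ` fst C)"
    and homeomorphism_chart: "homeomorphism (fst C) (snd C ` fst C) (snd C) (chart_inv C)"
  using A assms unfolding smooth_manifold_def by blast+

lemma chart_inv_chart: "C \<in> A \<Longrightarrow> p \<in> fst C \<Longrightarrow> chart_inv C (snd C p) = p"
  using homeomorphism_chart[of C] by (auto simp: homeomorphism_def)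

lemma chart_chart_inv: "C \<in> A \<Longrightarrow> x \<in> snd C ` fst C \<Longrightarrow> snd C (chart_inv C x) = x"
  using homeomorphism_chart[of C] by (auto simp: homeomorphism_def)

lemma chart_inv_in: "C \<in> A \<Longrightarrow> x \<in> snd C ` fst C \<Longrightarrow> chart_inv C x \<in> fst C"
  using homeomorphism_chart[of C] by (auto simp: homeomorphism_def)

lemma open_chart_restrict:
  assumes "C \<in> A" "open V"
  shows "open (snd C ` (fst C \<inter> V))"
proof -
  have "openin (top_of_set (fst C)) (fst C \<inter> V)" using assms(2) by auto
  from homeomorphism_imp_open_map[OF homeomorphism_chart[OF assms(1)] this]
  show ?thesis using open_chart_image[OF assms(1)] openin_open_trans by blast
qed

lemma open_chart_preimage:
  assumes "C \<in> A" "open V"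
  shows "open (fst C \<inter> snd C -` V)"
  using homeomorphism_chart[OF assms(1)] open_chart_domain[OF assms(1)] assms(2)
  by (metis homeomorphism_def continuous_on_open_vimage Int_commute)

lemma chart_at_in: "chart_at A p \<in> A" "p \<in> fst (chart_at A p)"
proof -
  have "\<exists>C. C \<in> A \<and> p \<in> fst C" using A unfolding smooth_manifold_def by blast
  from someI_ex[OF this] show "chart_at A p \<in> A" "p \<in> fst (chart_at A p)"
    unfolding chart_at_def by auto
qed

lemma smooth_transition:
  "C \<in> A \<Longrightarrow> D \<in> A \<Longrightarrow> smooth_on (snd C ` (fst C \<inter> fst D)) (snd D \<circ> chart_inv C)"
  using A unfolding smooth_manifold_def by blast

end

lemma smooth_manifold_std: "smooth_manifold (std_atlas :: ('e::euclidean_space, 'e) chart set)"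
proof -
  have "homeomorphism UNIV UNIV id (chart_inv (UNIV, id :: 'e \<Rightarrow> 'e))"
    by (simp add: chart_inv_def homeomorphism_def inv_into_def[abs_def] id_def continuous_on_id)
  moreover have "chart_inv (UNIV, id :: 'e \<Rightarrow> 'e) = id"
    by (simp add: chart_inv_def id_def inv_into_def[abs_def])
  ultimately show ?thesis
    using smooth_on_ident[where 'a='e] by (simp add: smooth_manifold_def std_atlas_def id_def comp_def)
qed

lemma chart_inv_std [simp]: "chart_inv (UNIV, id) = id"
  by (simp add: chart_inv_def id_def inv_into_def[abs_def])

lemma chart_at_std [simp]: "chart_at std_atlas x = (UNIV, id)"
  unfolding chart_at_def std_atlas_def by (rule some_equality) auto

lemma smooth_map_on_subset: "smooth_map_on A B W f \<Longrightarrow> W' \<subseteq> W \<Longrightarrow> smooth_map_on A B W' f"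
  unfolding smooth_map_on_def
  by (intro conjI ballI; (elim conjE)?)
    (blast intro: continuous_on_subset, rule smooth_on_subset, blast, blast)

lemma smooth_map_on_continuous: "smooth_map_on A B W f \<Longrightarrow> continuous_on W f"
  unfolding smooth_map_on_def by blast

lemma open_smooth_preimage:
  "smooth_map_on A B W f \<Longrightarrow> open W \<Longrightarrow> open V \<Longrightarrow> open (W \<inter> f -` V)"
  by (metis smooth_map_on_continuous continuous_on_open_vimage Int_commute)

lemma smooth_map_on_local:
  assumes "\<And>p. p \<in> W \<Longrightarrow> \<exists>U. open U \<and> p \<in> U \<and> smooth_map_on A B U f" "smooth_manifold A"
    "smooth_manifold B"
  shows "smooth_map_on A B W f"
  unfolding smooth_map_on_def
proof (intro conjI ballI)
  show "continuous_on W f"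
    using assms(1) by (metis smooth_map_on_continuous continuous_at_imp_continuous_on
        continuous_on_eq_continuous_at)
next
  fix C D assume CD: "C \<in> A" "D \<in> B"
  show "smooth_on (snd C ` (fst C \<inter> W \<inter> f -` fst D)) (snd D \<circ> f \<circ> chart_inv C)"
  proof (rule smooth_on_local)
    fix x assume "x \<in> snd C ` (fst C \<inter> W \<inter> f -` fst D)"
    then obtain p where p: "p \<in> fst C" "p \<in> W" "f p \<in> fst D" "x = snd C p" by auto
    obtain U where U: "open U" "p \<in> U" "smooth_map_on A B U f" using assms(1) p by blast
    have "open (U \<inter> f -` fst D)"
      using open_smooth_preimage[OF U(3,1)] open_chart_domain[OF assms(3) CD(2)] by blast
    from open_chart_restrict[OF assms(2) CD(1) this]
    have "open (snd C ` (fst C \<inter> U \<inter> f -` fst D))" by (simp add: Int_assoc)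
    moreover have "smooth_on (snd C ` (fst C \<inter> U \<inter> f -` fst D)) (snd D \<circ> f \<circ> chart_inv C)"
      using U(3) CD unfolding smooth_map_on_def by blast
    ultimately show "\<exists>U. open U \<and> x \<in> U \<and> smooth_on U (snd D \<circ> f \<circ> chart_inv C)"
      using p U(2) by blast
  qed
qed

text \<open>The definition tests every pair of charts. One suitable pair at each point is enough,
  because any other pair differs from it by transition maps, which are smooth on the
  overlaps.\<close>

lemma smooth_map_onI:
  assumes "smooth_manifold A" "smooth_manifold B" "open W" "continuous_on W f"
    and loc: "\<And>p. p \<in> W \<Longrightarrow> \<exists>C\<in>A. \<exists>D\<in>B. \<exists>V. p \<in> fst C \<and> f p \<in> fst D \<and> open V \<and> snd C p \<in> V \<and>
       smooth_on V (snd D \<circ> f \<circ> chart_inv C)"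
  shows "smooth_map_on A B W f"
  unfolding smooth_map_on_def
proof (intro conjI ballI assms(4))
  fix C' D' assume CD': "C' \<in> A" "D' \<in> B"
  show "smooth_on (snd C' ` (fst C' \<inter> W \<inter> f -` fst D')) (snd D' \<circ> f \<circ> chart_inv C')"
  proof (rule smooth_on_local)
    fix x assume "x \<in> snd C' ` (fst C' \<inter> W \<inter> f -` fst D')"
    then obtain p where p: "p \<in> fst C'" "p \<in> W" "f p \<in> fst D'" "x = snd C' p" by auto
    obtain C D V where C: "C \<in> A" "D \<in> B" "p \<in> fst C" "f p \<in> fst D" "open V" "snd C p \<in> V"
      "smooth_on V (snd D \<circ> f \<circ> chart_inv C)" using loc[OF p(2)] by blast
    \<comment> \<open>On the part of \<open>Q\<close> inside the domain of \<open>C'\<close> both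
      pairs of charts are available and the given expression of \<open>f\<close> is smooth, so the
      new expression is the given one between two transition maps.\<close>
    define Q where "Q = (W \<inter> f -` (fst D \<inter> fst D')) \<inter> (fst C \<inter> snd C -` V)"
    have oD: "open (fst D \<inter> fst D')" using open_chart_domain[OF assms(2)] C CD' by blast
    have "open (W \<inter> f -` (fst D \<inter> fst D'))"
      using assms(3,4) oD by (metis continuous_on_open_vimage Int_commute)
    then have Q: "open Q" using open_chart_preimage[OF assms(1) C(1,5)] by (auto simp: Q_def)
    let ?U = "snd C' ` (fst C' \<inter> Q)"
    have U: "open ?U" by (rule open_chart_restrict[OF assms(1) CD'(1) Q])
    have inv: "chart_inv C' y \<in> fst C'" "chart_inv C' y \<in> Q" "snd C (chart_inv C' y) \<in> V"
       "chart_inv C (snd C (chart_inv C' y)) = chart_inv C' y" if "y \<in> ?U" for y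
      using that chart_inv_chart[OF assms(1) CD'(1)] chart_inv_chart[OF assms(1) C(1)]
      by (auto simp: Q_def)
    have 1: "smooth_on ?U (snd C \<circ> chart_inv C')"
      by (rule smooth_on_subset[OF smooth_transition[OF assms(1) CD'(1) C(1)]]) (auto simp: Q_def)
    have 2: "smooth_on ?U (\<lambda>y. (snd D \<circ> f \<circ> chart_inv C) ((snd C \<circ> chart_inv C') y))"
      by (rule smooth_on_compose[OF U C(5) _ 1 C(7)]) (use inv in auto)
    have 3: "smooth_on ?U (\<lambda>y. (snd D' \<circ> chart_inv D) ((snd D \<circ> f \<circ> chart_inv C) ((snd C \<circ> chart_inv C') y)))"
    proof (rule smooth_on_compose[OF U _ _ 2 smooth_transition[OF assms(2) C(2) CD'(2)]])
      show "open (snd D ` (fst D \<inter> fst D'))"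
        using open_chart_restrict[OF assms(2) C(2)] open_chart_domain[OF assms(2) CD'(2)] by blast
      show "(\<lambda>y. (snd D \<circ> f \<circ> chart_inv C) ((snd C \<circ> chart_inv C') y)) ` ?U \<subseteq> snd D ` (fst D \<inter> fst D')"
      proof (rule image_subsetI)
        fix y assume y: "y \<in> ?U"
        have "f (chart_inv C' y) \<in> fst D \<inter> fst D'" using inv(2)[OF y] by (auto simp: Q_def)
        then show "(snd D \<circ> f \<circ> chart_inv C) ((snd C \<circ> chart_inv C') y) \<in> snd D ` (fst D \<inter> fst D')"
          using inv(4)[OF y] by auto
      qed
    qed
    have "smooth_on ?U (snd D' \<circ> f \<circ> chart_inv C')"
    proof (rule smooth_on_cong[OF U _ 3])
      fix y assume y: "y \<in> ?U"
      have "f (chart_inv C' y) \<in> fst D" using inv(2)[OF y] by (auto simp: Q_def)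
      then show "(snd D' \<circ> chart_inv D) ((snd D \<circ> f \<circ> chart_inv C) ((snd C \<circ> chart_inv C') y)) =
          (snd D' \<circ> f \<circ> chart_inv C') y"
        using inv(4)[OF y] chart_inv_chart[OF assms(2) C(2)] by simp
    qed
    moreover have "x \<in> ?U" using p C by (auto simp: Q_def)
    ultimately show "\<exists>U. open U \<and> x \<in> U \<and> smooth_on U (snd D' \<circ> f \<circ> chart_inv C')"
      using U by blast
  qed
qed

lemma smooth_map_on_rep:
  assumes "smooth_manifold A" "smooth_manifold B" "open W" "smooth_map_on A B W f" "p \<in> W"
    "C \<in> A" "p \<in> fst C" "D \<in> B" "f p \<in> fst D"
  obtains V where "open V" "snd C p \<in> V" "V \<subseteq> snd C ` fst C" "chart_inv C ` V \<subseteq> W"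
    "f ` chart_inv C ` V \<subseteq> fst D" "smooth_on V (snd D \<circ> f \<circ> chart_inv C)"
proof
  let ?V = "snd C ` (fst C \<inter> (W \<inter> f -` fst D))"
  show "open ?V"
    by (intro open_chart_restrict[OF assms(1,6)] open_smooth_preimage[OF assms(4,3)]
        open_chart_domain[OF assms(2,8)])
  show "snd C p \<in> ?V" "?V \<subseteq> snd C ` fst C" using assms by auto
  show "chart_inv C ` ?V \<subseteq> W" "f ` chart_inv C ` ?V \<subseteq> fst D"
    using chart_inv_chart[OF assms(1,6)] by auto
  show "smooth_on ?V (snd D \<circ> f \<circ> chart_inv C)"
    using assms(4,6,8) unfolding smooth_map_on_def by (metis Int_assoc)
qed

lemma smooth_map_on_compose:
  assumes "smooth_manifold A" "smooth_manifold B" "smooth_manifold C" "open W" "open V"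
    and f: "smooth_map_on A B W f" and g: "smooth_map_on B C V g" and sub: "f ` W \<subseteq> V"
  shows "smooth_map_on A C W (\<lambda>x. g (f x))"
proof (rule smooth_map_onI[OF assms(1,3,4)])
  show "continuous_on W (\<lambda>x. g (f x))"
    using continuous_on_compose2[OF smooth_map_on_continuous[OF g] smooth_map_on_continuous[OF f] sub] .
  fix p assume p: "p \<in> W"
  let ?c = "chart_at A p" and ?d = "chart_at B (f p)" and ?e = "chart_at C (g (f p))"
  note c = chart_at_in[OF assms(1), of p] and d = chart_at_in[OF assms(2), of "f p"]
    and e = chart_at_in[OF assms(3), of "g (f p)"]
  obtain V1 where V1: "open V1" "snd ?c p \<in> V1" "V1 \<subseteq> snd ?c ` fst ?c" "chart_inv ?c ` V1 \<subseteq> W"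
    "f ` chart_inv ?c ` V1 \<subseteq> fst ?d" "smooth_on V1 (snd ?d \<circ> f \<circ> chart_inv ?c)"
    by (rule smooth_map_on_rep[OF assms(1,2,4) f p c d])
  obtain V2 where V2: "open V2" "snd ?d (f p) \<in> V2" "V2 \<subseteq> snd ?d ` fst ?d" "chart_inv ?d ` V2 \<subseteq> V"
    "g ` chart_inv ?d ` V2 \<subseteq> fst ?e" "smooth_on V2 (snd ?e \<circ> g \<circ> chart_inv ?d)"
    using smooth_map_on_rep[OF assms(2,3,5) g _ d e] sub p by blast
  let ?V = "V1 \<inter> (snd ?d \<circ> f \<circ> chart_inv ?c) -` V2"
  have oV: "open ?V"
    using V1(1,6) V2(1) by (metis Int_commute continuous_on_open_vimage smooth_on_continuous)
  have "smooth_on ?V (\<lambda>x. (snd ?e \<circ> g \<circ> chart_inv ?d) ((snd ?d \<circ> f \<circ> chart_inv ?c) x))"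
    by (rule smooth_on_compose[OF oV V2(1) _ smooth_on_subset[OF V1(6)] V2(6)]) auto
  then have "smooth_on ?V (snd ?e \<circ> (\<lambda>x. g (f x)) \<circ> chart_inv ?c)"
    by (rule smooth_on_cong[OF oV, rotated])
      (use V1(5) chart_inv_chart[OF assms(2) d(1)] in \<open>simp add: image_subset_iff\<close>)
  then show "\<exists>C'\<in>A. \<exists>D\<in>C. \<exists>V. p \<in> fst C' \<and> g (f p) \<in> fst D \<and> open V \<and> snd C' p \<in> V \<and>
     smooth_on V (snd D \<circ> (\<lambda>x. g (f x)) \<circ> chart_inv C')"
    using c e oV V1(2) V2(2) chart_inv_chart[OF assms(1) c] by (intro bexI[of _ ?c] bexI[of _ ?e] exI[of _ ?V]) auto
qed

lemma smooth_map_on_cong: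
  assumes "smooth_manifold A" "smooth_manifold B" "open W" "smooth_map_on A B W f"
    "\<And>x. x \<in> W \<Longrightarrow> f x = g x"
  shows "smooth_map_on A B W g"
proof (rule smooth_map_onI[OF assms(1-3)])
  show "continuous_on W g"
    using smooth_map_on_continuous[OF assms(4)] assms(5) by (simp cong: continuous_on_cong)
  fix p assume p: "p \<in> W"
  let ?c = "chart_at A p" and ?d = "chart_at B (f p)"
  note c = chart_at_in[OF assms(1), of p] and d = chart_at_in[OF assms(2), of "f p"]
  obtain V1 where V1: "open V1" "snd ?c p \<in> V1" "V1 \<subseteq> snd ?c ` fst ?c" "chart_inv ?c ` V1 \<subseteq> W"
    "f ` chart_inv ?c ` V1 \<subseteq> fst ?d" "smooth_on V1 (snd ?d \<circ> f \<circ> chart_inv ?c)"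
    by (rule smooth_map_on_rep[OF assms(1,2,3,4) p c d])
  have "smooth_on V1 (snd ?d \<circ> g \<circ> chart_inv ?c)"
    by (rule smooth_on_cong[OF V1(1) _ V1(6)]) (use V1(4) assms(5) in auto)
  then show "\<exists>C\<in>A. \<exists>D\<in>B. \<exists>V. p \<in> fst C \<and> g p \<in> fst D \<and> open V \<and> snd C p \<in> V \<and>
     smooth_on V (snd D \<circ> g \<circ> chart_inv C)"
    using c d V1 assms(5)[OF p] by (intro bexI[of _ ?c] bexI[of _ ?d] exI[of _ V1]) auto
qed

lemma smooth_map_on_std_iff:
  "smooth_map_on A std_atlas W f \<longleftrightarrow>
    continuous_on W f \<and> (\<forall>C\<in>A. smooth_on (snd C ` (fst C \<inter> W)) (f \<circ> chart_inv C))"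
  by (simp add: smooth_map_on_def std_atlas_def)

text \<open>Continuity is part of the definition of smoothness; for maps to a vector space it is
  recovered from the smooth chart expressions by composing with the charts again.\<close>

lemma smooth_map_on_stdI:
  assumes "smooth_manifold A" "open W"
    "\<And>C. C \<in> A \<Longrightarrow> smooth_on (snd C ` (fst C \<inter> W)) (f \<circ> chart_inv C)"
  shows "smooth_map_on A std_atlas W f"
  unfolding smooth_map_on_std_iff
proof (intro conjI ballI assms(3))
  show "continuous_on W f"
  proof (rule continuous_at_imp_continuous_on, rule ballI)
    fix p assume p: "p \<in> W"
    let ?c = "chart_at A p"
    note c = chart_at_in[OF assms(1), of p]
    have 1: "continuous_on (snd ?c ` (fst ?c \<inter> W)) (f \<circ> chart_inv ?c)"
      by (rule smooth_on_continuous[OF assms(3)[OF c(1)]])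
    have "continuous_on (fst ?c \<inter> W) (snd ?c)"
      using homeomorphism_chart[OF assms(1) c(1)] continuous_on_subset
      unfolding homeomorphism_def by (metis Int_lower1)
    from continuous_on_compose2[OF 1 this order_refl]
    have "continuous_on (fst ?c \<inter> W) (\<lambda>x. f (chart_inv ?c (snd ?c x)))" by simp
    then have "continuous_on (fst ?c \<inter> W) f"
      by (rule continuous_on_eq) (use chart_inv_chart[OF assms(1) c(1)] in auto)
    then show "isCont f p"
      using c p open_chart_domain[OF assms(1) c(1)] assms(2)
      by (simp add: continuous_on_eq_continuous_at open_Int)
  qed
qed

lemma smooth_map_std_std_iff: "smooth_map_on std_atlas std_atlas W f \<longleftrightarrow> smooth_on W f"
  by (subst smooth_map_on_std_iff) (auto simp: std_atlas_def smooth_on_continuous)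

lemma smooth_map_on_ident:
  assumes "smooth_manifold A"
  shows "smooth_map_on A A W (\<lambda>x. x)"
proof -
  have "smooth_on (snd C ` (fst C \<inter> W \<inter> fst D)) (snd D \<circ> chart_inv C)" if "C \<in> A" "D \<in> A" for C D
    by (rule smooth_on_subset[OF smooth_transition[OF assms that]]) auto
  then show ?thesis by (simp add: smooth_map_on_def continuous_on_id comp_def)
qed

lemma smooth_map_on_const: "smooth_map_on A B W (\<lambda>x. c)"
  by (simp add: smooth_map_on_def continuous_on_const comp_def smooth_on_const)

lemma smooth_map_on_chart:
  assumes "smooth_manifold A" "C \<in> A"
  shows "smooth_map_on A std_atlas (fst C) (snd C)"
  proof (rule smooth_map_on_stdI[OF assms(1) open_chart_domain[OF assms]])
qed (rule smooth_transition[OF assms(1) _ assms(2)])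

lemma smooth_map_on_chart_inv:
  assumes "smooth_manifold A" "C \<in> A"
  shows "smooth_map_on std_atlas A (snd C ` fst C) (chart_inv C)"
proof -
  have "smooth_on (snd C ` fst C \<inter> chart_inv C -` fst D) (snd D \<circ> chart_inv C)" if "D \<in> A" for D
    by (rule smooth_on_subset[OF smooth_transition[OF assms that]])
      (auto simp: chart_inv_chart[OF assms])
  then show ?thesis
    using homeomorphism_chart[OF assms] by (simp add: smooth_map_on_def std_atlas_def homeomorphism_def)
qed

subsection \<open>Differentials\<close>

lemma tangent_map_has_derivative:
  assumes "smooth_manifold A" "smooth_manifold B" "open W" "smooth_map_on A B W f" "p \<in> W"
  shows "((snd (chart_at B (f p)) \<circ> f \<circ> chart_inv (chart_at A p)) has_derivative tangent_map A B f p)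
    (at (snd (chart_at A p) p))"
proof -
  obtain V where "snd (chart_at A p) p \<in> V"
    "smooth_on V (snd (chart_at B (f p)) \<circ> f \<circ> chart_inv (chart_at A p))"
    by (rule smooth_map_on_rep[OF assms chart_at_in[OF assms(1)] chart_at_in[OF assms(2)]])
  then show ?thesis unfolding tangent_map_def using smooth_on_has_derivative by blast
qed

lemma tangent_map_linear:
  assumes "smooth_manifold A" "smooth_manifold B" "open W" "smooth_map_on A B W f" "p \<in> W"
  shows "linear (tangent_map A B f p)"
  using has_derivative_linear[OF tangent_map_has_derivative[OF assms]] .

lemma tangent_map_cong:
  assumes "smooth_manifold A" "smooth_manifold B" "open W" "smooth_map_on A B W f" "p \<in> W"
    "\<And>x. x \<in> W \<Longrightarrow> f x = g x"
  shows "tangent_map A B f p = tangent_map A B g p"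
proof -
  let ?c = "chart_at A p" and ?d = "chart_at B (f p)"
  obtain V where V: "open V" "snd ?c p \<in> V" "chart_inv ?c ` V \<subseteq> W" "smooth_on V (snd ?d \<circ> f \<circ> chart_inv ?c)"
    by (rule smooth_map_on_rep[OF assms(1-5) chart_at_in[OF assms(1)] chart_at_in[OF assms(2)]])
  have "frechet_derivative (snd ?d \<circ> f \<circ> chart_inv ?c) (at (snd ?c p)) =
      frechet_derivative (snd ?d \<circ> g \<circ> chart_inv ?c) (at (snd ?c p))"
    by (rule frechet_derivative_transform_within_open[OF smooth_on_differentiable[OF V(4,2)] V(1,2)])
      (use V(3) assms(6) in auto)
  then show ?thesis by (simp add: tangent_map_def assms(6)[OF assms(5)])
qed

text \<open>Distinguished charts depend on the point alone: the target chart of \<open>f\<close> at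
  \<open>f p\<close> is the source chart of \<open>g\<close>, so the ordinary chain rule applies
  without a transition factor.\<close>

lemma tangent_map_compose:
  assumes "smooth_manifold A" "smooth_manifold B" "smooth_manifold C" "open W" "open V"
    and f: "smooth_map_on A B W f" and g: "smooth_map_on B C V g" and p: "p \<in> W" "f p \<in> V"
  shows "tangent_map A C (\<lambda>x. g (f x)) p v = tangent_map B C g (f p) (tangent_map A B f p v)"
proof -
  let ?c = "chart_at A p" and ?d = "chart_at B (f p)" and ?e = "chart_at C (g (f p))"
  note c = chart_at_in[OF assms(1), of p] and d = chart_at_in[OF assms(2), of "f p"]
  obtain V1 where V1: "open V1" "snd ?c p \<in> V1" "f ` chart_inv ?c ` V1 \<subseteq> fst ?d"
    by (rule smooth_map_on_rep[OF assms(1,2,4) f p(1) c d])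
  have eq: "snd ?d (f p) = (snd ?d \<circ> f \<circ> chart_inv ?c) (snd ?c p)"
    using chart_inv_chart[OF assms(1) c] by simp
  note df = tangent_map_has_derivative[OF assms(1,2,4) f p(1)]
    and dg = tangent_map_has_derivative[OF assms(2,3,5) g p(2)]
  have "((\<lambda>x. (snd ?e \<circ> g \<circ> chart_inv ?d) ((snd ?d \<circ> f \<circ> chart_inv ?c) x)) has_derivative
      (\<lambda>v. tangent_map B C g (f p) (tangent_map A B f p v))) (at (snd ?c p))"
    by (rule has_derivative_compose[OF df]) (use dg in \<open>simp only: eq\<close>)
  then have "((snd ?e \<circ> (\<lambda>x. g (f x)) \<circ> chart_inv ?c) has_derivative
      (\<lambda>v. tangent_map B C g (f p) (tangent_map A B f p v))) (at (snd ?c p))"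
    by (rule has_derivative_transform_within_open[OF _ V1(1,2)])
      (use V1(3) chart_inv_chart[OF assms(2) d(1)] in \<open>simp add: image_subset_iff\<close>)
  from frechet_derivative_at[OF this] show ?thesis unfolding tangent_map_def by metis
qed

lemma tangent_map_ident:
  assumes "smooth_manifold A"
  shows "tangent_map A A (\<lambda>x. x) p v = v"
proof -
  let ?c = "chart_at A p"
  note c = chart_at_in[OF assms, of p]
  have "((\<lambda>x. x) has_derivative (\<lambda>v. v)) (at (snd ?c p))" by (rule has_derivative_ident)
  then have "((snd ?c \<circ> (\<lambda>x. x) \<circ> chart_inv ?c) has_derivative (\<lambda>v. v)) (at (snd ?c p))"
    by (rule has_derivative_transform_within_open[OF _ open_chart_image[OF assms c(1)]])
      (use c chart_chart_inv[OF assms c(1)] in auto)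
  from frechet_derivative_at[OF this] show ?thesis unfolding tangent_map_def by metis
qed

lemma tangent_map_std: "tangent_map std_atlas std_atlas f x = frechet_derivative f (at x)"
  by (simp add: tangent_map_def)

text \<open>The composition is the identity on the open set of points of \<open>W\<close> that
  \<open>f\<close> maps into \<open>V\<close>, and its differential at \<open>p\<close> depends on
  nothing beyond that set.\<close>

lemma tangent_map_left_inverse:
  assumes "smooth_manifold A" "smooth_manifold B" "open W" "open V"
    and f: "smooth_map_on A B W f" and g: "smooth_map_on B A V g" and p: "p \<in> W" "f p \<in> V"
    and gf: "\<And>x. x \<in> W \<Longrightarrow> f x \<in> V \<Longrightarrow> g (f x) = x"
  shows "tangent_map B A g (f p) (tangent_map A B f p v) = v"
proof -
  have o: "open (W \<inter> f -` V)" by (rule open_smooth_preimage[OF f assms(3,4)])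
  have "tangent_map B A g (f p) (tangent_map A B f p v) = tangent_map A A (\<lambda>x. g (f x)) p v"
    using tangent_map_compose[OF assms(1,2,1) assms(3,4) f g p] by simp
  also have "\<dots> = tangent_map A A (\<lambda>x. x) p v"
    using tangent_map_cong[OF assms(1) assms(1) o smooth_map_on_ident[OF assms(1)], of p "\<lambda>x. g (f x)"]
      gf p by simp
  finally show ?thesis using tangent_map_ident[OF assms(1)] by simp
qed

lemma diffeo_on_tangent_bij:
  assumes "smooth_manifold A" "smooth_manifold B" "diffeo_on A B W f" "p \<in> W"
  shows "bij (tangent_map A B f p)"
proof -
  let ?g = "inv_into W f"
  note d = assms(3)[unfolded diffeo_on_def]
  have g: "?g (f p) = p" using d assms(4) by (simp add: inv_into_f_f)
  have 1: "tangent_map B A ?g (f p) (tangent_map A B f p v) = v" for v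
    by (rule tangent_map_left_inverse[OF assms(1,2), of W "f ` W"])
      (use d assms(4) in \<open>auto simp: inv_into_f_f\<close>)
  have 2: "tangent_map A B f (?g (f p)) (tangent_map B A ?g (f p) v) = v" for v
    by (rule tangent_map_left_inverse[OF assms(2,1), of "f ` W" W])
      (use d assms(4) in \<open>auto simp: inv_into_f_f\<close>)
  show ?thesis
    by (rule bij_betw_byWitness[of _ "tangent_map B A ?g (f p)"]) (use 1 2 g in auto)
qed

subsection \<open>Products\<close>

lemma prod_atlasE:
  assumes "P \<in> prod_atlas A B"
  obtains C D where "C \<in> A" "D \<in> B" "P = (fst C \<times> fst D, map_prod (snd C) (snd D))"
  using assms unfolding prod_atlas_def by blast

text \<open>Chart inverses are given by \<open>inv_into\<close> and are arbitrary off the image of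
  the chart; on the image the product chart is injective and its inverse splits.\<close>

lemma prod_chart_inv:
  assumes "smooth_manifold A" "smooth_manifold B" "C \<in> A" "D \<in> B"
    "x \<in> snd C ` fst C" "y \<in> snd D ` fst D"
  shows "chart_inv (fst C \<times> fst D, map_prod (snd C) (snd D)) (x, y) = (chart_inv C x, chart_inv D y)"
proof -
  obtain p q where pq: "p \<in> fst C" "x = snd C p" "q \<in> fst D" "y = snd D q" using assms by blast
  have "inj_on (snd C) (fst C)" "inj_on (snd D) (fst D)"
    using chart_inv_chart[OF assms(1,3)] chart_inv_chart[OF assms(2,4)] by (metis inj_on_inverseI)+
  then have "inj_on (map_prod (snd C) (snd D)) (fst C \<times> fst D)" by (rule map_prod_inj_on)
  from inv_into_f_f[OF this, of "(p, q)"] show ?thesis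
    using pq chart_inv_chart[OF assms(1,3)] chart_inv_chart[OF assms(2,4)] by (simp add: chart_inv_def)
qed

lemma smooth_on_map_prod:
  fixes f :: "'a::euclidean_space \<Rightarrow> 'b::real_normed_vector" and g :: "'c::euclidean_space \<Rightarrow> 'd::real_normed_vector"
  assumes "open S" "open T" "smooth_on S f" "smooth_on T g"
  shows "smooth_on (S \<times> T) (map_prod f g)"
proof -
  have o: "open (S \<times> T)" using assms by (simp add: open_Times)
  have f: "smooth_on (S \<times> T) (\<lambda>z. f (fst z))"
    by (rule smooth_on_compose[OF o assms(1) _ smooth_on_linear[OF bounded_linear_fst] assms(3)]) auto
  have g: "smooth_on (S \<times> T) (\<lambda>z. g (snd z))"
    by (rule smooth_on_compose[OF o assms(2) _ smooth_on_linear[OF bounded_linear_snd] assms(4)]) auto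
  show ?thesis using smooth_on_Pair[OF o f g] by (simp add: map_prod_def case_prod_beta')
qed

lemma smooth_manifold_prod:
  assumes A: "smooth_manifold A" and B: "smooth_manifold B"
  shows "smooth_manifold (prod_atlas A B)"
  unfolding smooth_manifold_def
proof (intro conjI ballI)
  have "p \<in> \<Union> (fst ` prod_atlas A B)" for p :: "'a \<times> 'c"
  proof -
    let ?C = "chart_at A (fst p)" and ?D = "chart_at B (snd p)"
    have "(fst ?C \<times> fst ?D, map_prod (snd ?C) (snd ?D)) \<in> prod_atlas A B"
      unfolding prod_atlas_def using chart_at_in[OF A] chart_at_in[OF B] by blast
    from imageI[OF this, of fst] have "fst ?C \<times> fst ?D \<subseteq> \<Union> (fst ` prod_atlas A B)" by force
    moreover have "p \<in> fst ?C \<times> fst ?D"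
      using chart_at_in[OF A, of "fst p"] chart_at_in[OF B, of "snd p"] by (simp add: mem_Times_iff)
    ultimately show ?thesis by blast
  qed
  then show "\<Union> (fst ` prod_atlas A B) = UNIV" by blast
next
  fix P assume "P \<in> prod_atlas A B"
  then obtain C D where CD: "C \<in> A" "D \<in> B" "P = (fst C \<times> fst D, map_prod (snd C) (snd D))"
    by (rule prod_atlasE)
  have im: "snd P ` fst P = snd C ` fst C \<times> snd D ` fst D" by (simp add: CD(3) map_prod_surj_on[OF refl refl])
  show "open (fst P)" "open (snd P ` fst P)"
    using open_chart_domain[OF A CD(1)] open_chart_domain[OF B CD(2)]
      open_chart_image[OF A CD(1)] open_chart_image[OF B CD(2)]
    unfolding im by (simp_all add: CD(3) open_Times)
  note hC = homeomorphism_chart[OF A CD(1)] and hD = homeomorphism_chart[OF B CD(2)]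
  show "homeomorphism (fst P) (snd P ` fst P) (snd P) (chart_inv P)"
    unfolding im
  proof (rule homeomorphismI)
    have cC: "continuous_on (fst C) (snd C)" "continuous_on (snd C ` fst C) (chart_inv C)"
      and cD: "continuous_on (fst D) (snd D)" "continuous_on (snd D ` fst D) (chart_inv D)"
      using hC hD unfolding homeomorphism_def by auto
    have "continuous_on (fst P) (\<lambda>z. (snd C (fst z), snd D (snd z)))"
      by (intro continuous_on_Pair continuous_on_compose2[OF cC(1)] continuous_on_compose2[OF cD(1)]
          continuous_on_fst continuous_on_snd continuous_on_id) (auto simp: CD(3))
    then show "continuous_on (fst P) (snd P)" by (simp add: CD(3) map_prod_def case_prod_beta')
    have "continuous_on (snd C ` fst C \<times> snd D ` fst D) (\<lambda>z. (chart_inv C (fst z), chart_inv D (snd z)))"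
      by (intro continuous_on_Pair continuous_on_compose2[OF cC(2)] continuous_on_compose2[OF cD(2)]
          continuous_on_fst continuous_on_snd continuous_on_id) auto
    then show "continuous_on (snd C ` fst C \<times> snd D ` fst D) (chart_inv P)"
      by (rule continuous_on_eq) (use prod_chart_inv[OF A B CD(1,2)] in \<open>auto simp: CD(3)\<close>)
    show "snd P ` fst P \<subseteq> snd C ` fst C \<times> snd D ` fst D" by (simp add: im)
    show "chart_inv P ` (snd C ` fst C \<times> snd D ` fst D) \<subseteq> fst P"
      using prod_chart_inv[OF A B CD(1,2)] chart_inv_in[OF A CD(1)] chart_inv_in[OF B CD(2)]
      by (auto simp: CD(3))
    show "chart_inv P (snd P z) = z" if "z \<in> fst P" for z
      using that prod_chart_inv[OF A B CD(1,2)] chart_inv_chart[OF A CD(1)] chart_inv_chart[OF B CD(2)]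
      by (auto simp: CD(3))
    show "snd P (chart_inv P z) = z" if "z \<in> snd C ` fst C \<times> snd D ` fst D" for z
      using that prod_chart_inv[OF A B CD(1,2)] chart_chart_inv[OF A CD(1)] chart_chart_inv[OF B CD(2)]
      by (auto simp: CD(3))
  qed
next
  fix P Q assume "P \<in> prod_atlas A B" "Q \<in> prod_atlas A B"
  then obtain C D C' D' where CD: "C \<in> A" "D \<in> B" "P = (fst C \<times> fst D, map_prod (snd C) (snd D))"
    "C' \<in> A" "D' \<in> B" "Q = (fst C' \<times> fst D', map_prod (snd C') (snd D'))"
    by (metis prod_atlasE)
  let ?U = "snd C ` (fst C \<inter> fst C')" and ?V = "snd D ` (fst D \<inter> fst D')"
  have o: "open ?U" "open ?V"
    using open_chart_restrict[OF A CD(1)] open_chart_restrict[OF B CD(2)]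
      open_chart_domain[OF A CD(4)] open_chart_domain[OF B CD(5)] by blast+
  have im: "snd P ` (fst P \<inter> fst Q) = ?U \<times> ?V"
    by (simp add: CD(3,6) Times_Int_Times map_prod_surj_on[OF refl refl])
  have "smooth_on (?U \<times> ?V) (map_prod (snd C' \<circ> chart_inv C) (snd D' \<circ> chart_inv D))"
    by (rule smooth_on_map_prod[OF o smooth_transition[OF A CD(1,4)] smooth_transition[OF B CD(2,5)]])
  then have "smooth_on (?U \<times> ?V) (snd Q \<circ> chart_inv P)"
    by (rule smooth_on_cong[OF open_Times[OF o], rotated])
      (use prod_chart_inv[OF A B CD(1,2)] in \<open>auto simp: CD(3,6)\<close>)
  then show "smooth_on (snd P ` (fst P \<inter> fst Q)) (snd Q \<circ> chart_inv P)" by (simp only: im)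
qed

lemma smooth_map_on_proj:
  assumes A: "smooth_manifold A" and B: "smooth_manifold B"
  shows smooth_map_on_fst: "smooth_map_on (prod_atlas A B) A UNIV fst"
    and smooth_map_on_snd: "smooth_map_on (prod_atlas A B) B UNIV snd"
proof -
  note AB = smooth_manifold_prod[OF A B]
  have *: "\<exists>P\<in>prod_atlas A B. \<exists>C\<in>A. \<exists>D\<in>B. \<exists>V. p \<in> fst P \<and> fst p \<in> fst C \<and> snd p \<in> fst D \<and> open V \<and> snd P p \<in> V \<and>
     smooth_on V (snd C \<circ> fst \<circ> chart_inv P) \<and> smooth_on V (snd D \<circ> snd \<circ> chart_inv P)" for p
  proof -
    let ?C = "chart_at A (fst p)" and ?D = "chart_at B (snd p)"
    let ?P = "(fst ?C \<times> fst ?D, map_prod (snd ?C) (snd ?D))"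
    let ?V = "snd ?C ` fst ?C \<times> snd ?D ` fst ?D"
    note C = chart_at_in[OF A, of "fst p"] and D = chart_at_in[OF B, of "snd p"]
    have P: "?P \<in> prod_atlas A B" unfolding prod_atlas_def using C D by blast
    have V: "open ?V" using open_chart_image[OF A C(1)] open_chart_image[OF B D(1)] by (rule open_Times)
    have "smooth_on ?V fst" "smooth_on ?V snd"
      by (rule smooth_on_linear[OF bounded_linear_fst] smooth_on_linear[OF bounded_linear_snd])+
    note sm = this
    have 1: "smooth_on ?V (snd ?C \<circ> fst \<circ> chart_inv ?P)"
      by (rule smooth_on_cong[OF V _ sm(1)])
        (use prod_chart_inv[OF A B C(1) D(1)] chart_chart_inv[OF A C(1)] in auto)
    have 2: "smooth_on ?V (snd ?D \<circ> snd \<circ> chart_inv ?P)"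
      by (rule smooth_on_cong[OF V _ sm(2)])
        (use prod_chart_inv[OF A B C(1) D(1)] chart_chart_inv[OF B D(1)] in auto)
    have "p \<in> fst ?P" "snd ?P p \<in> ?V" using C D by (auto simp: mem_Times_iff map_prod_def split_beta)
    with P C D V 1 2 show ?thesis
      by (intro bexI[OF _ P] bexI[OF _ C(1)] bexI[OF _ D(1)] exI[of _ ?V] conjI)
  qed
  show "smooth_map_on (prod_atlas A B) A UNIV fst"
  proof (rule smooth_map_onI[OF AB A open_UNIV continuous_on_fst[OF continuous_on_id]])
    fix p :: "'a \<times> 'c"
    show "\<exists>C\<in>prod_atlas A B. \<exists>D\<in>A. \<exists>V. p \<in> fst C \<and> fst p \<in> fst D \<and> open V \<and> snd C p \<in> V \<and>
      smooth_on V (snd D \<circ> fst \<circ> chart_inv C)" using *[of p] by blast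
  qed
  show "smooth_map_on (prod_atlas A B) B UNIV snd"
  proof (rule smooth_map_onI[OF AB B open_UNIV continuous_on_snd[OF continuous_on_id]])
    fix p :: "'a \<times> 'c"
    show "\<exists>C\<in>prod_atlas A B. \<exists>D\<in>B. \<exists>V. p \<in> fst C \<and> snd p \<in> fst D \<and> open V \<and> snd C p \<in> V \<and>
      smooth_on V (snd D \<circ> snd \<circ> chart_inv C)" using *[of p] by blast
  qed
qed

lemma smooth_map_on_Pair:
  assumes A: "smooth_manifold A" and B: "smooth_manifold B" and C: "smooth_manifold C" and W: "open W"
    and f: "smooth_map_on A B W f" and g: "smooth_map_on A C W g"
  shows "smooth_map_on A (prod_atlas B C) W (\<lambda>x. (f x, g x))"
proof (rule smooth_map_onI[OF A smooth_manifold_prod[OF B C] W])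
  show "continuous_on W (\<lambda>x. (f x, g x))"
    using smooth_map_on_continuous[OF f] smooth_map_on_continuous[OF g] by (rule continuous_on_Pair)
  fix p assume p: "p \<in> W"
  let ?c = "chart_at A p" and ?d = "chart_at B (f p)" and ?e = "chart_at C (g p)"
  let ?P = "(fst ?d \<times> fst ?e, map_prod (snd ?d) (snd ?e))"
  note c = chart_at_in[OF A, of p] and d = chart_at_in[OF B, of "f p"] and e = chart_at_in[OF C, of "g p"]
  have P: "?P \<in> prod_atlas B C" unfolding prod_atlas_def using d e by blast
  obtain V1 where V1: "open V1" "snd ?c p \<in> V1" "smooth_on V1 (snd ?d \<circ> f \<circ> chart_inv ?c)"
    by (rule smooth_map_on_rep[OF A B W f p c d])
  obtain V2 where V2: "open V2" "snd ?c p \<in> V2" "smooth_on V2 (snd ?e \<circ> g \<circ> chart_inv ?c)"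
    by (rule smooth_map_on_rep[OF A C W g p c e])
  have "smooth_on (V1 \<inter> V2) (\<lambda>x. ((snd ?d \<circ> f \<circ> chart_inv ?c) x, (snd ?e \<circ> g \<circ> chart_inv ?c) x))"
    by (intro smooth_on_Pair open_Int V1(1) V2(1) smooth_on_subset[OF V1(3)] smooth_on_subset[OF V2(3)]) auto
  then have "smooth_on (V1 \<inter> V2) (snd ?P \<circ> (\<lambda>x. (f x, g x)) \<circ> chart_inv ?c)"
    by (simp add: comp_def map_prod_def)
  then show "\<exists>C'\<in>A. \<exists>D\<in>prod_atlas B C. \<exists>V. p \<in> fst C' \<and> (f p, g p) \<in> fst D \<and> open V \<and> snd C' p \<in> V \<and>
     smooth_on V (snd D \<circ> (\<lambda>x. (f x, g x)) \<circ> chart_inv C')"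
    using c P d e V1 V2 by (intro bexI[of _ ?c] bexI[of _ ?P] exI[of _ "V1 \<inter> V2"]) auto
qed


section \<open>Calculus through a local diffeomorphism to a vector space\<close>

lemma smooth_on_frechet_apply_compose:
  fixes h :: "'a::euclidean_space \<Rightarrow> 'b::real_normed_vector" and u :: "'c::real_normed_vector \<Rightarrow> 'a"
  assumes "open S" "open V" "u ` S \<subseteq> V" "smooth_on V h" "smooth_on S u" "smooth_on S w"
  shows "smooth_on S (\<lambda>x. frechet_derivative h (at (u x)) (w x))"
proof (rule smooth_on_cong[OF assms(1)])
  have "smooth_on S (\<lambda>x. frechet_derivative h (at (u x)) b)" for b
    by (rule smooth_on_compose[OF assms(1-3,5) smooth_on_frechet[OF assms(4)]])
  then show "smooth_on S (\<lambda>x. \<Sum>b\<in>Basis. (w x \<bullet> b) *\<^sub>R frechet_derivative h (at (u x)) b)"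
    by (intro smooth_on_sum assms(1) finite_Basis smooth_on_bilinear[OF _ bounded_bilinear_scaleR]
        smooth_on_bounded_linear[OF _ bounded_linear_inner_left] assms)
  fix x assume "x \<in> S"
  then have "h differentiable (at (u x))" using assms(3,4) smooth_on_differentiable by blast
  from has_derivative_basis_sum[OF this]
  show "(\<Sum>b\<in>Basis. (w x \<bullet> b) *\<^sub>R frechet_derivative h (at (u x)) b) = frechet_derivative h (at (u x)) (w x)"
    by metis
qed

text \<open>Leibniz rule for a derivative applied to a moving vector. The term with the vector
  frozen is the second derivative of \<open>h\<close>, the one that has to cancel in Lie
  brackets.\<close>

lemma frechet_apply_has_derivative:
  fixes h :: "'a::euclidean_space \<Rightarrow> 'b::real_normed_vector"
  assumes S: "open S" "smooth_on S h" "x \<in> S" and w: "(w has_derivative w') (at x)"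
  shows "((\<lambda>y. frechet_derivative h (at y) (w y)) has_derivative
     (\<lambda>v. frechet_derivative (\<lambda>y. frechet_derivative h (at y) (w x)) (at x) v +
        frechet_derivative h (at x) (w' v))) (at x)"
proof -
  let ?h = "\<lambda>b y. frechet_derivative h (at y) b"
  let ?h' = "\<lambda>b. frechet_derivative (?h b) (at x)"
  have d: "(?h b has_derivative ?h' b) (at x)" for b
    by (rule smooth_on_has_derivative[OF smooth_on_frechet[OF S(2)] S(3)])
  have e: "frechet_derivative h (at y) v = (\<Sum>b\<in>Basis. (v \<bullet> b) *\<^sub>R ?h b y)" if "y \<in> S" for y v
    by (rule has_derivative_basis_sum[OF smooth_on_differentiable[OF S(2) that]])
  have w': "((\<lambda>y. w y \<bullet> b) has_derivative (\<lambda>v. w' v \<bullet> b)) (at x)" for b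
    by (rule bounded_linear.has_derivative[OF bounded_linear_inner_left w])
  have "((\<lambda>y. (w y \<bullet> b) *\<^sub>R ?h b y) has_derivative
      (\<lambda>v. (w x \<bullet> b) *\<^sub>R ?h' b v + (w' v \<bullet> b) *\<^sub>R ?h b x)) (at x)" for b
    by (rule has_derivative_scaleR[OF w' d])
  then have 1: "((\<lambda>y. \<Sum>b\<in>Basis. (w y \<bullet> b) *\<^sub>R ?h b y) has_derivative
      (\<lambda>v. \<Sum>b\<in>Basis. (w x \<bullet> b) *\<^sub>R ?h' b v + (w' v \<bullet> b) *\<^sub>R ?h b x)) (at x)"
    by (rule has_derivative_sum)
  have "((\<lambda>y. \<Sum>b\<in>Basis. (w x \<bullet> b) *\<^sub>R ?h b y) has_derivative (\<lambda>v. \<Sum>b\<in>Basis. (w x \<bullet> b) *\<^sub>R ?h' b v)) (at x)"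
    by (rule has_derivative_sum) (rule has_derivative_scaleR_right[OF d])
  then have "(?h (w x) has_derivative (\<lambda>v. \<Sum>b\<in>Basis. (w x \<bullet> b) *\<^sub>R ?h' b v)) (at x)"
    by (rule has_derivative_transform_within_open[OF _ S(1,3)]) (rule e[symmetric])
  from fun_cong[OF frechet_derivative_at[OF this], symmetric]
  have 2: "?h' (w x) v = (\<Sum>b\<in>Basis. (w x \<bullet> b) *\<^sub>R ?h' b v)" for v .
  have "(\<Sum>b\<in>Basis. (w x \<bullet> b) *\<^sub>R ?h' b v + (w' v \<bullet> b) *\<^sub>R ?h b x) = ?h' (w x) v + ?h (w' v) x" for v
    by (simp only: 2 e[OF S(3), of "w' v"] sum.distrib)
  then have 3: "(\<lambda>v. \<Sum>b\<in>Basis. (w x \<bullet> b) *\<^sub>R ?h' b v + (w' v \<bullet> b) *\<^sub>R ?h b x) =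
      (\<lambda>v. ?h' (w x) v + ?h (w' v) x)" by (rule ext)
  show ?thesis
    by (rule has_derivative_transform_within_open[OF 1[unfolded 3] S(1,3)]) (rule e[symmetric])
qed

lemma bilinear_basis_expand:
  fixes H :: "'a::euclidean_space \<Rightarrow> 'b::euclidean_space \<Rightarrow> real"
  assumes "bilinear H"
  shows "H u w = (\<Sum>b\<in>Basis. \<Sum>c\<in>Basis. ((u \<bullet> b) * (w \<bullet> c)) * H b c)"
proof -
  have "H u w = H (\<Sum>b\<in>Basis. (u \<bullet> b) *\<^sub>R b) (\<Sum>c\<in>Basis. (w \<bullet> c) *\<^sub>R c)"
    by (simp add: euclidean_representation)
  also have "\<dots> = (\<Sum>(b, c)\<in>Basis \<times> Basis. H ((u \<bullet> b) *\<^sub>R b) ((w \<bullet> c) *\<^sub>R c))"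
    using assms by (rule bilinear_sum)
  also have "\<dots> = (\<Sum>b\<in>Basis. \<Sum>c\<in>Basis. ((u \<bullet> b) * (w \<bullet> c)) * H b c)"
    using assms by (simp add: sum.cartesian_product[symmetric] bilinear_lmul bilinear_rmul mult.assoc)
  finally show ?thesis .
qed

text \<open>Three-term Leibniz rule. The hypothesis concerns the form on constant vectors; the basis
  expansion reduces moving arguments to products of scalar functions.\<close>

lemma bilinear_has_derivative:
  fixes K :: "'a::real_normed_vector \<Rightarrow> 'b::euclidean_space \<Rightarrow> 'c::euclidean_space \<Rightarrow> real"
  assumes bil: "\<And>y. bilinear (K y)" and K: "\<And>b c. ((\<lambda>y. K y b c) has_derivative K' b c) (at x)"
    and u: "(u has_derivative u') (at x)" and w: "(w has_derivative w') (at x)"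
  shows "((\<lambda>y. K y (u y) (w y)) has_derivative
    (\<lambda>v. K' (u x) (w x) v + K x (u' v) (w x) + K x (u x) (w' v))) (at x)"
proof -
  have u': "((\<lambda>y. u y \<bullet> b) has_derivative (\<lambda>v. u' v \<bullet> b)) (at x)" for b
    by (rule bounded_linear.has_derivative[OF bounded_linear_inner_left u])
  have w': "((\<lambda>y. w y \<bullet> b) has_derivative (\<lambda>v. w' v \<bullet> b)) (at x)" for b
    by (rule bounded_linear.has_derivative[OF bounded_linear_inner_left w])
  have "((\<lambda>y. ((u y \<bullet> b) * (w y \<bullet> c)) * K y b c) has_derivative
     (\<lambda>v. (u x \<bullet> b) * (w x \<bullet> c) * K' b c v + ((u x \<bullet> b) * (w' v \<bullet> c) + (u' v \<bullet> b) * (w x \<bullet> c)) * K x b c)) (at x)"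
    for b c by (rule has_derivative_mult[OF has_derivative_mult[OF u' w'] K])
  then have "((\<lambda>y. \<Sum>b\<in>Basis. \<Sum>c\<in>Basis. ((u y \<bullet> b) * (w y \<bullet> c)) * K y b c) has_derivative
     (\<lambda>v. \<Sum>b\<in>Basis. \<Sum>c\<in>Basis. (u x \<bullet> b) * (w x \<bullet> c) * K' b c v +
        ((u x \<bullet> b) * (w' v \<bullet> c) + (u' v \<bullet> b) * (w x \<bullet> c)) * K x b c)) (at x)"
    by (intro has_derivative_sum)
  then have 1: "((\<lambda>y. K y (u y) (w y)) has_derivative
     (\<lambda>v. \<Sum>b\<in>Basis. \<Sum>c\<in>Basis. (u x \<bullet> b) * (w x \<bullet> c) * K' b c v +
        ((u x \<bullet> b) * (w' v \<bullet> c) + (u' v \<bullet> b) * (w x \<bullet> c)) * K x b c)) (at x)"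
    by (simp only: bilinear_basis_expand[OF bil, symmetric])
  have "((\<lambda>y. \<Sum>b\<in>Basis. \<Sum>c\<in>Basis. ((u x \<bullet> b) * (w x \<bullet> c)) * K y b c) has_derivative
      (\<lambda>v. \<Sum>b\<in>Basis. \<Sum>c\<in>Basis. ((u x \<bullet> b) * (w x \<bullet> c)) * K' b c v)) (at x)"
    by (intro has_derivative_sum has_derivative_mult_right K)
  then have "((\<lambda>y. K y (u x) (w x)) has_derivative
      (\<lambda>v. \<Sum>b\<in>Basis. \<Sum>c\<in>Basis. ((u x \<bullet> b) * (w x \<bullet> c)) * K' b c v)) (at x)"
    by (simp only: bilinear_basis_expand[OF bil, symmetric])
  \<comment> \<open>The expansion of \<open>K'\<close> in the basis is not assumed. It holds because
    both sides are derivatives of the same function.\<close>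
  from has_derivative_unique[OF this K]
  have 2: "K' (u x) (w x) = (\<lambda>v. \<Sum>b\<in>Basis. \<Sum>c\<in>Basis. ((u x \<bullet> b) * (w x \<bullet> c)) * K' b c v)" by simp
  have 3: "(\<Sum>b\<in>Basis. \<Sum>c\<in>Basis. (u x \<bullet> b) * (w x \<bullet> c) * K' b c v +
        ((u x \<bullet> b) * (w' v \<bullet> c) + (u' v \<bullet> b) * (w x \<bullet> c)) * K x b c) =
      K' (u x) (w x) v + K x (u' v) (w x) + K x (u x) (w' v)" for v
    unfolding 2 bilinear_basis_expand[OF bil, of x "u' v" "w x"] bilinear_basis_expand[OF bil, of x "u x" "w' v"]
    by (simp add: sum.distrib distrib_right add_ac)
  show ?thesis using 1 by (simp only: 3)
qed

lemma smooth_on_bilinear_field: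
  fixes K :: "'a::real_normed_vector \<Rightarrow> 'b::euclidean_space \<Rightarrow> 'c::euclidean_space \<Rightarrow> real"
  assumes S: "open S" and bil: "\<And>y. bilinear (K y)" and K: "\<And>b c. smooth_on S (\<lambda>y. K y b c)"
    and u: "smooth_on S u" and w: "smooth_on S w"
  shows "smooth_on S (\<lambda>y. K y (u y) (w y))"
proof -
  have "smooth_on S (\<lambda>y. \<Sum>b\<in>Basis. \<Sum>c\<in>Basis. ((u y \<bullet> b) * (w y \<bullet> c)) * K y b c)"
    by (intro smooth_on_sum S finite_Basis smooth_on_bilinear[OF _ bounded_bilinear_mult]
        smooth_on_bounded_linear[OF _ bounded_linear_inner_left] K u w)
  then show ?thesis by (simp only: bilinear_basis_expand[OF bil, symmetric])
qed

text \<open>Instantiated for the manifold with \<open>dev\<close> and for its tangent bundle with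
  \<open>map_prod dev id\<close>. The map \<Phi> may fail to be injective, hence the local inverses
  below.\<close>

locale local_model =
  fixes B :: "('n::{t2_space,second_countable_topology}, 'f::euclidean_space) chart set"
    and \<Phi> :: "'n \<Rightarrow> 'f"
  assumes manifold: "smooth_manifold B"
    and local_diffeo: "\<And>p. \<exists>U. p \<in> U \<and> diffeo_on B std_atlas U \<Phi>"
begin

definition nb :: "'n \<Rightarrow> 'n set" where
  "nb p = (SOME U. p \<in> U \<and> diffeo_on B std_atlas U \<Phi>)"

definition sec :: "'n \<Rightarrow> 'f \<Rightarrow> 'n" where
  "sec p = inv_into (nb p) \<Phi>"

text \<open>This isomorphism from the tangent space to the model space absorbs the arbitrary choice
  of the distinguished chart at \<open>p\<close>.\<close>

definition frame :: "'n \<Rightarrow> 'f \<Rightarrow> 'f" where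
  "frame p = tangent_map B std_atlas \<Phi> p"

definition coframe :: "'n \<Rightarrow> 'f \<Rightarrow> 'f" where
  "coframe p = inv_into UNIV (frame p)"

text \<open>\<open>fd f p a\<close> is the derivative of \<open>f\<close> at \<open>p\<close> along the tangent vector with frame components \<open>a\<close>;
  only the germ of the local inverse \<open>sec p\<close> matters.\<close>

definition fd :: "('n \<Rightarrow> 'b::real_normed_vector) \<Rightarrow> 'n \<Rightarrow> 'f \<Rightarrow> 'b" where
  "fd f p a = frechet_derivative (f \<circ> sec p) (at (\<Phi> p)) a"

lemma nb_diffeo: "p \<in> nb p" "diffeo_on B std_atlas (nb p) \<Phi>"
  using someI_ex[OF local_diffeo[of p]] unfolding nb_def by auto

lemma open_nb: "open (nb p)" and open_image_nb: "open (\<Phi> ` nb p)" and inj_nb: "inj_on \<Phi> (nb p)"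
  using nb_diffeo(2)[of p] unfolding diffeo_on_def by blast+

lemma sec_model: "q \<in> nb p \<Longrightarrow> sec p (\<Phi> q) = q"
  unfolding sec_def by (rule inv_into_f_f[OF inj_nb])

lemma model_sec: "x \<in> \<Phi> ` nb p \<Longrightarrow> \<Phi> (sec p x) = x"
  unfolding sec_def by (rule f_inv_into_f)

lemma sec_in: "x \<in> \<Phi> ` nb p \<Longrightarrow> sec p x \<in> nb p"
  unfolding sec_def by (rule inv_into_into)

lemma sec_center [simp]: "sec p (\<Phi> p) = p"
  by (rule sec_model[OF nb_diffeo(1)])

lemma smooth_sec: "smooth_map_on std_atlas B (\<Phi> ` nb p) (sec p)"
  using nb_diffeo(2)[of p] unfolding diffeo_on_def sec_def by blast

lemma smooth_model: "smooth_map_on B std_atlas W \<Phi>"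
proof (rule smooth_map_on_local[OF _ manifold smooth_manifold_std])
  fix p
  show "\<exists>U. open U \<and> p \<in> U \<and> smooth_map_on B std_atlas U \<Phi>"
    using nb_diffeo[of p] open_nb[of p] unfolding diffeo_on_def by blast
qed

lemma open_model_image:
  assumes "open W"
  shows "open (\<Phi> ` (nb p \<inter> W))"
proof -
  have "\<Phi> ` (nb p \<inter> W) = \<Phi> ` nb p \<inter> sec p -` W"
    using sec_model model_sec sec_in by (force simp: image_iff)
  then show ?thesis
    using open_smooth_preimage[OF smooth_sec open_image_nb assms, of p] by simp
qed

lemma linear_frame: "linear (frame p)"
  unfolding frame_def
  by (rule tangent_map_linear[OF manifold smooth_manifold_std open_UNIV smooth_model UNIV_I])

lemma bij_frame: "bij (frame p)"
  unfolding frame_def by (rule diffeo_on_tangent_bij[OF manifold smooth_manifold_std nb_diffeo(2,1)])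

lemma frame_coframe [simp]: "frame p (coframe p a) = a"
  unfolding coframe_def using bij_frame by (simp add: bij_is_surj surj_f_inv_f)

lemma coframe_frame [simp]: "coframe p (frame p v) = v"
  unfolding coframe_def using bij_frame by (simp add: bij_is_inj inv_f_f)

lemma linear_coframe: "linear (coframe p)"
proof (rule linearI)
  note l = linear_add[OF linear_frame] linear_cmul[OF linear_frame]
  show "coframe p (a + b) = coframe p a + coframe p b" for a b
    by (metis coframe_frame frame_coframe l(1))
  show "coframe p (r *\<^sub>R a) = r *\<^sub>R coframe p a" for r a
    by (metis coframe_frame frame_coframe l(2))
qed

lemma frame_inject: "frame p v = frame p w \<longleftrightarrow> v = w"
  by (metis coframe_frame)

lemma smooth_map_rep:
  assumes "open W" "smooth_map_on B std_atlas W f" "p \<in> W"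
  obtains V where "open V" "\<Phi> p \<in> V" "V \<subseteq> \<Phi> ` nb p" "sec p ` V \<subseteq> W" "smooth_on V (f \<circ> sec p)"
proof
  let ?V = "\<Phi> ` (nb p \<inter> W)"
  show o: "open ?V" by (rule open_model_image[OF assms(1)])
  show "\<Phi> p \<in> ?V" using nb_diffeo(1) assms(3) by blast
  show s: "?V \<subseteq> \<Phi> ` nb p" by blast
  show i: "sec p ` ?V \<subseteq> W" using sec_model by auto
  have "smooth_map_on std_atlas std_atlas ?V (\<lambda>x. f (sec p x))"
    by (rule smooth_map_on_compose[OF smooth_manifold_std manifold smooth_manifold_std o assms(1)
          smooth_map_on_subset[OF smooth_sec s] assms(2) i])
  then show "smooth_on ?V (f \<circ> sec p)" by (simp add: smooth_map_std_std_iff comp_def)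
qed

lemma smooth_map_onI_rep:
  assumes D: "smooth_manifold D" and W: "open W"
    and loc: "\<And>p. p \<in> W \<Longrightarrow> \<exists>V. open V \<and> \<Phi> p \<in> V \<and> smooth_map_on std_atlas D V (f \<circ> sec p)"
  shows "smooth_map_on B D W f"
proof (rule smooth_map_on_local[OF _ manifold D])
  fix p assume p: "p \<in> W"
  obtain V where V: "open V" "\<Phi> p \<in> V" "smooth_map_on std_atlas D V (f \<circ> sec p)" using loc[OF p] by blast
  let ?U = "nb p \<inter> \<Phi> -` V"
  have U: "open ?U" by (rule open_smooth_preimage[OF smooth_model open_nb V(1)])
  have "smooth_map_on B D ?U (\<lambda>q. (f \<circ> sec p) (\<Phi> q))"
    by (rule smooth_map_on_compose[OF manifold smooth_manifold_std D U V(1) smooth_model V(3)]) auto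
  then have "smooth_map_on B D ?U f"
    by (rule smooth_map_on_cong[OF manifold D U]) (simp add: sec_model)
  then show "\<exists>U. open U \<and> p \<in> U \<and> smooth_map_on B D U f" using U V(2) nb_diffeo(1) by blast
qed

lemma smooth_map_stdI_rep:
  assumes "open W" "\<And>p. p \<in> W \<Longrightarrow> \<exists>V. open V \<and> \<Phi> p \<in> V \<and> smooth_on V (f \<circ> sec p)"
  shows "smooth_map_on B std_atlas W f"
  by (rule smooth_map_onI_rep[OF smooth_manifold_std assms(1)]) (simp add: smooth_map_std_std_iff assms(2))

lemma fd_has_derivative:
  assumes "open W" "smooth_map_on B std_atlas W f" "p \<in> W"
  shows "((f \<circ> sec p) has_derivative fd f p) (at (\<Phi> p))"
proof -
  obtain V where "\<Phi> p \<in> V" "smooth_on V (f \<circ> sec p)" by (rule smooth_map_rep[OF assms])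
  then show ?thesis unfolding fd_def[abs_def] using smooth_on_has_derivative by blast
qed

lemma linear_fd:
  "open W \<Longrightarrow> smooth_map_on B std_atlas W f \<Longrightarrow> p \<in> W \<Longrightarrow> linear (fd f p)"
  by (rule has_derivative_linear[OF fd_has_derivative])

lemma fd_eqI: "((f \<circ> sec p) has_derivative D) (at (\<Phi> p)) \<Longrightarrow> fd f p a = D a"
  unfolding fd_def by (metis frechet_derivative_at)

lemma fd_cong:
  assumes "open W" "smooth_map_on B std_atlas W f" "p \<in> W" "\<And>q. q \<in> W \<Longrightarrow> f q = g q"
  shows "fd f p a = fd g p a"
proof -
  obtain V where V: "open V" "\<Phi> p \<in> V" "sec p ` V \<subseteq> W" by (rule smooth_map_rep[OF assms(1-3)])
  show ?thesis
    by (rule fd_eqI[symmetric])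
      (rule has_derivative_transform_within_open[OF fd_has_derivative[OF assms(1-3)] V(1,2)];
        use V(3) assms(4) in auto)
qed

text \<open>The local inverses chosen at \<open>p\<close> and at \<open>q\<close> invert the same
  map and agree near the image of \<open>q\<close>. A single one thus computes \<open>fd f\<close>
  at all points near \<open>p\<close>, which is how smoothness of \<open>fd f\<close> in the point
  is seen.\<close>

lemma fd_near:
  assumes W: "open W" "smooth_map_on B std_atlas W f" "q \<in> W" and q: "q \<in> nb p"
  shows "((f \<circ> sec p) has_derivative fd f q) (at (\<Phi> q))"
proof (rule has_derivative_transform_within_open[OF fd_has_derivative[OF W]])
  show "open (\<Phi> ` (nb p \<inter> nb q))" by (rule open_model_image[OF open_nb])
  show "\<Phi> q \<in> \<Phi> ` (nb p \<inter> nb q)" using q nb_diffeo(1) by blast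
  show "(f \<circ> sec q) x = (f \<circ> sec p) x" if "x \<in> \<Phi> ` (nb p \<inter> nb q)" for x
    using that sec_model by auto
qed

lemma smooth_fd:
  assumes W: "open W" "smooth_map_on B std_atlas W f"
  shows "smooth_map_on B std_atlas W (\<lambda>q. fd f q a)"
proof (rule smooth_map_stdI_rep[OF W(1)])
  fix p assume p: "p \<in> W"
  obtain V where V: "open V" "\<Phi> p \<in> V" "V \<subseteq> \<Phi> ` nb p" "sec p ` V \<subseteq> W" "smooth_on V (f \<circ> sec p)"
    by (rule smooth_map_rep[OF W p])
  have "smooth_on V (\<lambda>x. frechet_derivative (f \<circ> sec p) (at x) a)" by (rule smooth_on_frechet[OF V(5)])
  then have "smooth_on V ((\<lambda>q. fd f q a) \<circ> sec p)"
  proof (rule smooth_on_cong[OF V(1), rotated])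
    fix x assume x: "x \<in> V"
    have "((f \<circ> sec p) has_derivative fd f (sec p x)) (at (\<Phi> (sec p x)))"
      by (rule fd_near[OF W]) (use V x sec_in in auto)
    moreover have "\<Phi> (sec p x) = x" using V(3) x model_sec by blast
    ultimately show "frechet_derivative (f \<circ> sec p) (at x) a = ((\<lambda>q. fd f q a) \<circ> sec p) x"
      using frechet_derivative_at by fastforce
  qed
  then show "\<exists>V. open V \<and> \<Phi> p \<in> V \<and> smooth_on V ((\<lambda>q. fd f q a) \<circ> sec p)" using V by blast
qed

text \<open>Near \<open>p\<close> the function is \<open>f \<circ> sec p\<close> after \<Phi>, and
  the chain rule separates the derivative in the model from the frame.\<close>

lemma tangent_map_eq_fd:
  assumes W: "open W" "smooth_map_on B std_atlas W f" "p \<in> W"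
  shows "tangent_map B std_atlas f p v = fd f p (frame p v)"
proof -
  obtain V where V: "open V" "\<Phi> p \<in> V" "V \<subseteq> \<Phi> ` nb p" "sec p ` V \<subseteq> W" "smooth_on V (f \<circ> sec p)"
    by (rule smooth_map_rep[OF W])
  let ?U = "nb p \<inter> \<Phi> -` V"
  have U: "open ?U" "p \<in> ?U"
    using open_smooth_preimage[OF smooth_model open_nb V(1)] V(2) nb_diffeo(1) by auto
  have s: "smooth_map_on std_atlas std_atlas V (f \<circ> sec p)" using V(5) by (simp add: smooth_map_std_std_iff)
  have "smooth_map_on B std_atlas ?U (\<lambda>q. (f \<circ> sec p) (\<Phi> q))"
    by (rule smooth_map_on_compose[OF manifold smooth_manifold_std smooth_manifold_std U(1) V(1) smooth_model s]) auto
  from tangent_map_cong[OF manifold smooth_manifold_std U(1) this U(2), of f]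
  have "tangent_map B std_atlas (\<lambda>q. (f \<circ> sec p) (\<Phi> q)) p = tangent_map B std_atlas f p"
    by (simp add: sec_model)
  with tangent_map_compose[OF manifold smooth_manifold_std smooth_manifold_std U(1) V(1) smooth_model s U(2) V(2)]
  show ?thesis by (simp add: fd_def frame_def tangent_map_std)
qed

lemma dir_deriv_eq_fd:
  assumes W: "open W" "smooth_map_on B std_atlas W f" "p \<in> W"
  shows "dir_deriv B f p v = fd f p (frame p v)"
  unfolding dir_deriv_def by (rule tangent_map_eq_fd[OF W])

subsection \<open>Vector fields\<close>

lemma frame_chart:
  assumes "C \<in> B" "q \<in> fst C"
  shows "frame q v = frechet_derivative (\<Phi> \<circ> chart_inv C) (at (snd C q)) (tangent_map B std_atlas (snd C) q v)"
proof -
  note oC = open_chart_domain[OF manifold assms(1)] open_chart_image[OF manifold assms(1)]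
  note s1 = smooth_map_on_chart[OF manifold assms(1)]
  have s2: "smooth_map_on std_atlas std_atlas (snd C ` fst C) (\<lambda>x. \<Phi> (chart_inv C x))"
    by (rule smooth_map_on_compose[OF smooth_manifold_std manifold smooth_manifold_std oC(2) open_UNIV
          smooth_map_on_chart_inv[OF manifold assms(1)] smooth_model]) auto
  have "tangent_map B std_atlas \<Phi> q = tangent_map B std_atlas (\<lambda>q. \<Phi> (chart_inv C (snd C q))) q"
    by (rule tangent_map_cong[OF manifold smooth_manifold_std oC(1) smooth_model assms(2)])
      (simp add: chart_inv_chart[OF manifold assms(1)])
  with tangent_map_compose[OF manifold smooth_manifold_std smooth_manifold_std oC s1 s2 assms(2)]
  show ?thesis using assms(2) by (simp add: frame_def tangent_map_std comp_def)
qed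

lemma smooth_model_chart_inv:
  assumes "C \<in> B"
  shows "smooth_on (snd C ` fst C) (\<Phi> \<circ> chart_inv C)"
  using smooth_model[of UNIV] assms unfolding smooth_map_on_std_iff by auto

text \<open>Chart components become frame components by the Jacobian of \<Phi> in the chart, and
  frame components become chart components by the Jacobian of the chart in the model. Both Jacobians
  are smooth.\<close>

lemma smooth_field_on_iff_frame:
  assumes W: "open W"
  shows "smooth_field_on B W X \<longleftrightarrow> smooth_map_on B std_atlas W (\<lambda>p. frame p (X p))"
proof
  assume X: "smooth_field_on B W X"
  show "smooth_map_on B std_atlas W (\<lambda>p. frame p (X p))"
  proof (rule smooth_map_on_stdI[OF manifold W])
    fix C assume C: "C \<in> B"
    let ?S = "snd C ` (fst C \<inter> W)"
    have o: "open ?S" by (rule open_chart_restrict[OF manifold C W])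
    have "smooth_on ?S (local_rep B C X)" using X C unfolding smooth_field_on_def by blast
    from smooth_on_frechet_apply[OF o smooth_on_subset[OF smooth_model_chart_inv[OF C]] this]
    have "smooth_on ?S (\<lambda>x. frechet_derivative (\<Phi> \<circ> chart_inv C) (at x) (local_rep B C X x))" by blast
    then show "smooth_on ?S ((\<lambda>p. frame p (X p)) \<circ> chart_inv C)"
      by (rule smooth_on_cong[OF o, rotated])
        (auto simp: frame_chart[OF C] local_rep_def chart_inv_chart[OF manifold C])
  qed
next
  assume X: "smooth_map_on B std_atlas W (\<lambda>p. frame p (X p))"
  show "smooth_field_on B W X"
    unfolding smooth_field_on_def
  proof (intro ballI smooth_on_local)
    fix C x assume C: "C \<in> B" and "x \<in> snd C ` (fst C \<inter> W)"
    then obtain p where p: "p \<in> fst C" "p \<in> W" "x = snd C p" by blast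
    note oC = open_chart_domain[OF manifold C]
    note s = smooth_map_on_chart[OF manifold C]
    obtain V where V: "open V" "\<Phi> p \<in> V" "V \<subseteq> \<Phi> ` nb p" "smooth_on V (snd C \<circ> sec p)"
      by (rule smooth_map_rep[OF oC s p(1)])
    let ?Q = "W \<inter> (nb p \<inter> \<Phi> -` V)"
    have Q: "open ?Q" using open_smooth_preimage[OF smooth_model open_nb V(1)] W by blast
    let ?S = "snd C ` (fst C \<inter> ?Q)"
    have S: "open ?S" by (rule open_chart_restrict[OF manifold C Q])
    have "smooth_on ?S (\<lambda>y. frechet_derivative (snd C \<circ> sec p) (at ((\<Phi> \<circ> chart_inv C) y))
        (((\<lambda>p. frame p (X p)) \<circ> chart_inv C) y))"
    proof (rule smooth_on_frechet_apply_compose[OF S V(1) _ V(4)])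
      show "(\<Phi> \<circ> chart_inv C) ` ?S \<subseteq> V" by (auto simp: chart_inv_chart[OF manifold C])
      show "smooth_on ?S (\<Phi> \<circ> chart_inv C)"
        by (rule smooth_on_subset[OF smooth_model_chart_inv[OF C]]) auto
      show "smooth_on ?S ((\<lambda>p. frame p (X p)) \<circ> chart_inv C)"
        using X C unfolding smooth_map_on_std_iff by (elim conjE ballE) (rule smooth_on_subset, auto)
    qed
    then have "smooth_on ?S (local_rep B C X)"
    proof (rule smooth_on_cong[OF S, rotated])
      fix y assume "y \<in> ?S"
      then obtain q where q: "q \<in> fst C" "q \<in> nb p" "\<Phi> q \<in> V" "y = snd C q" by blast
      then have e: "chart_inv C y = q" by (simp add: chart_inv_chart[OF manifold C])
      have "((snd C \<circ> sec p) has_derivative fd (snd C) q) (at (\<Phi> q))" by (rule fd_near[OF oC s q(1,2)])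
      then show "frechet_derivative (snd C \<circ> sec p) (at ((\<Phi> \<circ> chart_inv C) y))
        (((\<lambda>p. frame p (X p)) \<circ> chart_inv C) y) = local_rep B C X y"
        using tangent_map_eq_fd[OF oC s q(1)] frechet_derivative_at
        by (fastforce simp: local_rep_def e)
    qed
    then show "\<exists>U. open U \<and> x \<in> U \<and> smooth_on U (local_rep B C X)"
      using S p V nb_diffeo(1) by (intro exI[of _ ?S]) auto
  qed
qed

lemma smooth_const_field: "open W \<Longrightarrow> smooth_field_on B W (\<lambda>p. coframe p a)"
  by (simp add: smooth_field_on_iff_frame smooth_map_on_const)

text \<open>In a chart both sides differ by the second derivative of the coordinate change, which is
  symmetric.\<close>

lemma frame_lie_bracket:
  assumes W: "open W" "p \<in> W" and X: "smooth_field_on B W X" and Y: "smooth_field_on B W Y"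
  shows "frame p (lie_bracket B X Y p) =
    fd (\<lambda>q. frame q (Y q)) p (frame p (X p)) - fd (\<lambda>q. frame q (X q)) p (frame p (Y p))"
proof -
  let ?C = "chart_at B p"
  note C = chart_at_in[OF manifold, of p]
  let ?x = "snd ?C p" and ?\<tau> = "\<Phi> \<circ> chart_inv ?C"
  let ?S = "snd ?C ` (fst ?C \<inter> (nb p \<inter> W))"
  have S: "open ?S" by (rule open_chart_restrict[OF manifold C(1)]) (use W open_nb in blast)
  have x: "?x \<in> ?S" using C W nb_diffeo(1) by blast
  have \<tau>: "smooth_on ?S ?\<tau>" by (rule smooth_on_subset[OF smooth_model_chart_inv[OF C(1)]]) auto
  have \<tau>': "(?\<tau> has_derivative frechet_derivative ?\<tau> (at ?x)) (at ?x)"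
    by (rule smooth_on_has_derivative[OF \<tau> x])
  have fr: "frame p v = frechet_derivative ?\<tau> (at ?x) v" for v
    by (simp add: frame_def tangent_map_def)
  \<comment> \<open>Frame components of \<open>Z\<close> are the derivative of the coordinate change
    applied to the chart components. The Leibniz rule gives a second derivative of the coordinate
    change and the derivative of the chart components.\<close>
  have key: "fd (\<lambda>q. frame q (Z q)) p (frame p v) =
      frechet_derivative (\<lambda>y. frechet_derivative ?\<tau> (at y) (local_rep B ?C Z ?x)) (at ?x) v
      + frame p (frechet_derivative (local_rep B ?C Z) (at ?x) v)"
    if Z: "smooth_field_on B W Z" for Z v
  proof -
    have Zs: "smooth_map_on B std_atlas W (\<lambda>q. frame q (Z q))"
      using Z smooth_field_on_iff_frame[OF W(1)] by blast
    have "smooth_on ?S (local_rep B ?C Z)"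
      by (rule smooth_on_subset[of "snd ?C ` (fst ?C \<inter> W)"])
        (use Z C in \<open>auto simp: smooth_field_on_def\<close>)
    from frechet_apply_has_derivative[OF S \<tau> x smooth_on_has_derivative[OF this x]]
    have 1: "((\<lambda>y. frechet_derivative ?\<tau> (at y) (local_rep B ?C Z y)) has_derivative
      (\<lambda>v. frechet_derivative (\<lambda>y. frechet_derivative ?\<tau> (at y) (local_rep B ?C Z ?x)) (at ?x) v
      + frame p (frechet_derivative (local_rep B ?C Z) (at ?x) v))) (at ?x)" (is "(_ has_derivative ?D) _")
      by (simp only: fr)
    have "?\<tau> ?x = \<Phi> p" using chart_inv_chart[OF manifold C] by simp
    then have "((\<lambda>y. ((\<lambda>q. frame q (Z q)) \<circ> sec p) (?\<tau> y)) has_derivative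
        (\<lambda>v. fd (\<lambda>q. frame q (Z q)) p (frechet_derivative ?\<tau> (at ?x) v))) (at ?x)"
      by (intro has_derivative_compose[OF \<tau>']) (simp only: fd_has_derivative[OF W(1) Zs W(2)])
    then have "((\<lambda>y. frechet_derivative ?\<tau> (at y) (local_rep B ?C Z y)) has_derivative
        (\<lambda>v. fd (\<lambda>q. frame q (Z q)) p (frechet_derivative ?\<tau> (at ?x) v))) (at ?x)"
      by (rule has_derivative_transform_within_open[OF _ S x])
        (auto simp: chart_inv_chart[OF manifold C(1)] sec_model frame_chart[OF C(1)] local_rep_def)
    from has_derivative_unique[OF this 1] show ?thesis by (metis fr)
  qed
  have rep: "frechet_derivative ?\<tau> (at ?x) (local_rep B ?C Z ?x) = frame p (Z p)" for Z
    using frame_chart[OF C] by (simp add: local_rep_def chart_inv_chart[OF manifold C])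
  \<comment> \<open>By convention a tangent vector at \<open>p\<close> is its own list of components
    in the distinguished chart at \<open>p\<close>.\<close>
  have tid: "local_rep B ?C Z ?x = Z p" for Z
    using rep[of Z] fr frame_inject by metis
  show ?thesis
    using mixed_derivatives_commute[OF S \<tau> x, of "X p" "Y p"]
    by (simp add: key[OF X] key[OF Y] lie_bracket_def Let_def tid linear_diff[OF linear_frame])
qed

subsection \<open>Bilinear forms\<close>

lemma bilinear_coframe: "bilinear (h p) \<Longrightarrow> bilinear (\<lambda>a b. h p (coframe p a) (coframe p b))"
  using linear_coframe[of p] unfolding bilinear_def
  by (auto simp: linear_iff)

text \<open>Constant frame fields suffice as test fields: smooth fields have smooth frame
  components, and the form is a finite sum of its coefficients times such components.\<close>

lemma smooth_bilinear_fieldI: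
  assumes bil: "\<And>p. bilinear (h p)"
    and h: "\<And>a b. smooth_map_on B std_atlas UNIV (\<lambda>p. h p (coframe p a) (coframe p b))"
  shows "smooth_bilinear_field B h"
  unfolding smooth_bilinear_field_def
proof (intro conjI allI impI bil; elim conjE)
  fix W X Y assume W: "open W" and X: "smooth_field_on B W X" and Y: "smooth_field_on B W Y"
  let ?H = "\<lambda>p a b. h p (coframe p a) (coframe p b)"
  show "smooth_map_on B std_atlas W (\<lambda>p. h p (X p) (Y p))"
  proof (rule smooth_map_on_stdI[OF manifold W])
    fix C assume C: "C \<in> B"
    let ?S = "snd C ` (fst C \<inter> W)"
    have bil2: "bilinear (?H q)" for q by (rule bilinear_coframe[OF bil])
    have "smooth_on ?S ((\<lambda>p. ?H p a b) \<circ> chart_inv C)" for a b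
      using h C unfolding smooth_map_on_std_iff by (auto intro: smooth_on_subset)
    moreover have "smooth_on ?S ((\<lambda>p. frame p (X p)) \<circ> chart_inv C)" "smooth_on ?S ((\<lambda>p. frame p (Y p)) \<circ> chart_inv C)"
      using X Y C unfolding smooth_field_on_iff_frame[OF W] smooth_map_on_std_iff by blast+
    ultimately have "smooth_on ?S (\<lambda>x. ?H (chart_inv C x) (((\<lambda>p. frame p (X p)) \<circ> chart_inv C) x)
        (((\<lambda>p. frame p (Y p)) \<circ> chart_inv C) x))"
      using smooth_on_bilinear_field[of ?S "\<lambda>x. ?H (chart_inv C x)"
          "(\<lambda>p. frame p (X p)) \<circ> chart_inv C" "(\<lambda>p. frame p (Y p)) \<circ> chart_inv C"]
        open_chart_restrict[OF manifold C W] bil2 by (simp add: comp_def)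
    then show "smooth_on ?S ((\<lambda>p. h p (X p) (Y p)) \<circ> chart_inv C)" by (simp add: comp_def)
  qed
qed

lemma smooth_bilinear_fieldD:
  assumes "smooth_bilinear_field B h"
  shows "bilinear (h p)" "smooth_map_on B std_atlas UNIV (\<lambda>p. h p (coframe p a) (coframe p b))"
  using assms smooth_const_field[OF open_UNIV] unfolding smooth_bilinear_field_def by blast+

text \<open>The first term differentiates the coefficients of \<open>h\<close> with the frame
  components of both fields frozen at \<open>p\<close>; the other two differentiate the
  components.\<close>

lemma fd_bilinear_field:
  assumes h: "smooth_bilinear_field B h" and W: "open W" "p \<in> W"
    and X: "smooth_field_on B W X" and Y: "smooth_field_on B W Y"
  shows "fd (\<lambda>q. h q (X q) (Y q)) p c =
    fd (\<lambda>q. h q (coframe q (frame p (X p))) (coframe q (frame p (Y p)))) p c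
    + h p (coframe p (fd (\<lambda>q. frame q (X q)) p c)) (Y p)
    + h p (X p) (coframe p (fd (\<lambda>q. frame q (Y q)) p c))"
proof -
  let ?H = "\<lambda>q a b. h q (coframe q a) (coframe q b)"
  have bil: "bilinear (?H q)" for q by (rule bilinear_coframe[OF smooth_bilinear_fieldD(1)[OF h]])
  have K: "((\<lambda>x. ?H (sec p x) a b) has_derivative (\<lambda>c. fd (\<lambda>q. ?H q a b) p c)) (at (\<Phi> p))" for a b
    using fd_has_derivative[OF open_UNIV smooth_bilinear_fieldD(2)[OF h] UNIV_I] by (simp add: comp_def)
  have f: "((\<lambda>x. frame (sec p x) (Z (sec p x))) has_derivative fd (\<lambda>q. frame q (Z q)) p) (at (\<Phi> p))"
    if "smooth_field_on B W Z" for Z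
    using fd_has_derivative[OF W(1) _ W(2)] that smooth_field_on_iff_frame[OF W(1)] by (simp add: comp_def)
  have "((\<lambda>x. ?H (sec p x) (frame (sec p x) (X (sec p x))) (frame (sec p x) (Y (sec p x)))) has_derivative
      (\<lambda>c. fd (\<lambda>q. ?H q (frame p (X p)) (frame p (Y p))) p c
        + ?H p (fd (\<lambda>q. frame q (X q)) p c) (frame p (Y p))
        + ?H p (frame p (X p)) (fd (\<lambda>q. frame q (Y q)) p c))) (at (\<Phi> p))"
    using bilinear_has_derivative[of "\<lambda>x. ?H (sec p x)", OF bil K f[OF X] f[OF Y]] by simp
  then have "(((\<lambda>q. h q (X q) (Y q)) \<circ> sec p) has_derivative
      (\<lambda>c. fd (\<lambda>q. ?H q (frame p (X p)) (frame p (Y p))) p c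
        + ?H p (fd (\<lambda>q. frame q (X q)) p c) (frame p (Y p))
        + ?H p (frame p (X p)) (fd (\<lambda>q. frame q (Y q)) p c))) (at (\<Phi> p))"
    by (simp add: comp_def)
  from fd_eqI[OF this] show ?thesis by simp
qed

end


section \<open>Affine maps of a flat manifold with a development\<close>

lemma smooth_field_on_subset:
  assumes "smooth_field_on A W X" "V \<subseteq> W"
  shows "smooth_field_on A V X"
  unfolding smooth_field_on_def
proof
  fix C assume "C \<in> A"
  then have "smooth_on (snd C ` (fst C \<inter> W)) (local_rep A C X)" using assms(1) unfolding smooth_field_on_def by blast
  then show "smooth_on (snd C ` (fst C \<inter> V)) (local_rep A C X)" by (rule smooth_on_subset) (use assms(2) in blast)
qed

lemma affine_diffeo_on_nabla:
  assumes "affine_diffeo_on A nabla B nabla' W f" "open V" "V \<subseteq> W" "smooth_field_on A V Y"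
    "smooth_field_on B (f ` V) Y'" "\<And>p. p \<in> V \<Longrightarrow> tangent_map A B f p (Y p) = Y' (f p)" "p \<in> V"
  shows "tangent_map A B f p (nabla Y p v) = nabla' Y' (f p) (tangent_map A B f p v)"
  using assms unfolding affine_diffeo_on_def by blast

context local_model
begin

lemma fd_model: "fd \<Phi> p a = a"
  using tangent_map_eq_fd[OF open_UNIV smooth_model UNIV_I, of p "coframe p a"]
  by (simp add: frame_def[symmetric])

lemma smooth_compose_linear:
  assumes "open W" "smooth_map_on B std_atlas W f" "bounded_linear L"
  shows "smooth_map_on B std_atlas W (\<lambda>q. L (f q))"
proof -
  have "smooth_map_on std_atlas std_atlas UNIV L"
    by (simp add: smooth_map_std_std_iff smooth_on_linear assms)
  from smooth_map_on_compose[OF manifold smooth_manifold_std smooth_manifold_std assms(1) open_UNIV assms(2) this]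
  show ?thesis by simp
qed

lemma fd_linear:
  assumes "open W" "smooth_map_on B std_atlas W f" "p \<in> W" "bounded_linear L"
  shows "fd (\<lambda>q. L (f q)) p a = L (fd f p a)"
  using fd_eqI[of "\<lambda>q. L (f q)"] bounded_linear.has_derivative[OF assms(4) fd_has_derivative[OF assms(1-3)]]
  by (simp add: comp_def)

lemma smooth_diff:
  assumes "open W" "smooth_map_on B std_atlas W f" "smooth_map_on B std_atlas W g"
  shows "smooth_map_on B std_atlas W (\<lambda>q. f q - g q)"
proof (rule smooth_map_on_stdI[OF manifold assms(1)])
  fix C assume "C \<in> B"
  then show "smooth_on (snd C ` (fst C \<inter> W)) ((\<lambda>q. f q - g q) \<circ> chart_inv C)"
    using smooth_on_diff[OF open_chart_restrict[OF manifold _ assms(1)]] assms(2,3)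
    unfolding smooth_map_on_std_iff comp_def by blast
qed

lemma fd_diff:
  assumes "open W" "smooth_map_on B std_atlas W f" "smooth_map_on B std_atlas W g" "p \<in> W"
  shows "fd (\<lambda>q. f q - g q) p a = fd f p a - fd g p a"
  using fd_eqI[of "\<lambda>q. f q - g q"] has_derivative_diff[OF fd_has_derivative[OF assms(1,2,4)]
      fd_has_derivative[OF assms(1,3,4)]] by (simp add: comp_def)

lemma fd_const: "fd (\<lambda>q. c) p a = 0"
  by (simp add: fd_def comp_def)

text \<open>A ball around the image of \<open>p\<close> in the model is convex, so a vanishing
  derivative makes \<open>f \<circ> sec p\<close> constant there; the ball is then pulled back to
  the manifold.\<close>

lemma fd_zero_locally_constant:
  assumes W: "open W" "smooth_map_on B std_atlas W f" and z: "\<And>q a. q \<in> W \<Longrightarrow> fd f q a = 0" and p: "p \<in> W"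
  obtains V where "open V" "p \<in> V" "V \<subseteq> W" "\<And>q. q \<in> V \<Longrightarrow> f q = f p"
proof -
  obtain V where V: "open V" "\<Phi> p \<in> V" "V \<subseteq> \<Phi> ` nb p" "sec p ` V \<subseteq> W" "smooth_on V (f \<circ> sec p)"
    by (rule smooth_map_rep[OF W p])
  obtain r where r: "r > 0" "ball (\<Phi> p) r \<subseteq> V" using V(1,2) open_contains_ball by blast
  let ?U = "nb p \<inter> \<Phi> -` ball (\<Phi> p) r"
  have U: "open ?U" by (rule open_smooth_preimage[OF smooth_model open_nb open_ball])
  have d: "((f \<circ> sec p) has_derivative (\<lambda>h. 0)) (at x)" if "x \<in> ball (\<Phi> p) r" for x
  proof -
    have "x \<in> V" using that r(2) by blast
    then have x: "x \<in> \<Phi> ` nb p" "sec p x \<in> W" using V(3,4) by blast+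
    from fd_near[OF W x(2) sec_in[OF x(1)]]
    have "((f \<circ> sec p) has_derivative fd f (sec p x)) (at x)" by (simp add: model_sec[OF x(1)])
    moreover have "fd f (sec p x) = (\<lambda>h. 0)" using z[OF x(2)] by blast
    ultimately show ?thesis by simp
  qed
  have a: "f q = f p" if q: "q \<in> ?U" for q
  proof -
    have "(f \<circ> sec p) (\<Phi> q) = (f \<circ> sec p) (\<Phi> p)"
      by (rule has_derivative_zero_unique[of "ball (\<Phi> p) r" "f \<circ> sec p"])
        (use q r in \<open>auto intro: has_derivative_at_withinI[OF d]\<close>)
    then show ?thesis using q sec_model by simp
  qed
  have b: "?U \<subseteq> W"
  proof
    fix q assume q: "q \<in> ?U"
    then have "sec p (\<Phi> q) \<in> W" using r(2) V(4) by blast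
    then show "q \<in> W" using q sec_model by simp
  qed
  have c: "p \<in> ?U" using r nb_diffeo(1) by simp
  show ?thesis by (rule that[OF U c b a])
qed

lemma fd_zero_constant:
  assumes "connected (UNIV :: 'n set)" "smooth_map_on B std_atlas UNIV f" "\<And>q a. fd f q a = 0"
  shows "f p = f q"
proof (rule connected_local_const[OF assms(1)])
  show "\<forall>a\<in>UNIV. eventually (\<lambda>b. f a = f b) (at a within UNIV)"
  proof
    fix a
    obtain V where "open V" "a \<in> V" "\<And>q. q \<in> V \<Longrightarrow> f q = f a"
      using fd_zero_locally_constant[OF open_UNIV assms(2,3) UNIV_I, of a] by metis
    then show "eventually (\<lambda>b. f a = f b) (at a within UNIV)"
      unfolding eventually_at_topological by metis
  qed
qed auto

section \<open>Maps of the manifold read in the frames\<close>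

lemma smooth_model_compose:
  assumes "open W" "smooth_map_on B B W f"
  shows "smooth_map_on B std_atlas W (\<lambda>q. \<Phi> (f q))"
  by (rule smooth_map_on_compose[OF manifold manifold smooth_manifold_std assms(1) open_UNIV assms(2) smooth_model]) auto

text \<open>Composing with \<Phi> applies the frame at \<open>f p\<close> to the differential, so
  the matrix of the differential in the frames is the derivative of a map with values in the model
  space.\<close>

lemma frame_tangent:
  assumes "open W" "smooth_map_on B B W f" "p \<in> W"
  shows "frame (f p) (tangent_map B B f p v) = fd (\<lambda>q. \<Phi> (f q)) p (frame p v)"
  using tangent_map_compose[OF manifold manifold smooth_manifold_std assms(1) open_UNIV assms(2) smooth_model assms(3)]
    tangent_map_eq_fd[OF assms(1) smooth_model_compose[OF assms(1,2)] assms(3)]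
  by (simp add: frame_def)

lemma fd_chain:
  assumes W: "open W" "smooth_map_on B B W f" "p \<in> W" and V: "open V" "smooth_map_on B std_atlas V h" "f p \<in> V"
  shows "fd (\<lambda>q. h (f q)) p (frame p v) = fd h (f p) (frame (f p) (tangent_map B B f p v))"
proof -
  let ?U = "W \<inter> f -` V"
  have U: "open ?U" by (rule open_smooth_preimage[OF W(2,1) V(1)])
  have f: "smooth_map_on B B ?U f" by (rule smooth_map_on_subset[OF W(2)]) auto
  have p: "p \<in> ?U" using W V by auto
  have hf: "smooth_map_on B std_atlas ?U (\<lambda>q. h (f q))"
    by (rule smooth_map_on_compose[OF manifold manifold smooth_manifold_std U V(1) f V(2)]) auto
  show ?thesis
    using tangent_map_compose[OF manifold manifold smooth_manifold_std U V(1) f V(2) p V(3)]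
      tangent_map_eq_fd[OF U hf p] tangent_map_eq_fd[OF V] by simp
qed

text \<open>The image of \<Phi> contains a ball, and affine maps that agree on a ball have the same
  linear part and the same value at 0.\<close>

lemma affine_map_unique:
  assumes "affine_map T" "affine_map T'" "\<And>p. T (\<Phi> p) = T' (\<Phi> p)"
  shows "T = T'"
proof
  fix y
  fix p :: 'n
  have "open (\<Phi> ` nb p)" "\<Phi> p \<in> \<Phi> ` nb p" using open_image_nb nb_diffeo(1) by auto
  then obtain r where r: "r > 0" "ball (\<Phi> p) r \<subseteq> \<Phi> ` nb p" using open_contains_ball by blast
  have eq: "T x = T' x" if "x \<in> ball (\<Phi> p) r" for x using that r assms(3) by blast
  have lin: "linear (linear_part T)" "linear (linear_part T')" using assms unfolding affine_map_def by auto
  have T: "T x = linear_part T x + T 0" "T' x = linear_part T' x + T' 0" for x by (simp_all add: linear_part_def)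
  have l: "linear_part T v = linear_part T' v" for v
  proof (cases "v = 0")
    case True
    then show ?thesis using lin linear_0 by metis
  next
    case False
    \<comment> \<open>Scales \<open>v\<close> to length \<open>r / 2\<close>, so that the shifted
      centre stays in the ball.\<close>
    define s where "s = r / (2 * norm v)"
    have s: "s > 0" using r False by (simp add: s_def)
    have "norm (s *\<^sub>R v) < r" using r False by (simp add: s_def)
    then have "\<Phi> p + s *\<^sub>R v \<in> ball (\<Phi> p) r" by (simp add: dist_norm)
    from eq[OF this] eq[of "\<Phi> p"] r
    have "T (\<Phi> p + s *\<^sub>R v) - T (\<Phi> p) = T' (\<Phi> p + s *\<^sub>R v) - T' (\<Phi> p)" by simp
    then have "linear_part T (s *\<^sub>R v) = linear_part T' (s *\<^sub>R v)"
      by (simp add: T[of "\<Phi> p + s *\<^sub>R v"] T[of "\<Phi> p"] linear_add[OF lin(1)] linear_add[OF lin(2)])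
    then show ?thesis using s by (simp add: linear_cmul[OF lin(1)] linear_cmul[OF lin(2)])
  qed
  have "T 0 = T' 0" using eq[of "\<Phi> p"] r T[of "\<Phi> p"] l by simp
  then show "T y = T' y" by (simp add: T[of y] l)
qed

lemma induced_affine_eq:
  assumes "affine_map T" "\<Phi> \<circ> f = T \<circ> \<Phi>"
  shows "induced_affine \<Phi> f = T"
  unfolding induced_affine_def
proof (rule the_equality)
  fix T' assume "affine_map T' \<and> \<Phi> \<circ> f = T' \<circ> \<Phi>"
  then show "T' = T" using assms by (intro affine_map_unique) (auto simp: fun_eq_iff)
qed (use assms in auto)

text \<open>Affinity in frame form: one matrix \<open>S\<close> for the differential at all points.
  Linearity of \<open>S\<close> is not imposed, since \<open>S\<close> is the derivative of \<Phi>
  after \<open>f\<close>.\<close>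

definition intertwines :: "('n \<Rightarrow> 'n) \<Rightarrow> ('f \<Rightarrow> 'f) \<Rightarrow> bool" where
  "intertwines f S \<longleftrightarrow> smooth_map_on B B UNIV f \<and>
     (\<forall>q v. frame (f q) (tangent_map B B f q v) = S (frame q v))"

lemma intertwines_smooth: "intertwines f S \<Longrightarrow> smooth_map_on B B W f"
  unfolding intertwines_def by (rule smooth_map_on_subset[of _ _ UNIV]) auto

lemma intertwines_frame: "intertwines f S \<Longrightarrow> frame (f q) (tangent_map B B f q v) = S (frame q v)"
  unfolding intertwines_def by blast

lemma intertwines_fd: "intertwines f S \<Longrightarrow> fd (\<lambda>q. \<Phi> (f q)) p a = S a"
  using frame_tangent[OF open_UNIV intertwines_smooth UNIV_I, of f S p "coframe p a"] intertwines_frame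
  by simp

lemma intertwines_linear:
  assumes "intertwines f S"
  shows "linear S"
proof -
  have "linear (fd (\<lambda>q. \<Phi> (f q)) p)" for p
    by (rule linear_fd[OF open_UNIV smooth_model_compose[OF open_UNIV intertwines_smooth[OF assms]] UNIV_I])
  moreover have "fd (\<lambda>q. \<Phi> (f q)) p = S" for p using intertwines_fd[OF assms] by blast
  ultimately show ?thesis by metis
qed

lemma intertwines_id: "intertwines (\<lambda>x. x) (\<lambda>x. x)"
  unfolding intertwines_def by (simp add: smooth_map_on_ident manifold tangent_map_ident)

lemma tangent_map_comp_global:
  assumes "smooth_map_on B B UNIV f" "smooth_map_on B B UNIV g"
  shows "tangent_map B B (\<lambda>x. g (f x)) p v = tangent_map B B g (f p) (tangent_map B B f p v)"
  by (rule tangent_map_compose[OF manifold manifold manifold open_UNIV open_UNIV assms]) auto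

lemma smooth_comp_global:
  assumes "smooth_map_on B B UNIV f" "smooth_map_on B B UNIV g"
  shows "smooth_map_on B B UNIV (\<lambda>x. g (f x))"
  by (rule smooth_map_on_compose[OF manifold manifold manifold open_UNIV open_UNIV assms]) auto

lemma intertwines_comp:
  assumes "intertwines f S" "intertwines g R"
  shows "intertwines (\<lambda>x. g (f x)) (\<lambda>x. R (S x))"
  using assms tangent_map_comp_global[of f g] smooth_comp_global[of f g] unfolding intertwines_def by simp

lemma bij_diffeo_tangent:
  assumes "bij f" "smooth_map_on B B UNIV f" "smooth_map_on B B UNIV (inv_into UNIV f)"
  shows "tangent_map B B f p (tangent_map B B (inv_into UNIV f) (f p) v) = v"
    "tangent_map B B (inv_into UNIV f) (f p) (tangent_map B B f p v) = v"
proof -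
  have b: "inv_into UNIV f (f x) = x" "f (inv_into UNIV f x) = x" for x
    using assms(1) by (simp_all add: bij_is_inj bij_is_surj surj_f_inv_f)
  show "tangent_map B B f p (tangent_map B B (inv_into UNIV f) (f p) v) = v"
    using tangent_map_left_inverse[OF manifold manifold open_UNIV open_UNIV assms(3,2), of "f p"] b by simp
  show "tangent_map B B (inv_into UNIV f) (f p) (tangent_map B B f p v) = v"
    using tangent_map_left_inverse[OF manifold manifold open_UNIV open_UNIV assms(2,3), of p] b by simp
qed

text \<open>Injectivity of the differential of \<open>f\<close> makes \<open>S\<close> injective,
  and the relation for the inverse map is the one for \<open>f\<close> at the preimage, solved for
  the inner vector.\<close>

lemma intertwines_inv:
  assumes "bij f" "smooth_map_on B B UNIV (inv_into UNIV f)" "intertwines f S"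
  shows "intertwines (inv_into UNIV f) (inv_into UNIV S)"
proof -
  note t = bij_diffeo_tangent[OF assms(1) intertwines_smooth[OF assms(3)] assms(2)]
  have b: "inv_into UNIV f (f x) = x" "f (inv_into UNIV f x) = x" for x
    using assms(1) by (simp_all add: bij_is_inj bij_is_surj surj_f_inv_f)
  have "inj S"
  proof (rule injI)
    fix a b assume "S a = S b"
    then have "frame (f p) (tangent_map B B f p (coframe p a)) = frame (f p) (tangent_map B B f p (coframe p b))" for p
      by (simp add: intertwines_frame[OF assms(3)])
    then show "a = b" by (metis frame_inject frame_coframe t(2))
  qed
  moreover have "S (frame (inv_into UNIV f q) (tangent_map B B (inv_into UNIV f) q v)) = frame q v" for q v
    using intertwines_frame[OF assms(3), of "inv_into UNIV f q" "tangent_map B B (inv_into UNIV f) q v"] t(1)[of "inv_into UNIV f q" v] b by simp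
  ultimately have "frame (inv_into UNIV f q) (tangent_map B B (inv_into UNIV f) q v) = inv_into UNIV S (frame q v)" for q v
    by (metis inv_f_f)
  then show ?thesis using assms(2) unfolding intertwines_def by blast
qed

text \<open>The difference between \<Phi> after \<open>f\<close> and \<open>S\<close> after \<Phi>
  has zero derivative, hence is a constant \<open>c\<close> on the connected manifold; the affine
  map is \<open>S\<close> followed by the translation by \<open>c\<close>.\<close>

lemma intertwines_affine:
  assumes "connected (UNIV :: 'n set)" "intertwines f S"
  obtains T where "affine_map T" "linear_part T = S" "\<Phi> \<circ> f = T \<circ> \<Phi>"
proof -
  have L: "bounded_linear S" using intertwines_linear[OF assms(2)] by (simp add: linear_conv_bounded_linear)
  note s = smooth_model_compose[OF open_UNIV intertwines_smooth[OF assms(2)]]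
    smooth_compose_linear[OF open_UNIV smooth_model L]
  have "fd (\<lambda>q. \<Phi> (f q) - S (\<Phi> q)) p a = 0" for p a
    using fd_diff[OF open_UNIV s UNIV_I] intertwines_fd[OF assms(2)]
      fd_linear[OF open_UNIV smooth_model UNIV_I L] by (simp add: fd_model)
  from fd_zero_constant[OF assms(1) smooth_diff[OF open_UNIV s] this]
  obtain c where c: "\<And>p. \<Phi> (f p) - S (\<Phi> p) = c" by metis
  have 0: "S 0 = 0" using intertwines_linear[OF assms(2)] by (rule linear_0)
  have lp: "linear_part (\<lambda>x. S x + c) = S" by (rule ext) (simp add: linear_part_def 0)
  show ?thesis
  proof (rule that[of "\<lambda>x. S x + c"])
    show "affine_map (\<lambda>x. S x + c)" unfolding affine_map_def lp by (rule intertwines_linear[OF assms(2)])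
    show "\<Phi> \<circ> f = (\<lambda>x. S x + c) \<circ> \<Phi>" using c by (auto simp: fun_eq_iff algebra_simps)
  qed (rule lp)
qed

text \<open>The matrix \<open>S\<close> may depend on the neighbourhood, and no inverse of
  \<open>f\<close> is asked for, so these germs compose freely. This is the form in which flows for
  small times are glued to flows for all times.\<close>

definition affine_near :: "('n \<Rightarrow> 'n) \<Rightarrow> 'n \<Rightarrow> bool" where
  "affine_near f p \<longleftrightarrow> (\<exists>U S. open U \<and> p \<in> U \<and> smooth_map_on B B U f \<and>
     (\<forall>q\<in>U. \<forall>v. frame (f q) (tangent_map B B f q v) = S (frame q v)))"

lemma affine_near_comp:
  assumes "affine_near f p" "affine_near g (f p)"
  shows "affine_near (\<lambda>x. g (f x)) p"
proof -
  obtain U S where U: "open U" "p \<in> U" "smooth_map_on B B U f"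
     "\<And>q v. q \<in> U \<Longrightarrow> frame (f q) (tangent_map B B f q v) = S (frame q v)"
    using assms(1) unfolding affine_near_def by blast
  obtain V R where V: "open V" "f p \<in> V" "smooth_map_on B B V g"
     "\<And>q v. q \<in> V \<Longrightarrow> frame (g q) (tangent_map B B g q v) = R (frame q v)"
    using assms(2) unfolding affine_near_def by blast
  let ?U = "U \<inter> f -` V"
  have o: "open ?U" by (rule open_smooth_preimage[OF U(3,1) V(1)])
  have f: "smooth_map_on B B ?U f" by (rule smooth_map_on_subset[OF U(3)]) auto
  have "smooth_map_on B B ?U (\<lambda>x. g (f x))"
    by (rule smooth_map_on_compose[OF manifold manifold manifold o V(1) f V(3)]) auto
  moreover have "frame (g (f q)) (tangent_map B B (\<lambda>x. g (f x)) q v) = R (S (frame q v))" if "q \<in> ?U" for q v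
    using tangent_map_compose[OF manifold manifold manifold o V(1) f V(3) that] that U(4) V(4) by simp
  ultimately show ?thesis
    unfolding affine_near_def using o U(2) V(2)
    by (intro exI[of _ ?U] exI[of _ "\<lambda>x. R (S x)"]) auto
qed

lemma affine_near_cong:
  assumes "affine_near f p" "open W" "p \<in> W" "\<And>x. x \<in> W \<Longrightarrow> f x = g x"
  shows "affine_near g p"
proof -
  obtain U S where U: "open U" "p \<in> U" "smooth_map_on B B U f"
     "\<And>q v. q \<in> U \<Longrightarrow> frame (f q) (tangent_map B B f q v) = S (frame q v)"
    using assms(1) unfolding affine_near_def by blast
  have o: "open (U \<inter> W)" using U assms by blast
  have f: "smooth_map_on B B (U \<inter> W) f" by (rule smooth_map_on_subset[OF U(3)]) auto
  have "smooth_map_on B B (U \<inter> W) g"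
    by (rule smooth_map_on_cong[OF manifold manifold o f]) (use assms(4) in auto)
  moreover have "frame (g q) (tangent_map B B g q v) = S (frame q v)" if "q \<in> U \<inter> W" for q v
    using tangent_map_cong[OF manifold manifold o f that, of g] U(4)[of q v] assms(4) that by auto
  ultimately show ?thesis
    unfolding affine_near_def using o U(2) assms(3) by (intro exI[of _ "U \<inter> W"] exI[of _ S]) auto
qed

text \<open>The derivative of \<Phi> after \<open>f\<close>, as a function of the point with values
  in linear maps, is locally constant and so constant on the connected manifold. Its value is the
  global matrix.\<close>

lemma affine_near_global:
  assumes "connected (UNIV :: 'n set)" "\<And>p. affine_near f p"
  obtains S where "intertwines f S"
proof -
  have s: "smooth_map_on B B UNIV f"
    by (rule smooth_map_on_local[OF _ manifold manifold]) (use assms(2) in \<open>auto simp: affine_near_def; blast\<close>)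
  have "fd (\<lambda>q. \<Phi> (f q)) p = fd (\<lambda>q. \<Phi> (f q)) p'" for p p'
  proof (rule connected_local_const[OF assms(1)])
    show "\<forall>a\<in>UNIV. eventually (\<lambda>b. fd (\<lambda>q. \<Phi> (f q)) a = fd (\<lambda>q. \<Phi> (f q)) b) (at a within UNIV)"
    proof
      fix p
      obtain U S where U: "open U" "p \<in> U"
        "\<And>q v. q \<in> U \<Longrightarrow> frame (f q) (tangent_map B B f q v) = S (frame q v)"
        using assms(2)[of p] unfolding affine_near_def by blast
      have e: "fd (\<lambda>q. \<Phi> (f q)) q = S" if "q \<in> U" for q
      proof
        fix a
        show "fd (\<lambda>q. \<Phi> (f q)) q a = S a"
          using frame_tangent[OF open_UNIV s UNIV_I, of q "coframe q a"] U(3)[OF that] by simp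
      qed
      then show "eventually (\<lambda>b. fd (\<lambda>q. \<Phi> (f q)) p = fd (\<lambda>q. \<Phi> (f q)) b) (at p within UNIV)"
        unfolding eventually_at_topological using U(1,2) by (intro exI[of _ U]) simp
    qed
  qed auto
  then obtain S where "\<And>p. fd (\<lambda>q. \<Phi> (f q)) p = S" by metis
  then have "intertwines f S"
    unfolding intertwines_def using s frame_tangent[OF open_UNIV s UNIV_I] by simp
  then show ?thesis by (rule that)
qed

end

section \<open>The flat connection in the frames of the development\<close>

locale flat_model = local_model A dev
  for A :: "('m::{t2_space,second_countable_topology}, 'e::euclidean_space) chart set"
    and dev :: "'m \<Rightarrow> 'e" +
  fixes nabla :: "('m, 'e) conn"
  assumes dev_affine: "\<And>p. \<exists>U. p \<in> U \<and> affine_diffeo_on A nabla std_atlas std_connection U dev"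
begin

text \<open>The image of \<open>Y\<close> under the locally affine map \<open>dev\<close> is the
  function \<open>frame q (Y q)\<close> read through \<open>sec p\<close>, and the standard
  connection differentiates it.\<close>

lemma frame_nabla:
  assumes W: "open W" "smooth_field_on A W Y" "p \<in> W"
  shows "frame p (nabla Y p v) = fd (\<lambda>q. frame q (Y q)) p (frame p v)"
proof -
  obtain U where U: "p \<in> U" "affine_diffeo_on A nabla std_atlas std_connection U dev"
    using dev_affine by blast
  have oU: "open U" using U(2) unfolding affine_diffeo_on_def diffeo_on_def by blast
  let ?Y = "(\<lambda>q. frame q (Y q)) \<circ> sec p"
  have Ys: "smooth_map_on A std_atlas W (\<lambda>q. frame q (Y q))"
    using W smooth_field_on_iff_frame by blast
  obtain V where V: "open V" "dev p \<in> V" "V \<subseteq> dev ` nb p" "sec p ` V \<subseteq> W" "smooth_on V ?Y"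
    by (rule smooth_map_rep[OF W(1) Ys W(3)])
  let ?V = "U \<inter> W \<inter> (nb p \<inter> dev -` V)"
  have o: "open ?V" using open_smooth_preimage[OF smooth_model open_nb V(1)] oU W(1) by blast
  have im: "dev ` ?V \<subseteq> V" by blast
  have "smooth_field_on A ?V Y"
    by (rule smooth_field_on_subset[OF W(2)]) auto
  moreover have "smooth_field_on std_atlas (dev ` ?V) ?Y"
    using smooth_on_subset[OF V(5) im]
    by (simp add: smooth_field_on_def std_atlas_def local_rep_def[abs_def] tangent_map_std[unfolded std_atlas_def])
  moreover have "tangent_map A std_atlas dev q (Y q) = ?Y (dev q)" if "q \<in> ?V" for q
    using sec_model that by (simp add: frame_def)
  moreover have "p \<in> ?V" using U W V nb_diffeo(1) by blast
  ultimately have "tangent_map A std_atlas dev p (nabla Y p v) =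
      std_connection ?Y (dev p) (tangent_map A std_atlas dev p v)"
    by (intro affine_diffeo_on_nabla[OF U(2) o]) auto
  then show ?thesis by (simp add: frame_def std_connection_def fd_def)
qed

text \<open>A constant frame field is parallel, and so is its image under an affine diffeomorphism.
  The frame components of the image are the matrix of the differential applied to the constant
  vector, so that matrix is locally constant.\<close>

lemma affine_near_affine_diffeo:
  assumes f: "affine_diffeo_on A nabla A nabla W f" and p: "p \<in> W"
  shows "affine_near f p"
proof -
  have d: "open W" "open (f ` W)" "inj_on f W" "smooth_map_on A A W f"
    "smooth_map_on A A (f ` W) (inv_into W f)"
    using f unfolding affine_diffeo_on_def diffeo_on_def by blast+
  let ?g = "inv_into W f"
  let ?k = "\<lambda>a q. fd (\<lambda>q. dev (f q)) q a"
  note sm = smooth_model_compose[OF d(1,4)]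
  have g: "?g (f q) = q" if "q \<in> W" for q using that d(3) by simp
  have z: "fd (?k a) q c = 0" if q: "q \<in> W" for a q c
  proof -
    \<comment> \<open>\<open>?Y'\<close> is the push-forward by \<open>f\<close> of the constant
      frame field \<open>?Y\<close>.\<close>
    let ?Y = "\<lambda>q. coframe q a" and ?Y' = "\<lambda>y. tangent_map A A f (?g y) (coframe (?g y) a)"
    have fr: "frame y (?Y' y) = ?k a (?g y)" if "y \<in> f ` W" for y
    proof -
      from that obtain q where "q \<in> W" "y = f q" by blast
      then show ?thesis using frame_tangent[OF d(1,4), of q "coframe q a"] g by simp
    qed
    have "smooth_map_on A std_atlas (f ` W) (\<lambda>y. ?k a (?g y))"
      by (rule smooth_map_on_compose[OF manifold manifold smooth_manifold_std d(2,1,5) smooth_fd[OF d(1) sm]])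
        (use g in auto)
    then have Y's: "smooth_map_on A std_atlas (f ` W) (\<lambda>y. frame y (?Y' y))"
      by (rule smooth_map_on_cong[OF manifold smooth_manifold_std d(2)]) (simp add: fr)
    then have Y': "smooth_field_on A (f ` W) ?Y'" by (simp add: smooth_field_on_iff_frame d(2))
    have Y: "smooth_field_on A W ?Y" by (rule smooth_const_field[OF d(1)])
    have "frame q (nabla ?Y q v) = 0" for v using frame_nabla[OF d(1) Y q] by (simp add: fd_const)
    then have n0: "nabla ?Y q v = 0" for v by (metis frame_inject linear_0 linear_frame)
    have "tangent_map A A f q (nabla ?Y q v) = nabla ?Y' (f q) (tangent_map A A f q v)" for v
      by (rule affine_diffeo_on_nabla[OF f d(1) order_refl Y Y' _ q]) (simp add: g)
    then have n1: "nabla ?Y' (f q) (tangent_map A A f q v) = 0" for v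
      using n0 linear_0[OF tangent_map_linear[OF manifold manifold d(1,4) q]] by simp
    have "fd (\<lambda>y. frame y (?Y' y)) (f q) (frame (f q) (tangent_map A A f q v)) = 0" for v
      unfolding frame_nabla[OF d(2) Y' imageI[OF q], symmetric] n1 by (rule linear_0[OF linear_frame])
    from fd_chain[OF d(1,4) q d(2) Y's, of "coframe q c"] this q
    have "fd (\<lambda>q. frame (f q) (?Y' (f q))) q c = 0" by simp
    moreover have "fd (?k a) q c = fd (\<lambda>q. frame (f q) (?Y' (f q))) q c"
      by (rule fd_cong[OF d(1) smooth_fd[OF d(1) sm] q]) (simp add: frame_tangent[OF d(1,4)] g)
    ultimately show ?thesis by simp
  qed
  have "\<exists>V. open V \<and> p \<in> V \<and> V \<subseteq> W \<and> (\<forall>q\<in>V. ?k b q = ?k b p)" for b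
    by (rule fd_zero_locally_constant[OF d(1) smooth_fd[OF d(1) sm] z p]) blast+
  then obtain V where V: "\<And>b. open (V b)" "\<And>b. p \<in> V b" "\<And>b. V b \<subseteq> W" "\<And>b q. q \<in> V b \<Longrightarrow> ?k b q = ?k b p"
    by metis
  \<comment> \<open>Each basis vector brings its own neighbourhood; the basis is finite, so the
    intersection is still open and the whole matrix is constant on it.\<close>
  let ?V = "\<Inter>b\<in>Basis. V b"
  have VW: "?V \<subseteq> W" using V(3) nonempty_Basis by blast
  have o: "open ?V" using V(1) by (intro open_INT) auto
  have "frame (f q) (tangent_map A A f q v) = fd (\<lambda>q. dev (f q)) p (frame q v)" if q: "q \<in> ?V" for q v
  proof -
    have qW: "q \<in> W" using VW q by blast
    have "fd (\<lambda>q. dev (f q)) q = fd (\<lambda>q. dev (f q)) p"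
      by (rule linear_eq_stdbasis[OF linear_fd[OF d(1) sm qW] linear_fd[OF d(1) sm p]]) (use V(4) q in auto)
    then show ?thesis using frame_tangent[OF d(1,4) qW] by simp
  qed
  then show ?thesis
    unfolding affine_near_def using o V(2) smooth_map_on_subset[OF d(4) VW]
    by (intro exI[of _ ?V] exI[of _ "fd (\<lambda>q. dev (f q)) p"]) auto
qed

text \<open>For related fields \<open>frame (f q) (Y' (f q)) = S (frame q (Y q))\<close>, and the
  constant matrix \<open>S\<close> commutes with differentiation.\<close>

lemma affine_diffeo_onI:
  assumes f: "bij f" "smooth_map_on A A UNIV (inv_into UNIV f)" "intertwines f S"
  shows "affine_diffeo_on A nabla A nabla UNIV f"
  unfolding affine_diffeo_on_def
proof (intro conjI allI impI ballI; (elim conjE)?)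
  note fs = intertwines_smooth[OF f(3)]
  have sj: "range f = UNIV" using f(1) by (simp add: bij_is_surj)
  show "diffeo_on A A UNIV f"
    unfolding diffeo_on_def using fs f sj by (simp add: bij_is_inj)
  fix V Y Y' p v
  assume V: "open V" and Y: "smooth_field_on A V Y" and Y': "smooth_field_on A (f ` V) Y'"
    and rel: "\<forall>p\<in>V. tangent_map A A f p (Y p) = Y' (f p)" and p: "p \<in> V"
  have "f ` V = inv_into UNIV f -` V" using f(1) bij_image_Collect_eq[OF f(1), of "\<lambda>x. x \<in> V"] by (simp add: vimage_def)
  then have oV: "open (f ` V)" using open_smooth_preimage[OF f(2) open_UNIV V] by simp
  note ys = iffD1[OF smooth_field_on_iff_frame[OF V] Y] and ys' = iffD1[OF smooth_field_on_iff_frame[OF oV] Y']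
  have L: "bounded_linear S" using intertwines_linear[OF f(3)] by (simp add: linear_conv_bounded_linear)
  have "frame (f p) (nabla Y' (f p) (tangent_map A A f p v)) =
      fd (\<lambda>q. frame q (Y' q)) (f p) (frame (f p) (tangent_map A A f p v))"
    by (rule frame_nabla[OF oV Y']) (use p in blast)
  also have "\<dots> = fd (\<lambda>q. frame (f q) (Y' (f q))) p (frame p v)"
    by (rule fd_chain[OF V fs p oV ys', symmetric]) (use p in blast)
  also have "\<dots> = fd (\<lambda>q. S (frame q (Y q))) p (frame p v)"
    by (rule fd_cong[OF V smooth_compose_linear[OF V ys L] p, symmetric])
      (use rel intertwines_frame[OF f(3)] in metis)
  also have "\<dots> = S (fd (\<lambda>q. frame q (Y q)) p (frame p v))" by (rule fd_linear[OF V ys p L])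
  also have "\<dots> = frame (f p) (tangent_map A A f p (nabla Y p v))"
    by (simp add: intertwines_frame[OF f(3)] frame_nabla[OF V Y p])
  finally show "tangent_map A A f p (nabla Y p v) = nabla Y' (f p) (tangent_map A A f p v)"
    by (simp add: frame_inject)
qed

lemma affine_diffeo_onD:
  assumes "connected (UNIV :: 'm set)" "affine_diffeo_on A nabla A nabla UNIV f" "surj f"
  obtains S where "bij f" "smooth_map_on A A UNIV (inv_into UNIV f)" "intertwines f S"
proof -
  obtain S where S: "intertwines f S"
    by (rule affine_near_global[OF assms(1)]) (use affine_near_affine_diffeo[OF assms(2)] in auto)
  have "bij f" "smooth_map_on A A UNIV (inv_into UNIV f)"
    using assms(2,3) unfolding affine_diffeo_on_def diffeo_on_def bij_def by auto
  then show ?thesis using that S by blast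
qed

text \<open>Coordinate fields of a flat chart and constant frame fields are both parallel, so near
  \<open>p\<close> they correspond by a constant matrix. The coefficients of \<open>g\<close> are
  second derivatives of the potential in constant directions, and their derivatives are third
  derivatives, which are symmetric.\<close>

lemma hessian_derivative_symmetric:
  assumes h: "hessian_manifold A nabla g"
  shows "fd (\<lambda>q. g q (coframe q a) (coframe q b)) p c = fd (\<lambda>q. g q (coframe q c) (coframe q b)) p a"
proof -
  obtain C \<phi> where C: "p \<in> fst C" "flat_chart A nabla C" "smooth_on (snd C ` fst C) \<phi>"
    and hess: "\<And>q u v. q \<in> fst C \<Longrightarrow> g q (coord_field A C u q) (coord_field A C v q) =
           frechet_derivative (\<lambda>x. frechet_derivative \<phi> (at x) v) (at (snd C q)) u"
    using h unfolding hessian_manifold_def by metis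
  have d: "open (fst C)" "open (snd C ` fst C)" "inj_on (snd C) (fst C)" "smooth_map_on A std_atlas (fst C) (snd C)"
    "smooth_map_on std_atlas A (snd C ` fst C) (chart_inv C)"
    and flat: "\<And>u q v. q \<in> fst C \<Longrightarrow> nabla (coord_field A C u) q v = 0"
    using C(2) unfolding flat_chart_def diffeo_on_def chart_inv_def by blast+
  have ci: "chart_inv C (snd C q) = q" if "q \<in> fst C" for q using that d(3) by (simp add: chart_inv_def)
  have ct: "tangent_map A std_atlas (snd C) q (coord_field A C u q) = u" if q: "q \<in> fst C" for q u
  proof -
    have "tangent_map A std_atlas (snd C) (chart_inv C (snd C q))
        (tangent_map std_atlas A (chart_inv C) (snd C q) u) = u"
      by (rule tangent_map_left_inverse[OF smooth_manifold_std manifold d(2,1,5,4)]) (use q ci in auto)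
    then show ?thesis using q ci by (simp add: coord_field_def)
  qed
  have tc: "coord_field A C (tangent_map A std_atlas (snd C) q v) q = v" if q: "q \<in> fst C" for q v
    unfolding coord_field_def
    by (rule tangent_map_left_inverse[OF manifold smooth_manifold_std d(1,2,4,5)]) (use q ci in auto)
  define h where "h = (\<lambda>x. dev (chart_inv C x))"
  have h: "smooth_map_on std_atlas std_atlas (snd C ` fst C) h"
    unfolding h_def
    by (rule smooth_map_on_compose[OF smooth_manifold_std manifold smooth_manifold_std d(2) open_UNIV d(5) smooth_model]) auto
  have K: "frame q (coord_field A C u q) = frechet_derivative h (at (snd C q)) u" if q: "q \<in> fst C" for q u
    using tangent_map_compose[OF smooth_manifold_std manifold smooth_manifold_std d(2) open_UNIV d(5) smooth_model, of "snd C q" u] q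
    by (simp add: coord_field_def frame_def ci h_def tangent_map_std)
  have Ks: "smooth_map_on A std_atlas (fst C) (\<lambda>q. frame q (coord_field A C u q))" for u
  proof -
    have "smooth_map_on std_atlas std_atlas (snd C ` fst C) (\<lambda>x. frechet_derivative h (at x) u)"
      using smooth_on_frechet h by (simp add: smooth_map_std_std_iff)
    from smooth_map_on_compose[OF manifold smooth_manifold_std smooth_manifold_std d(1,2,4) this]
    have "smooth_map_on A std_atlas (fst C) (\<lambda>q. frechet_derivative h (at (snd C q)) u)" by simp
    then show ?thesis by (rule smooth_map_on_cong[OF manifold smooth_manifold_std d(1)]) (simp add: K)
  qed
  \<comment> \<open>The coordinate direction is chosen so that the two fields match at
    \<open>p\<close>; being parallel, they agree on a neighbourhood.\<close>
  have const: "\<exists>V. open V \<and> p \<in> V \<and> V \<subseteq> fst C \<and> (\<forall>q\<in>V. coframe q e = coord_field A C (tangent_map A std_atlas (snd C) p (coframe p e)) q)" for e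
  proof -
    let ?u = "tangent_map A std_atlas (snd C) p (coframe p e)"
    have cf: "smooth_field_on A (fst C) (coord_field A C ?u)" by (simp add: smooth_field_on_iff_frame d(1) Ks)
    have z: "fd (\<lambda>q. frame q (coord_field A C ?u q)) q c = 0" if "q \<in> fst C" for q c
      using frame_nabla[OF d(1) cf that, of "coframe q c"] flat[OF that] linear_0[OF linear_frame] by simp
    obtain V where V: "open V" "p \<in> V" "V \<subseteq> fst C"
      "\<And>q. q \<in> V \<Longrightarrow> frame q (coord_field A C ?u q) = frame p (coord_field A C ?u p)"
      by (rule fd_zero_locally_constant[OF d(1) Ks z C(1)]) blast+
    have "coframe q e = coord_field A C ?u q" if "q \<in> V" for q
      using V(4)[OF that] tc[OF C(1)] by (metis coframe_frame frame_coframe)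
    then show ?thesis using V(1-3) by blast
  qed
  let ?u = "\<lambda>e. tangent_map A std_atlas (snd C) p (coframe p e)"
  \<comment> \<open>With one derivative in the direction of \<open>b\<close> already taken, the
    exchange of \<open>a\<close> and \<open>c\<close> is the symmetry of the second derivative of
    \<psi>.\<close>
  define \<psi> where "\<psi> = (\<lambda>x. frechet_derivative \<phi> (at x) (?u b))"
  have \<psi>: "smooth_on (snd C ` fst C) \<psi>" unfolding \<psi>_def by (rule smooth_on_frechet[OF C(3)])
  have main: "fd (\<lambda>q. g q (coframe q a) (coframe q b)) p c =
      frechet_derivative (\<lambda>x. frechet_derivative \<psi> (at x) (?u a)) (at (snd C p)) (?u c)" for a c
  proof -
    obtain V1 V2 where V: "open V1" "p \<in> V1" "V1 \<subseteq> fst C" "\<And>q. q \<in> V1 \<Longrightarrow> coframe q a = coord_field A C (?u a) q"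
       "open V2" "p \<in> V2" "V2 \<subseteq> fst C" "\<And>q. q \<in> V2 \<Longrightarrow> coframe q b = coord_field A C (?u b) q"
      using const[of a] const[of b] by metis
    let ?V = "V1 \<inter> V2" and ?k = "\<lambda>x. frechet_derivative \<psi> (at x) (?u a)"
    have o: "open ?V" "p \<in> ?V" using V by auto
    have ks: "smooth_map_on std_atlas std_atlas (snd C ` fst C) ?k"
      using smooth_on_frechet[OF \<psi>] by (simp add: smooth_map_std_std_iff)
    have cs: "smooth_map_on A std_atlas ?V (snd C)" by (rule smooth_map_on_subset[OF d(4)]) (use V in auto)
    have sub: "snd C ` ?V \<subseteq> snd C ` fst C" using V by auto
    have s: "smooth_map_on A std_atlas ?V (\<lambda>q. ?k (snd C q))"
      by (rule smooth_map_on_compose[OF manifold smooth_manifold_std smooth_manifold_std o(1) d(2) cs ks sub])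
    have "fd (\<lambda>q. ?k (snd C q)) p c = fd (\<lambda>q. g q (coframe q a) (coframe q b)) p c"
      proof (rule fd_cong[OF o(1) s o(2)])
      fix q assume q: "q \<in> ?V"
      then have "q \<in> fst C" using V(3) by blast
      from hess[OF this, of "?u a" "?u b"] V(4)[of q] V(8)[of q] q
      show "?k (snd C q) = g q (coframe q a) (coframe q b)" by (simp add: \<psi>_def)
    qed
    moreover have "fd (\<lambda>q. ?k (snd C q)) p c = frechet_derivative ?k (at (snd C p)) (?u c)"
      using tangent_map_eq_fd[OF o(1) s o(2), of "coframe p c"]
        tangent_map_compose[OF manifold smooth_manifold_std smooth_manifold_std o(1) d(2) cs ks o(2)] C(1)
      by (simp add: tangent_map_std)
    ultimately show ?thesis by simp
  qed
  show ?thesis unfolding main by (rule mixed_derivatives_commute[OF d(2) \<psi>]) (use C(1) in blast)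
qed

end


section \<open>Flows of affine vector fields\<close>

text \<open>Gronwall for the squared distance of two solutions.\<close>

lemma lipschitz_ode_unique:
  fixes u w :: "real \<Rightarrow> 'a::real_inner"
  assumes u: "\<And>t. l < t \<Longrightarrow> t < r \<Longrightarrow> (u has_vector_derivative e (u t)) (at t)"
    and w: "\<And>t. l < t \<Longrightarrow> t < r \<Longrightarrow> (w has_vector_derivative e (w t)) (at t)"
    and lip: "\<And>t. l < t \<Longrightarrow> t < r \<Longrightarrow> norm (e (u t) - e (w t)) \<le> K * norm (u t - w t)"
    and x: "l < x" "x < r" "u x = w x" and y: "l < y" "y < r"
  shows "u y = w y"
proof -
  let ?d = "\<lambda>t. u t - w t"
  let ?h = "\<lambda>t. ?d t \<bullet> ?d t" and ?h' = "\<lambda>t. 2 * (?d t \<bullet> (e (u t) - e (w t)))"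
  have d: "(?h has_real_derivative ?h' t) (at t)" if "l < t" "t < r" for t
  proof -
    have "(?d has_vector_derivative e (u t) - e (w t)) (at t)"
      using u[OF that] w[OF that] by (rule has_vector_derivative_diff)
    then have "(?d has_derivative (\<lambda>s. s *\<^sub>R (e (u t) - e (w t)))) (at t)"
      by (simp add: has_vector_derivative_def)
    from has_derivative_inner[OF this this]
    show ?thesis
      unfolding has_field_derivative_def
      by (rule has_derivative_eq_rhs) (auto simp: fun_eq_iff inner_commute)
  qed
  have bound: "\<bar>?h' t\<bar> \<le> 2 * K * ?h t" if "l < t" "t < r" for t
  proof -
    have "\<bar>?d t \<bullet> (e (u t) - e (w t))\<bar> \<le> norm (?d t) * norm (e (u t) - e (w t))"
      by (rule Cauchy_Schwarz_ineq2)
    also have "\<dots> \<le> norm (?d t) * (K * norm (?d t))" using lip[OF that] by (rule mult_left_mono) simp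
    also have "\<dots> = K * ?h t" by (simp add: dot_square_norm power2_eq_square)
    finally show ?thesis by (simp add: abs_mult)
  qed
  \<comment> \<open>Integrating factor: the weighted squared distance does not grow forward from
    \<open>x\<close> for \<open>c = - 2 * K\<close>, nor backward from \<open>x\<close> for
    \<open>c = 2 * K\<close>, and it vanishes at \<open>x\<close>.\<close>
  let ?k = "\<lambda>c t. ?h t * exp (c * t)"
  have kd: "(?k c has_real_derivative (?h' t + c * ?h t) * exp (c * t)) (at t)" if "l < t" "t < r" for t c
    by (rule derivative_eq_intros d[OF that] refl)+ (simp add: algebra_simps)
  have "?h y \<le> 0"
  proof (cases "x \<le> y")
    case True
    have "?k (- 2 * K) y \<le> ?k (- 2 * K) x"
    proof (rule DERIV_nonpos_imp_nonincreasing[OF True])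
      fix t assume t: "x \<le> t" "t \<le> y"
      then have lt: "l < t" "t < r" using x y by auto
      then show "\<exists>z. (?k (- 2 * K) has_real_derivative z) (at t) \<and> z \<le> 0"
        using kd[OF lt, of "- 2 * K"] bound[OF lt] by (intro exI conjI) (auto intro!: mult_nonpos_nonneg)
    qed
    then show ?thesis using x(3) by (simp add: mult_le_0_iff)
  next
    case False
    then have le: "y \<le> x" by simp
    have "?k (2 * K) y \<le> ?k (2 * K) x"
    proof (rule DERIV_nonneg_imp_nondecreasing[OF le])
      fix t assume t: "y \<le> t" "t \<le> x"
      then have lt: "l < t" "t < r" using x y by auto
      then show "\<exists>z. (?k (2 * K) has_real_derivative z) (at t) \<and> 0 \<le> z"
        using kd[OF lt, of "2 * K"] bound[OF lt] by (intro exI conjI) (auto intro!: mult_nonneg_nonneg)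
    qed
    then show ?thesis using x(3) by (simp add: mult_le_0_iff)
  qed
  then show ?thesis by (metis inner_eq_zero_iff inner_ge_zero antisym eq_iff_diff_eq_0)
qed

lemma integral_curve_subset: "integral_curve A X T c \<Longrightarrow> T' \<subseteq> T \<Longrightarrow> integral_curve A X T' c"
  unfolding integral_curve_def using smooth_map_on_subset by blast

context local_model
begin

lemma integral_curve_deriv:
  assumes c: "integral_curve B X T c" "open T" "t \<in> T" and f: "smooth_map_on B std_atlas UNIV f"
  shows "((\<lambda>t. f (c t)) has_vector_derivative fd f (c t) (frame (c t) (X (c t)))) (at t)"
proof -
  have cs: "smooth_map_on std_atlas B T c" and ct: "tangent_map std_atlas B c t 1 = X (c t)"
    using c unfolding integral_curve_def by auto
  have s: "smooth_map_on std_atlas std_atlas T (\<lambda>t. f (c t))"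
    by (rule smooth_map_on_compose[OF smooth_manifold_std manifold smooth_manifold_std c(2) open_UNIV cs f]) auto
  then have d: "((\<lambda>t. f (c t)) has_derivative frechet_derivative (\<lambda>t. f (c t)) (at t)) (at t)"
    using smooth_on_has_derivative c(3) by (auto simp: smooth_map_std_std_iff)
  have e: "frechet_derivative (\<lambda>t. f (c t)) (at t) 1 = fd f (c t) (frame (c t) (X (c t)))"
    using tangent_map_compose[OF smooth_manifold_std manifold smooth_manifold_std c(2) open_UNIV cs f c(3), of 1]
      tangent_map_eq_fd[OF open_UNIV f UNIV_I] by (simp add: tangent_map_std ct)
  interpret linear "frechet_derivative (\<lambda>t. f (c t)) (at t)" using d by (rule has_derivative_linear)
  have "frechet_derivative (\<lambda>t. f (c t)) (at t) s = s *\<^sub>R fd f (c t) (frame (c t) (X (c t)))" for s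
    using scaleR[of s 1] e by simp
  then have "frechet_derivative (\<lambda>t. f (c t)) (at t) = (\<lambda>s. s *\<^sub>R fd f (c t) (frame (c t) (X (c t))))" by blast
  then show ?thesis using d by (simp add: has_vector_derivative_def)
qed

lemma integral_curve_model:
  assumes "integral_curve B X T c" "open T" "t \<in> T"
  shows "((\<lambda>t. \<Phi> (c t)) has_vector_derivative frame (c t) (X (c t))) (at t)"
  using integral_curve_deriv[OF assms smooth_model] by (simp add: fd_model)

lemma integral_curve_image:
  assumes c: "integral_curve B X T c" "open T" and f: "smooth_map_on B B UNIV f"
    "\<And>p. tangent_map B B f p (X p) = X (f p)"
  shows "integral_curve B X T (\<lambda>t. f (c t))"
proof -
  have cs: "smooth_map_on std_atlas B T c" and ct: "\<And>t. t \<in> T \<Longrightarrow> tangent_map std_atlas B c t 1 = X (c t)"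
    using c unfolding integral_curve_def by auto
  have "smooth_map_on std_atlas B T (\<lambda>t. f (c t))"
    by (rule smooth_map_on_compose[OF smooth_manifold_std manifold manifold c(2) open_UNIV cs f(1)]) auto
  then show ?thesis
    unfolding integral_curve_def
    using tangent_map_compose[OF smooth_manifold_std manifold manifold c(2) open_UNIV cs f(1)] ct f(2) by simp
qed

lemma integral_curve_shift:
  assumes "integral_curve B X UNIV c"
  shows "integral_curve B X UNIV (\<lambda>t. c (t + s))"
proof -
  have cs: "smooth_map_on std_atlas B UNIV c" and ct: "\<And>t. tangent_map std_atlas B c t 1 = X (c t)"
    using assms unfolding integral_curve_def by auto
  have d: "((\<lambda>t. t + s) has_derivative (\<lambda>h. h)) (at t)" for t :: real by (auto intro!: derivative_eq_intros)
  have a: "smooth_map_on std_atlas std_atlas UNIV (\<lambda>t::real. t + s)"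
    by (simp add: smooth_map_std_std_iff smooth_on_add smooth_on_ident smooth_on_const)
  have ta: "tangent_map std_atlas std_atlas (\<lambda>t. t + s) t 1 = 1" for t :: real
    using frechet_derivative_at[OF d, of t] by (simp add: tangent_map_std) metis
  have "smooth_map_on std_atlas B UNIV (\<lambda>t. c (t + s))"
    by (rule smooth_map_on_compose[OF smooth_manifold_std smooth_manifold_std manifold open_UNIV open_UNIV a cs]) auto
  moreover have "tangent_map std_atlas B (\<lambda>t. c (t + s)) t 1 = X (c (t + s))" for t
    using tangent_map_compose[OF smooth_manifold_std smooth_manifold_std manifold open_UNIV open_UNIV a cs, of t 1]
      ta ct by simp
  ultimately show ?thesis unfolding integral_curve_def by simp
qed

text \<open>By connectedness of \<open>T\<close> it is enough that near each time agreement at one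
  time implies agreement at the others. Where the curves differ, separation makes this vacuous;
  where they meet, both stay in a neighbourhood on which the field is Lipschitz in the
  model.\<close>

lemma integral_curve_unique:
  assumes X: "smooth_field_on B UNIV X" and T: "open T" "connected T"
    and c: "integral_curve B X T c" and c': "integral_curve B X T c'"
    and s: "s \<in> T" "c s = c' s" and t: "t \<in> T"
  shows "c t = c' t"
proof (rule connected_induction_simple[OF T(2) s(1) t, of "\<lambda>t. c t = c' t", OF s(2)])
  fix a assume a: "a \<in> T"
  have cont: "continuous_on T c" "continuous_on T c'"
    using c c' smooth_map_on_continuous unfolding integral_curve_def by blast+
  have pre: "open (T \<inter> c -` U)" "open (T \<inter> c' -` U)" if "open U" for U
    using cont T(1) that by (metis continuous_on_open_vimage Int_commute)+
  show "\<exists>J. openin (top_of_set T) J \<and> a \<in> J \<and> (\<forall>x\<in>J. \<forall>y\<in>J. c x = c' x \<longrightarrow> c y = c' y)"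
  proof (cases "c a = c' a")
    case False
    then obtain U V where UV: "open U" "open V" "c a \<in> U" "c' a \<in> V" "U \<inter> V = {}"
      using hausdorff[OF False] by blast
    let ?J = "(T \<inter> c -` U) \<inter> (T \<inter> c' -` V)"
    have "open ?J" using pre UV by blast
    then have "openin (top_of_set T) ?J" by (intro open_subset) auto
    moreover have "\<forall>x\<in>?J. c x \<noteq> c' x"
    proof
      fix x assume "x \<in> ?J"
      then have "c x \<in> U" "c' x \<in> V" by auto
      then show "c x \<noteq> c' x" using UV(5) by (metis disjoint_iff)
    qed
    moreover have "a \<in> ?J" using UV a by auto
    ultimately show ?thesis by blast
  next
    case True
    define p where "p = c a"
    have Es: "smooth_map_on B std_atlas UNIV (\<lambda>q. frame q (X q))"
      using X smooth_field_on_iff_frame by blast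
    obtain V where V: "open V" "\<Phi> p \<in> V" "V \<subseteq> \<Phi> ` nb p" "smooth_on V ((\<lambda>q. frame q (X q)) \<circ> sec p)"
      by (rule smooth_map_rep[OF open_UNIV Es UNIV_I])
    obtain r K where r: "r > 0" "ball (\<Phi> p) r \<subseteq> V"
      "\<And>x y. x \<in> ball (\<Phi> p) r \<Longrightarrow> y \<in> ball (\<Phi> p) r \<Longrightarrow>
        norm (((\<lambda>q. frame q (X q)) \<circ> sec p) x - ((\<lambda>q. frame q (X q)) \<circ> sec p) y) \<le> K * norm (x - y)"
      by (rule smooth_on_lipschitz[OF V(1,4,2)]) blast
    let ?U = "nb p \<inter> \<Phi> -` ball (\<Phi> p) r"
    have U: "open ?U" "p \<in> ?U"
      using open_smooth_preimage[OF smooth_model open_nb open_ball] r(1) nb_diffeo(1) by auto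
    have "open ((T \<inter> c -` ?U) \<inter> (T \<inter> c' -` ?U))" using pre[OF U(1)] by blast
    moreover have "a \<in> (T \<inter> c -` ?U) \<inter> (T \<inter> c' -` ?U)" using a U(2) True p_def by auto
    ultimately obtain \<delta> where \<delta>: "\<delta> > 0" "ball a \<delta> \<subseteq> (T \<inter> c -` ?U) \<inter> (T \<inter> c' -` ?U)"
      using open_contains_ball by meson
    have J: "t \<in> ball a \<delta> \<longleftrightarrow> a - \<delta> < t \<and> t < a + \<delta>" for t by (auto simp: dist_real_def)
    have inU: "t \<in> T" "c t \<in> ?U" "c' t \<in> ?U" if "a - \<delta> < t" "t < a + \<delta>" for t
      using \<delta>(2) that J by blast+
    have "c y = c' y" if "x \<in> ball a \<delta>" "y \<in> ball a \<delta>" "c x = c' x" for x y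
    proof -
      let ?e = "(\<lambda>q. frame q (X q)) \<circ> sec p"
      have "\<Phi> (c y) = \<Phi> (c' y)"
      proof (rule lipschitz_ode_unique[where l = "a - \<delta>" and r = "a + \<delta>" and e = ?e and K = K
            and u = "\<lambda>t. \<Phi> (c t)" and w = "\<lambda>t. \<Phi> (c' t)" and x = x])
        fix t assume t: "a - \<delta> < t" "t < a + \<delta>"
        show "((\<lambda>t. \<Phi> (c t)) has_vector_derivative ?e (\<Phi> (c t))) (at t)"
          using integral_curve_model[OF c T(1) inU(1)[OF t]] inU(2)[OF t] by (simp add: sec_model)
        show "((\<lambda>t. \<Phi> (c' t)) has_vector_derivative ?e (\<Phi> (c' t))) (at t)"
          using integral_curve_model[OF c' T(1) inU(1)[OF t]] inU(3)[OF t] by (simp add: sec_model)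
        show "norm (?e (\<Phi> (c t)) - ?e (\<Phi> (c' t))) \<le> K * norm (\<Phi> (c t) - \<Phi> (c' t))"
          by (rule r(3)) (use inU[OF t] in auto)
      qed (use that J in auto)
      moreover have "c y \<in> nb p" "c' y \<in> nb p" using inU that(2) J by auto
      ultimately show ?thesis using sec_model by metis
    qed
    moreover have "openin (top_of_set T) (ball a \<delta>)" using \<delta>(2) by (intro open_subset) auto
    moreover have "a \<in> ball a \<delta>" using \<delta>(1) by simp
    ultimately show ?thesis by (intro exI[of _ "ball a \<delta>"] conjI ballI impI)
  qed
qed

end

section \<open>The flow of a complete affine field\<close>

locale complete_affine_field = flat_model A dev nabla
  for A :: "('m::{t2_space,second_countable_topology}, 'e::euclidean_space) chart set"
    and dev :: "'m \<Rightarrow> 'e" and nabla +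
  fixes \<xi> :: "'m \<Rightarrow> 'e"
  assumes connected: "connected (UNIV :: 'm set)"
    and affine: "affine_field A nabla \<xi>"
    and complete: "complete_field A \<xi>"
begin

abbreviation flow :: "real \<Rightarrow> 'm \<Rightarrow> 'm" where
  "flow \<equiv> exp_flow A \<xi>"

lemma smooth_\<xi>: "smooth_field_on A UNIV \<xi>"
  using affine unfolding affine_field_def by blast

text \<open>Uniqueness of integral curves makes the description in \<open>exp_flow\<close> definite,
  so any integral curve starting at \<open>p\<close> evaluates it.\<close>

lemma flow_eqI:
  assumes "c 0 = p" "integral_curve A \<xi> UNIV c"
  shows "flow t p = c t"
proof -
  have "(THE c. c 0 = p \<and> integral_curve A \<xi> UNIV c) = c"
  proof (rule the_equality)
    fix c' assume c': "c' 0 = p \<and> integral_curve A \<xi> UNIV c'"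
    show "c' = c"
    proof
      fix t
      show "c' t = c t"
        by (rule integral_curve_unique[OF smooth_\<xi> open_UNIV connected_UNIV, of c' c 0 t]) (use assms c' in auto)
    qed
  qed (use assms in simp)
  then show ?thesis by (simp add: exp_flow_def)
qed

lemma flow_curve: "integral_curve A \<xi> UNIV (\<lambda>t. flow t p)" and flow_0: "flow 0 p = p"
proof -
  obtain c where c: "c 0 = p" "integral_curve A \<xi> UNIV c" using complete unfolding complete_field_def by blast
  have "(\<lambda>t. flow t p) = c" using flow_eqI[OF c] by blast
  then show "integral_curve A \<xi> UNIV (\<lambda>t. flow t p)" "flow 0 p = p" using c flow_eqI[OF c, of 0] by simp_all
qed

lemma flow_add: "flow (s + t) p = flow s (flow t p)"
  using flow_eqI[of "\<lambda>s. flow (s + t) p" "flow t p" s] integral_curve_shift[OF flow_curve[of p], of t] by simp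

text \<open>A map preserving \<xi> sends integral curves to integral curves, and the image of the
  one through \<open>p\<close> starts at \<open>f p\<close>.\<close>

lemma flow_commute:
  assumes "smooth_map_on A A UNIV f" "\<And>p. tangent_map A A f p (\<xi> p) = \<xi> (f p)"
  shows "flow t (f p) = f (flow t p)"
  by (rule flow_eqI) (use flow_0 integral_curve_image[OF flow_curve open_UNIV assms] in auto)

text \<open>The local flow supplied by \<open>affine_field\<close> and the global flow consist of
  integral curves with the same starting points, so they coincide. One time bound serves a whole
  neighbourhood.\<close>

lemma affine_near_flow_small:
  obtains \<epsilon> W where "\<epsilon> > 0" "open W" "p \<in> W"
    "\<And>t q. \<bar>t\<bar> < \<epsilon> \<Longrightarrow> q \<in> W \<Longrightarrow> affine_near (flow t) q"
proof -
  obtain \<epsilon> W F where F: "p \<in> W" "local_flow A \<xi> \<epsilon> W F"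
    "\<And>t. t \<in> {-\<epsilon><..<\<epsilon>} \<Longrightarrow> affine_diffeo_on A nabla A nabla W (F t)"
    using affine unfolding affine_field_def by metis
  have W: "\<epsilon> > 0" "open W" "\<And>q. q \<in> W \<Longrightarrow> F 0 q = q"
    "\<And>q. q \<in> W \<Longrightarrow> integral_curve A \<xi> {-\<epsilon><..<\<epsilon>} (\<lambda>t. F t q)"
    using F(2) unfolding local_flow_def by auto
  have eq: "F t q = flow t q" if "\<bar>t\<bar> < \<epsilon>" "q \<in> W" for t q
    by (rule integral_curve_unique[where s = 0 and t = t, OF smooth_\<xi> open_greaterThanLessThan connected_Ioo W(4)[OF that(2)]
          integral_curve_subset[OF flow_curve]]) (use that W flow_0 in auto)
  show ?thesis
  proof (rule that[OF W(1,2) F(1)])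
    fix t q assume t: "\<bar>t\<bar> < \<epsilon>" and q: "q \<in> W"
    have "affine_near (F t) q" by (rule affine_near_affine_diffeo[OF F(3) q]) (use t in auto)
    then show "affine_near (flow t) q" by (rule affine_near_cong[OF _ W(2) q]) (rule eq[OF t])
  qed
qed

text \<open>The times at which the flow is affine near \<open>p\<close> form an open and closed set, since nearby times
  differ by a local flow around the point reached.\<close>

lemma affine_near_flow: "affine_near (flow t) p"
proof (rule connected_induction_simple[OF connected_UNIV, of 0 t "\<lambda>t. affine_near (flow t) p"])
  have "affine_near (\<lambda>x. x) p" unfolding affine_near_def
    using intertwines_id unfolding intertwines_def by (metis UNIV_I open_UNIV)
  then show "affine_near (flow 0) p"
    by (rule affine_near_cong[OF _ open_UNIV UNIV_I]) (simp add: flow_0)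
  fix a :: real
  obtain \<epsilon> W where W: "\<epsilon> > 0" "open W" "flow a p \<in> W"
    "\<And>t q. \<bar>t\<bar> < \<epsilon> \<Longrightarrow> q \<in> W \<Longrightarrow> affine_near (flow t) q"
    by (rule affine_near_flow_small[of "flow a p"]) blast
  have "continuous_on UNIV (\<lambda>t. flow t p)"
    using flow_curve smooth_map_on_continuous unfolding integral_curve_def by blast
  then have o: "open ((\<lambda>t. flow t p) -` W)" using W(2) open_vimage by blast
  \<comment> \<open>The radius is half of \<epsilon>, so that any two times in the ball differ by
    less than \<epsilon>.\<close>
  let ?J = "(\<lambda>t. flow t p) -` W \<inter> ball a (\<epsilon> / 2)"
  have "affine_near (flow y) p" if xy: "x \<in> ?J" "y \<in> ?J" and P: "affine_near (flow x) p" for x y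
  proof -
    have "dist a y < \<epsilon> / 2" "dist a x < \<epsilon> / 2" using xy by auto
    then have "\<bar>y - x\<bar> < \<epsilon>" using dist_triangle_half_r by (metis dist_real_def)
    then have "affine_near (flow (y - x)) (flow x p)" using W(4) xy by auto
    from affine_near_comp[OF P this] have "affine_near (\<lambda>q. flow (y - x) (flow x q)) p" .
    then show ?thesis
      by (rule affine_near_cong[OF _ open_UNIV UNIV_I]) (simp add: flow_add[symmetric])
  qed
  then show "\<exists>T. openin (top_of_set UNIV) T \<and> a \<in> T \<and>
      (\<forall>x\<in>T. \<forall>y\<in>T. affine_near (flow x) p \<longrightarrow> affine_near (flow y) p)"
    proof (intro exI[of _ ?J] conjI ballI impI)
    show "openin (top_of_set UNIV) ?J" using o by (simp add: open_Int)
    show "a \<in> ?J" using W(1,3) by simp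
  qed
qed auto

text \<open>The choice is unambiguous: the matrix is the derivative of \<open>dev\<close> after the
  flow map, at any point.\<close>

definition flow_linear :: "real \<Rightarrow> 'e \<Rightarrow> 'e" where
  "flow_linear t = (SOME S. intertwines (flow t) S)"

lemma intertwines_flow: "intertwines (flow t) (flow_linear t)"
proof -
  obtain S where "intertwines (flow t) S" by (rule affine_near_global[OF connected affine_near_flow])
  then show ?thesis using someI[of "intertwines (flow t)" S] by (simp add: flow_linear_def)
qed

lemma flow_inverse: "flow (- t) (flow t p) = p" "flow t (flow (- t) p) = p"
  using flow_add[of "- t" t] flow_add[of t "- t"] flow_0 by simp_all

lemma bij_flow: "bij (flow t)" and inv_flow: "inv_into UNIV (flow t) = flow (- t)"
proof -
  show b: "bij (flow t)"
    by (rule bij_betw_byWitness[of _ "flow (- t)"]) (auto simp: flow_inverse)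
  show "inv_into UNIV (flow t) = flow (- t)"
    by (rule ext) (metis b bij_inv_eq_iff flow_inverse(2))
qed

text \<open>Smooth dependence on the starting point, at arbitrary times, is a by-product of gluing
  affine germs.\<close>

lemma smooth_flow: "smooth_map_on A A UNIV (flow t)"
  by (rule intertwines_smooth[OF intertwines_flow])

text \<open>Obtained by differentiating \<open>flow t (flow s p) = flow (s + t) p\<close> with
  respect to \<open>s\<close> at 0.\<close>

lemma tangent_flow_field: "tangent_map A A (flow t) p (\<xi> p) = \<xi> (flow t p)"
proof -
  have c: "smooth_map_on std_atlas A UNIV (\<lambda>s. flow s p)" "tangent_map std_atlas A (\<lambda>s. flow s p) 0 1 = \<xi> p"
    using flow_curve[of p] flow_0 unfolding integral_curve_def by auto
  have "tangent_map A A (flow t) p (\<xi> p) = tangent_map std_atlas A (\<lambda>s. flow t (flow s p)) 0 1"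
    using tangent_map_compose[OF smooth_manifold_std manifold manifold open_UNIV open_UNIV c(1) smooth_flow, of 0 t 1]
      c(2) flow_0 by simp
  also have "(\<lambda>s. flow t (flow s p)) = (\<lambda>s. flow (s + t) p)" by (simp add: flow_add[symmetric] add.commute)
  also have "tangent_map std_atlas A (\<lambda>s. flow (s + t) p) 0 1 = \<xi> (flow t p)"
    using integral_curve_shift[OF flow_curve[of p], of t] unfolding integral_curve_def by simp
  finally show ?thesis .
qed

lemma flow_linear_0: "flow_linear 0 a = a"
proof -
  have "flow_linear 0 a = fd (\<lambda>q. dev (flow 0 q)) p a" for p by (simp add: intertwines_fd[OF intertwines_flow])
  then show ?thesis by (simp add: flow_0 fd_model)
qed

lemma flow_linear_add: "flow_linear (s + t) a = flow_linear s (flow_linear t a)"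
proof -
  have "flow (s + t) = (\<lambda>x. flow s (flow t x))" using flow_add by blast
  then show ?thesis
    using intertwines_fd[OF intertwines_flow[of "s + t"]]
      intertwines_fd[OF intertwines_comp[OF intertwines_flow[of t] intertwines_flow[of s]]] by metis
qed

lemma model_flow_diff: "dev (flow t q) - dev (flow t p) = flow_linear t (dev q - dev p)"
proof -
  obtain T where T: "linear_part T = flow_linear t" "dev \<circ> flow t = T \<circ> dev"
    by (rule intertwines_affine[OF connected intertwines_flow])
  have "T x - T y = flow_linear t (x - y)" for x y
    using linear_diff[OF intertwines_linear[OF intertwines_flow[of t]], of x y]
    by (simp add: T(1)[symmetric] linear_part_def)
  then show ?thesis using T(2) by (simp add: fun_eq_iff)
qed

text \<open>Since the flow is affine in the coordinates \<open>dev\<close>, the velocity \<open>E\<close> of the flow satisfies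
  \<open>E (x + s a) - E x = s D\<close> for small \<open>s\<close>, where \<open>D\<close> is the derivative of its linear part at \<open>a\<close>.\<close>

lemma flow_linear_deriv:
  "((\<lambda>t. flow_linear t a) has_vector_derivative fd (\<lambda>q. frame q (\<xi> q)) p a) (at 0)"
proof -
  let ?E = "\<lambda>q. frame q (\<xi> q)"
  have Es: "smooth_map_on A std_atlas UNIV ?E" using smooth_\<xi> smooth_field_on_iff_frame by blast
  have d: "((\<lambda>t. dev (flow t q)) has_vector_derivative ?E q) (at 0)" for q
    using integral_curve_model[OF flow_curve open_UNIV UNIV_I, of q 0] by (simp add: flow_0)
  have lin: "linear (flow_linear t)" for t by (rule intertwines_linear[OF intertwines_flow])
  obtain r where r: "r > 0" "ball (dev p) r \<subseteq> dev ` nb p"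
    using open_image_nb[of p] nb_diffeo(1)[of p] open_contains_ball by blast
  \<comment> \<open>For \<open>s\<close> below this bound in absolute value the point
    \<open>dev p + s *\<^sub>R a\<close> stays in the image of \<open>nb p\<close>. The summand 1
    covers \<open>a = 0\<close>.\<close>
  define \<delta> where "\<delta> = r / (norm a + 1)"
  have \<delta>: "\<delta> > 0" using r(1) by (simp add: \<delta>_def add_nonneg_pos)
  have pos: "norm a + 1 > 0" by (simp add: add_nonneg_pos)
  have near: "dev (sec p (dev p + s *\<^sub>R a)) = dev p + s *\<^sub>R a" if "\<bar>s\<bar> < \<delta>" for s
  proof -
    have "\<bar>s\<bar> * norm a \<le> \<bar>s\<bar> * (norm a + 1)" by (simp add: mult_left_mono)
    also have "\<dots> < r" using that pos by (simp add: \<delta>_def pos_less_divide_eq)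
    finally have "dev p + s *\<^sub>R a \<in> ball (dev p) r" by (simp add: dist_norm)
    then show ?thesis using r(2) by (intro model_sec) blast
  qed
  have sd: "((\<lambda>t. s *\<^sub>R flow_linear t a) has_vector_derivative ?E (sec p (dev p + s *\<^sub>R a)) - ?E p) (at 0)"
    if "\<bar>s\<bar> < \<delta>" for s
    using has_vector_derivative_diff[OF d[of "sec p (dev p + s *\<^sub>R a)"] d[of p]]
    by (simp add: model_flow_diff near[OF that] linear_cmul[OF lin])
  \<comment> \<open>Differentiability of \<open>flow_linear t a\<close> in \<open>t\<close> is not
    known beforehand. It is read off from two flow lines whose developed starting points differ by
    \<open>(\<delta> / 2) *\<^sub>R a\<close>; half of \<delta> is merely one admissible nonzero
    shift.\<close>
  define D where "D = (1 / (\<delta> / 2)) *\<^sub>R (?E (sec p (dev p + (\<delta> / 2) *\<^sub>R a)) - ?E p)"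
  have D: "((\<lambda>t. flow_linear t a) has_vector_derivative D) (at 0)"
  proof -
    have "((\<lambda>t. (1 / (\<delta> / 2)) *\<^sub>R ((\<delta> / 2) *\<^sub>R flow_linear t a)) has_vector_derivative D) (at 0)"
      unfolding D_def
      by (rule bounded_linear.has_vector_derivative[OF bounded_linear_scaleR_right sd]) (use \<delta> in simp)
    then show ?thesis using \<delta> by simp
  qed
  \<comment> \<open>Comparison with an arbitrary small shift \<open>s\<close> shows that the frame
    components of \<xi> are affine along the segment, with slope \<open>D\<close>.\<close>
  have Ds: "?E (sec p (dev p + s *\<^sub>R a)) = ?E p + s *\<^sub>R D" if "\<bar>s\<bar> < \<delta>" for s
    using vector_derivative_unique_at[OF sd[OF that]
        bounded_linear.has_vector_derivative[OF bounded_linear_scaleR_right D, of s]]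
    by (simp add: algebra_simps)
  have l: "((\<lambda>s. dev p + s *\<^sub>R a) has_derivative (\<lambda>s. s *\<^sub>R a)) (at 0)"
    by (auto intro!: derivative_eq_intros)
  have "((\<lambda>s. (?E \<circ> sec p) (dev p + s *\<^sub>R a)) has_derivative (\<lambda>s. fd ?E p (s *\<^sub>R a))) (at 0)"
    by (rule has_derivative_compose[OF l]) (simp only: scaleR_zero_left add_0_right fd_has_derivative[OF open_UNIV Es UNIV_I])
  then have "((\<lambda>s. ?E p + s *\<^sub>R D) has_derivative (\<lambda>s. fd ?E p (s *\<^sub>R a))) (at 0)"
    by (rule has_derivative_transform_within_open[of _ _ _ _ "{-\<delta><..<\<delta>}"]) (use \<delta> Ds in auto)
  moreover have "((\<lambda>s. ?E p + s *\<^sub>R D) has_derivative (\<lambda>s. s *\<^sub>R D)) (at 0)"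
    by (auto intro!: derivative_eq_intros)
  ultimately have "(\<lambda>s. fd ?E p (s *\<^sub>R a)) = (\<lambda>s. s *\<^sub>R D)" by (rule has_derivative_unique)
  from fun_cong[OF this, of 1] show ?thesis using D by simp
qed

text \<open>In the frames the pull-back of \<open>g\<close> by the flow has coefficients
  \<open>k\<close>. Their derivative at time 0 is given by the Lie derivative, and the group law
  carries this to every time, so the derivative of each coefficient is twice the
  coefficient.\<close>

lemma flow_scales:
  assumes g: "smooth_bilinear_field A g"
    and lie: "\<And>Y Z p. smooth_field_on A UNIV Y \<Longrightarrow> smooth_field_on A UNIV Z \<Longrightarrow>
      lie_derivative A \<xi> g Y Z p = 2 * g p (Y p) (Z p)"
  shows "g (flow t p) (tangent_map A A (flow t) p u) (tangent_map A A (flow t) p v) = exp (2 * t) * g p u v"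
proof -
  let ?H = "\<lambda>q a b. g q (coframe q a) (coframe q b)" and ?E = "\<lambda>q. frame q (\<xi> q)"
  have bil: "bilinear (?H q)" for q by (rule bilinear_coframe[OF smooth_bilinear_fieldD(1)[OF g]])
  have Hs: "smooth_map_on A std_atlas UNIV (\<lambda>q. ?H q a b)" for a b by (rule smooth_bilinear_fieldD(2)[OF g])
  have infinitesimal: "fd (\<lambda>q. ?H q a b) q (?E q) + ?H q (fd ?E q a) b + ?H q a (fd ?E q b) = 2 * ?H q a b" for q a b
  proof -
    have c: "smooth_field_on A UNIV (\<lambda>q. coframe q a)" for a by (rule smooth_const_field[OF open_UNIV])
    \<comment> \<open>A constant frame field has derivative 0, so only the derivative of \<xi>
      survives in the bracket. Its minus sign cancels those in the Lie derivative.\<close>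
    have br: "lie_bracket A \<xi> (\<lambda>q. coframe q a) q = - coframe q (fd ?E q a)" for a
    proof -
      have "frame q (lie_bracket A \<xi> (\<lambda>q. coframe q a) q) = - fd ?E q a"
        using frame_lie_bracket[OF open_UNIV UNIV_I smooth_\<xi> c] by (simp add: fd_const)
      then have "coframe q (frame q (lie_bracket A \<xi> (\<lambda>q. coframe q a) q)) = coframe q (- fd ?E q a)" by (rule arg_cong)
      then show ?thesis by (simp only: coframe_frame linear_neg[OF linear_coframe])
    qed
    show ?thesis
      using lie[OF c c, of a b q] smooth_bilinear_fieldD(1)[OF g, of q]
      by (simp add: lie_derivative_def dir_deriv_eq_fd[OF open_UNIV Hs UNIV_I] br bilinear_lneg bilinear_rneg)
  qed
  have d0: "((\<lambda>s. ?H (flow s q) (flow_linear s a) (flow_linear s b)) has_vector_derivative 2 * ?H q a b) (at 0)" for q a b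
  proof -
    have K: "((\<lambda>s. ?H (flow s q) b c) has_derivative (\<lambda>s. s *\<^sub>R fd (\<lambda>q. ?H q b c) q (?E q))) (at 0)" for b c
      proof -
      have "((\<lambda>s. ?H (flow s q) b c) has_vector_derivative
          fd (\<lambda>q. ?H q b c) (flow t q) (?E (flow t q))) (at t)" for t
        by (rule integral_curve_deriv[OF flow_curve open_UNIV UNIV_I Hs])
      from this[of 0] show ?thesis by (simp add: has_vector_derivative_def flow_0)
    qed
    have L: "((\<lambda>s. flow_linear s a) has_derivative (\<lambda>s. s *\<^sub>R fd ?E q a)) (at 0)" for a
      using flow_linear_deriv[of a q] by (simp add: has_vector_derivative_def)
    have "((\<lambda>s. ?H (flow s q) (flow_linear s a) (flow_linear s b)) has_derivative
       (\<lambda>s. s *\<^sub>R fd (\<lambda>q. ?H q a b) q (?E q) + ?H q (s *\<^sub>R fd ?E q a) b + ?H q a (s *\<^sub>R fd ?E q b))) (at 0)"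
      using bilinear_has_derivative[of "\<lambda>s. ?H (flow s q)", OF bil K L L] by (simp add: flow_0 flow_linear_0)
    moreover have "s *\<^sub>R fd (\<lambda>q. ?H q a b) q (?E q) + ?H q (s *\<^sub>R fd ?E q a) b + ?H q a (s *\<^sub>R fd ?E q b) = s *\<^sub>R (2 * ?H q a b)" for s
      unfolding infinitesimal[symmetric]
      by (simp only: bilinear_lmul[OF bil] bilinear_rmul[OF bil] scaleR_add_right)
    ultimately show ?thesis by (simp add: has_vector_derivative_def)
  qed
  define k where "k = (\<lambda>t a b. ?H (flow t p) (flow_linear t a) (flow_linear t b))"
  have kd: "((\<lambda>t. k t a b) has_real_derivative 2 * k t a b) (at t)" for t a b
  proof -
    have "((\<lambda>s. k (s + t) a b) has_real_derivative 2 * k t a b) (at 0)"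
      using d0[of "flow t p" "flow_linear t a" "flow_linear t b"]
      by (simp add: k_def flow_add flow_linear_add has_real_derivative_iff_has_vector_derivative)
    then show ?thesis using DERIV_shift[of "\<lambda>t. k t a b" "2 * k t a b" 0 t] by simp
  qed
  \<comment> \<open>The factor \<open>exp (- 2 * t)\<close> turns the differential equation for
    \<open>k\<close> into constancy.\<close>
  have "((\<lambda>t. k t a b * exp (- 2 * t)) has_real_derivative 0) (at t)" for t a b
    by (rule derivative_eq_intros kd refl)+ simp
  then have "k t a b * exp (- 2 * t) = k 0 a b * exp (- 2 * 0)" for a b
    by (intro DERIV_isconst_all[rule_format]) blast
  then have k: "k t a b = exp (2 * t) * ?H p a b" for a b
    by (simp add: k_def flow_0 flow_linear_0 exp_minus field_simps)
  have "tangent_map A A (flow t) p w = coframe (flow t p) (flow_linear t (frame p w))" for w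
    using intertwines_frame[OF intertwines_flow] by (metis coframe_frame)
  then show ?thesis using k[of "frame p u" "frame p v"] by (simp add: k_def)
qed

end


section \<open>The Kaehler structure on the tangent bundle\<close>

context local_model
begin

lemma diffeo_tangent_bundle:
  "diffeo_on (prod_atlas B std_atlas) std_atlas (nb p \<times> UNIV) (map_prod \<Phi> (id :: 'f \<Rightarrow> 'f))"
proof -
  let ?N = "prod_atlas B (std_atlas :: ('f, 'f) chart set)" and ?\<Psi> = "map_prod \<Phi> (id :: 'f \<Rightarrow> 'f)" and ?W = "nb p \<times> (UNIV :: 'f set)"
  note N = smooth_manifold_prod[OF manifold smooth_manifold_std]
  note f = smooth_map_on_fst[OF manifold smooth_manifold_std] and s = smooth_map_on_snd[OF manifold smooth_manifold_std]
  have W: "open ?W" by (intro open_Times open_nb open_UNIV)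
  have im: "?\<Psi> ` ?W = \<Phi> ` nb p \<times> UNIV" by (simp add: map_prod_surj_on)
  then have oI: "open (?\<Psi> ` ?W)" by (simp add: open_Times open_image_nb)
  have inj: "inj_on ?\<Psi> ?W" by (intro map_prod_inj_on inj_nb) simp
  have inv: "inv_into ?W ?\<Psi> z = (sec p (fst z), snd z)" if "z \<in> ?\<Psi> ` ?W" for z
  proof -
    from that obtain q v where q: "q \<in> nb p" "z = ?\<Psi> (q, v)" by auto
    then show ?thesis using inv_into_f_f[OF inj, of "(q, v)"] by (simp add: sec_model)
  qed
  have 1: "smooth_map_on ?N std_atlas UNIV (\<lambda>z. \<Phi> (fst z))"
    by (rule smooth_map_on_compose[OF N manifold smooth_manifold_std open_UNIV open_UNIV f smooth_model]) auto
  have "smooth_map_on ?N std_atlas UNIV (\<lambda>z. (\<Phi> (fst z), snd z))"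
  proof (rule smooth_map_on_stdI[OF N open_UNIV])
    fix C assume C: "C \<in> ?N"
    have "open (snd C ` (fst C \<inter> UNIV))" by (rule open_chart_restrict[OF N C open_UNIV])
    from smooth_on_Pair[OF this] 1 s C
    show "smooth_on (snd C ` (fst C \<inter> UNIV)) ((\<lambda>z. (\<Phi> (fst z), snd z)) \<circ> chart_inv C)"
      unfolding smooth_map_on_std_iff comp_def by blast
  qed
  moreover have "(\<lambda>z. (\<Phi> (fst z), snd z)) = ?\<Psi>" by (auto simp: fun_eq_iff)
  ultimately have "smooth_map_on ?N std_atlas UNIV ?\<Psi>" by (simp only:)
  then have 2: "smooth_map_on ?N std_atlas ?W ?\<Psi>" by (rule smooth_map_on_subset) simp
  have o: "open (\<Phi> ` nb p \<times> (UNIV :: 'f set))" by (simp add: open_Times open_image_nb)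
  have l: "smooth_map_on std_atlas std_atlas (\<Phi> ` nb p \<times> (UNIV :: 'f set)) fst" "smooth_map_on std_atlas std_atlas (\<Phi> ` nb p \<times> (UNIV :: 'f set)) snd"
    by (simp_all add: smooth_map_std_std_iff smooth_on_linear bounded_linear_fst bounded_linear_snd)
  have "smooth_map_on std_atlas B (\<Phi> ` nb p \<times> (UNIV :: 'f set)) (\<lambda>z. sec p (fst z))"
    by (rule smooth_map_on_compose[OF smooth_manifold_std smooth_manifold_std manifold o open_image_nb l(1) smooth_sec]) auto
  from smooth_map_on_Pair[OF smooth_manifold_std manifold smooth_manifold_std o this l(2)]
  have "smooth_map_on std_atlas ?N (?\<Psi> ` ?W) (\<lambda>z. (sec p (fst z), snd z))" by (simp add: im)
  then have "smooth_map_on std_atlas ?N (?\<Psi> ` ?W) (inv_into ?W ?\<Psi>)"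
    by (rule smooth_map_on_cong[OF smooth_manifold_std N oI]) (simp add: inv)
  then show ?thesis unfolding diffeo_on_def using W oI inj 2 by blast
qed

lemma local_model_tangent_bundle: "local_model (tb_atlas B) (map_prod \<Phi> id)"
proof
  show "smooth_manifold (tb_atlas B)"
    unfolding tb_atlas_def by (rule smooth_manifold_prod[OF manifold smooth_manifold_std])
  fix z :: "'n \<times> 'f"
  have "z \<in> nb (fst z) \<times> UNIV" using nb_diffeo(1) by (simp add: mem_Times_iff)
  then show "\<exists>U. z \<in> U \<and> diffeo_on (tb_atlas B) std_atlas U (map_prod \<Phi> id)"
    unfolding tb_atlas_def by (intro exI[of _ "nb (fst z) \<times> UNIV"] conjI diffeo_tangent_bundle)
qed

end

lemma bounded_linear_rotation: "bounded_linear (\<lambda>(X, Y). (- Y, X) :: 'e::euclidean_space \<times> 'e)"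
  unfolding case_prod_beta'
  by (rule bounded_linear_Pair[OF bounded_linear_minus[OF bounded_linear_snd] bounded_linear_fst])

locale hessian_model = flat_model A dev nabla
  for A :: "('m::{t2_space,second_countable_topology}, 'e::euclidean_space) chart set"
    and dev :: "'m \<Rightarrow> 'e" and nabla +
  fixes g :: "'m \<Rightarrow> 'e \<Rightarrow> 'e \<Rightarrow> real"
  assumes hessian: "hessian_manifold A nabla g"

sublocale hessian_model \<subseteq> TB: local_model "tb_atlas A" "map_prod dev id"
  by (rule local_model_tangent_bundle)

context hessian_model
begin

abbreviation I where "I \<equiv> tb_complex A dev"
abbreviation J :: "'e \<times> 'e \<Rightarrow> 'e \<times> 'e" where "J \<equiv> \<lambda>(X, Y). (- Y, X)"

definition H :: "'m \<Rightarrow> 'e \<Rightarrow> 'e \<Rightarrow> real" where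
  "H q a b = g q (coframe q a) (coframe q b)"

lemma smooth_metric: "smooth_bilinear_field A g"
  and metric_sym: "g p u v = g p v u" and metric_pos: "u \<noteq> 0 \<Longrightarrow> g p u u > 0"
  using hessian unfolding hessian_manifold_def riemannian_metric_def by auto

lemma bilinear_H: "bilinear (H q)"
  unfolding H_def[abs_def] by (rule bilinear_coframe[OF smooth_bilinear_fieldD(1)[OF smooth_metric]])

lemma smooth_H: "smooth_map_on A std_atlas UNIV (\<lambda>q. H q a b)"
  unfolding H_def by (rule smooth_bilinear_fieldD(2)[OF smooth_metric])

lemma H_sym: "H q a b = H q b a"
  unfolding H_def by (rule metric_sym)

lemma H_pos: "a \<noteq> 0 \<Longrightarrow> H q a a > 0"
  unfolding H_def by (rule metric_pos) (metis frame_coframe linear_0 linear_frame)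

lemma fd_H_sym: "fd (\<lambda>q. H q a b) p c = fd (\<lambda>q. H q c b) p a" "fd (\<lambda>q. H q a b) p c = fd (\<lambda>q. H q b a) p c"
  unfolding H_def using hessian_derivative_symmetric[OF hessian] by (auto simp: metric_sym)

lemma tb_frame_eq: "tb_frame A dev = TB.frame"
  by (intro ext) (simp add: tb_frame_def TB.frame_def)

lemma smooth_fst: "smooth_map_on (tb_atlas A) A UNIV fst" and smooth_snd: "smooth_map_on (tb_atlas A) std_atlas UNIV snd"
  unfolding tb_atlas_def
  by (rule smooth_map_on_fst[OF manifold smooth_manifold_std] smooth_map_on_snd[OF manifold smooth_manifold_std])+

text \<open>Both sides differentiate the same map, written as \<open>dev\<close> after
  \<open>fst\<close> and as \<open>fst\<close> after \<open>map_prod dev id\<close>.\<close>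

lemma fst_tb_frame: "frame (fst z) (tangent_map (tb_atlas A) A fst z w) = fst (TB.frame z w)"
proof -
  have 1: "smooth_map_on std_atlas std_atlas UNIV (fst :: 'e \<times> 'e \<Rightarrow> 'e)"
    by (simp add: smooth_map_std_std_iff smooth_on_linear bounded_linear_fst)
  have "frechet_derivative fst (at (map_prod dev id z)) = (fst :: 'e \<times> 'e \<Rightarrow> 'e)"
    by (rule frechet_derivative_at[symmetric]) (rule bounded_linear_imp_has_derivative[OF bounded_linear_fst])
  then have "tangent_map (tb_atlas A) std_atlas (\<lambda>z. fst (map_prod dev id z)) z w = fst (TB.frame z w)"
    using tangent_map_compose[OF TB.manifold smooth_manifold_std smooth_manifold_std open_UNIV open_UNIV TB.smooth_model 1, of z w]
    by (simp add: tangent_map_std TB.frame_def)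
  moreover have "tangent_map (tb_atlas A) std_atlas (\<lambda>z. dev (fst z)) z w = frame (fst z) (tangent_map (tb_atlas A) A fst z w)"
    using tangent_map_compose[OF TB.manifold manifold smooth_manifold_std open_UNIV open_UNIV smooth_fst smooth_model, of z w]
    by (simp add: frame_def)
  ultimately show ?thesis by simp
qed

lemma smooth_fst_compose:
  assumes "smooth_map_on A std_atlas UNIV f"
  shows "smooth_map_on (tb_atlas A) std_atlas UNIV (\<lambda>z. f (fst z))"
  by (rule smooth_map_on_compose[OF TB.manifold manifold smooth_manifold_std open_UNIV open_UNIV smooth_fst assms]) auto

lemma fd_fst_compose:
  assumes "smooth_map_on A std_atlas UNIV f"
  shows "TB.fd (\<lambda>z. f (fst z)) z c = fd f (fst z) (fst c)"
  using tangent_map_compose[OF TB.manifold manifold smooth_manifold_std open_UNIV open_UNIV smooth_fst assms, of z "TB.coframe z c"]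
    TB.tangent_map_eq_fd[OF open_UNIV smooth_fst_compose[OF assms] UNIV_I, of z "TB.coframe z c"]
    tangent_map_eq_fd[OF open_UNIV assms UNIV_I] fst_tb_frame
  by simp

lemma pullback_fst: "pullback_form (tb_atlas A) A fst g z v w = H (fst z) (fst (TB.frame z v)) (fst (TB.frame z w))"
  by (simp add: pullback_form_def H_def fst_tb_frame[symmetric])

lemma I_eq: "I z w = TB.coframe z (J (TB.frame z w))"
  by (simp add: tb_complex_def tb_frame_eq TB.coframe_def)

lemma frame_I: "TB.frame z (I z w) = J (TB.frame z w)"
  by (simp add: I_eq)

definition \<Omega> :: "'m \<Rightarrow> 'e \<times> 'e \<Rightarrow> 'e \<times> 'e \<Rightarrow> real" where
  "\<Omega> q a b = H q (fst a) (snd b) - H q (snd a) (fst b)"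

text \<open>For frame components \<open>a\<close> of \<open>v\<close> and \<open>b\<close> of
  \<open>w\<close>, the two parts of the metric at \<open>I v\<close> and \<open>w\<close> are
  \<open>H\<close> of \<open>- snd a\<close> and \<open>fst b\<close>, and \<open>H\<close> of
  \<open>- fst a\<close> and \<open>- snd b\<close>. The coefficients depend on the base point
  alone.\<close>

lemma tb_form_eq: "tb_form A dev g z v w = \<Omega> (fst z) (TB.frame z v) (TB.frame z w)"
  by (simp add: tb_form_def tb_metric_def pullback_fst frame_I \<Omega>_def split_beta
      bilinear_lneg[OF bilinear_H] bilinear_rneg[OF bilinear_H])

lemma bilinear_\<Omega>: "bilinear (\<Omega> q)"
  unfolding bilinear_def linear_iff \<Omega>_def
  by (simp add: bilinear_ladd[OF bilinear_H] bilinear_radd[OF bilinear_H]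
      bilinear_lmul[OF bilinear_H] bilinear_rmul[OF bilinear_H] algebra_simps)

lemma \<Omega>_antisym: "\<Omega> q a b = - \<Omega> q b a"
  unfolding \<Omega>_def using H_sym[of q "fst a" "snd b"] H_sym[of q "snd a" "fst b"] by simp

lemma smooth_\<Omega>: "smooth_map_on (tb_atlas A) std_atlas UNIV (\<lambda>z. \<Omega> (fst z) a b)"
  unfolding \<Omega>_def by (intro TB.smooth_diff[OF open_UNIV] smooth_fst_compose smooth_H)

lemma fd_\<Omega>: "TB.fd (\<lambda>z. \<Omega> (fst z) a b) z c =
    fd (\<lambda>q. H q (fst a) (snd b)) (fst z) (fst c) - fd (\<lambda>q. H q (snd a) (fst b)) (fst z) (fst c)"
  unfolding \<Omega>_def
  using TB.fd_diff[OF open_UNIV smooth_fst_compose[OF smooth_H] smooth_fst_compose[OF smooth_H] UNIV_I,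
      of "fst a" "snd b" "snd a" "fst b" z c]
    fd_fst_compose[OF smooth_H]
  by simp

text \<open>Closedness on constant frame fields. Only horizontal components differentiate, and the
  six resulting terms cancel in pairs by the total symmetry of the derivative of \<open>H\<close>:
  each pair contains the vertical component of one of the three vectors.\<close>

lemma fd_\<Omega>_cyclic: "TB.fd (\<lambda>z. \<Omega> (fst z) y w) z x - TB.fd (\<lambda>z. \<Omega> (fst z) x w) z y
    + TB.fd (\<lambda>z. \<Omega> (fst z) x y) z w = 0"
proof -
  let ?K = "\<lambda>a b c. fd (\<lambda>q. H q a b) (fst z) c"
  have s: "?K a b c = ?K c b a" "?K a b c = ?K b a c" for a b c by (rule fd_H_sym)+
  have "?K (fst y) (snd w) (fst x) = ?K (fst x) (snd w) (fst y)" by (rule s(1))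
  moreover have "?K (snd y) (fst w) (fst x) = ?K (fst x) (snd y) (fst w)" by (metis s)
  moreover have "?K (snd x) (fst w) (fst y) = ?K (snd x) (fst y) (fst w)" by (metis s)
  ultimately show ?thesis unfolding fd_\<Omega> by simp
qed

lemma bilinear_tb_form: "bilinear (tb_form A dev g z)"
  using linear_compose[OF TB.linear_frame[of z]] bilinear_\<Omega>[of "fst z"]
  unfolding bilinear_def tb_form_eq[abs_def] comp_def by blast

lemma smooth_tb_form: "smooth_bilinear_field (tb_atlas A) (tb_form A dev g)"
  by (rule TB.smooth_bilinear_fieldI[OF bilinear_tb_form]) (simp add: tb_form_eq smooth_\<Omega>)

text \<open>In the frames a bracket is an antisymmetrised derivative of components, so the
  derivatives of the fields cancel between the Leibniz expansions and the bracket terms. The cyclic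
  sum for constant fields remains.\<close>

lemma closed_tb_form: "closed_2form (tb_atlas A) (tb_form A dev g)"
  unfolding closed_2form_def
proof (intro conjI allI impI ballI smooth_tb_form; (elim conjE)?)
  let ?w = "tb_form A dev g"
  show anti: "?w p u v = - ?w p v u" for p u v unfolding tb_form_eq by (rule \<Omega>_antisym)
  fix W X Y Z p assume W: "open W" and X: "smooth_field_on (tb_atlas A) W X"
    and Y: "smooth_field_on (tb_atlas A) W Y" and Z: "smooth_field_on (tb_atlas A) W Z" and p: "p \<in> W"
  let ?F = "\<lambda>X q. TB.frame q (X q)"
  have dd: "dir_deriv (tb_atlas A) (\<lambda>q. ?w q (S q) (T q)) p (R p) =
      TB.fd (\<lambda>q. \<Omega> (fst q) (?F S p) (?F T p)) p (?F R p)
      + \<Omega> (fst p) (TB.fd (?F S) p (?F R p)) (?F T p) + \<Omega> (fst p) (?F S p) (TB.fd (?F T) p (?F R p))"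
    if S: "smooth_field_on (tb_atlas A) W S" and T: "smooth_field_on (tb_atlas A) W T" for R S T
  proof -
    have "smooth_map_on (tb_atlas A) std_atlas W (\<lambda>q. ?w q (S q) (T q))"
      using smooth_tb_form W S T unfolding smooth_bilinear_field_def by blast
    then show ?thesis
      using TB.dir_deriv_eq_fd[OF W _ p] TB.fd_bilinear_field[OF smooth_tb_form W p S T]
      by (simp add: tb_form_eq)
  qed
  have br: "?w p (lie_bracket (tb_atlas A) S T p) (R p) =
      \<Omega> (fst p) (TB.fd (?F T) p (?F S p)) (?F R p) - \<Omega> (fst p) (TB.fd (?F S) p (?F T p)) (?F R p)"
    if S: "smooth_field_on (tb_atlas A) W S" and T: "smooth_field_on (tb_atlas A) W T" for R S T
    unfolding tb_form_eq TB.frame_lie_bracket[OF W p S T] by (rule bilinear_lsub[OF bilinear_\<Omega>])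
  \<comment> \<open>Moves the derivative of a field to the first argument, where the bracket terms
    have it.\<close>
  have a: "\<Omega> (fst p) (?F R p) b = - \<Omega> (fst p) b (?F R p)" for R b by (rule \<Omega>_antisym)
  show "dir_deriv (tb_atlas A) (\<lambda>q. ?w q (Y q) (Z q)) p (X p)
         - dir_deriv (tb_atlas A) (\<lambda>q. ?w q (X q) (Z q)) p (Y p)
         + dir_deriv (tb_atlas A) (\<lambda>q. ?w q (X q) (Y q)) p (Z p)
         - ?w p (lie_bracket (tb_atlas A) X Y p) (Z p)
         + ?w p (lie_bracket (tb_atlas A) X Z p) (Y p)
         - ?w p (lie_bracket (tb_atlas A) Y Z p) (X p) = 0"
    unfolding dd[OF Y Z] dd[OF X Z] dd[OF X Y] br[OF X Y] br[OF X Z] br[OF Y Z]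
    using fd_\<Omega>_cyclic[of "?F Y p" "?F Z p" p "?F X p"]
      a[of X "TB.fd (?F Y) p (?F Z p)"] a[of X "TB.fd (?F Z) p (?F Y p)"] a[of Y "TB.fd (?F Z) p (?F X p)"]
    by linarith
qed

text \<open>Integrability is visible in the coordinates \<open>map_prod dev id\<close>, in which
  \<open>I\<close> is the constant rotation \<open>J\<close>.\<close>

lemma complex_structure_I: "complex_structure (tb_atlas A) I"
  unfolding complex_structure_def
proof (intro conjI allI)
  have lJ: "linear J" by (rule bounded_linear.linear[OF bounded_linear_rotation])
  have JJ: "J (J x) = - x" for x :: "'e \<times> 'e" by (simp add: split_beta prod_eq_iff)
  show "smooth_endomorphism_field (tb_atlas A) I"
    unfolding smooth_endomorphism_field_def
  proof (intro conjI allI impI; (elim conjE)?)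
    show "linear (I p)" for p
      using linear_compose[OF linear_compose[OF TB.linear_frame lJ] TB.linear_coframe]
      unfolding I_eq[abs_def] comp_def .
    fix W X assume W: "open W" and X: "smooth_field_on (tb_atlas A) W X"
    show "smooth_field_on (tb_atlas A) W (\<lambda>p. I p (X p))"
      using TB.smooth_compose_linear[OF W _ bounded_linear_rotation] X
      unfolding TB.smooth_field_on_iff_frame[OF W] frame_I .
  qed
  show "I p (I p v) = - v" for p v
    by (simp only: I_eq TB.frame_coframe JJ linear_neg[OF TB.linear_coframe] TB.coframe_frame)
  fix p
  show "\<exists>U (c :: 'm \<times> 'e \<Rightarrow> 'e \<times> 'e) J. p \<in> U \<and> diffeo_on (tb_atlas A) std_atlas U c \<and> linear J \<and> (\<forall>x. J (J x) = - x) \<and>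
      (\<forall>q\<in>U. \<forall>v. tangent_map (tb_atlas A) std_atlas c q (I q v) = J (tangent_map (tb_atlas A) std_atlas c q v))"
    using TB.nb_diffeo lJ JJ frame_I unfolding TB.frame_def by blast
qed

text \<open>On \<open>u\<close> and \<open>I u\<close> the form is the sum of \<open>H\<close> on
  the horizontal and on the vertical component of \<open>u\<close>, at least one of which is
  nonzero.\<close>

lemma kaehler_tb_form: "kaehler_structure (tb_atlas A) I (tb_form A dev g)"
  unfolding kaehler_structure_def
proof (intro conjI allI impI TB.manifold complex_structure_I closed_tb_form)
  show "tb_form A dev g p (I p u) (I p v) = tb_form A dev g p u v" for p u v
    by (simp add: tb_form_eq frame_I \<Omega>_def split_beta bilinear_lneg[OF bilinear_H] bilinear_rneg[OF bilinear_H])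
  fix p u assume u: "u \<noteq> (0 :: 'e \<times> 'e)"
  let ?a = "TB.frame p u"
  have "?a \<noteq> 0" using u by (metis TB.coframe_frame linear_0 TB.linear_coframe)
  then have "fst ?a \<noteq> 0 \<or> snd ?a \<noteq> 0" by (simp add: prod_eq_iff)
  moreover have "H (fst p) c c \<ge> 0" for c
    using H_pos[of c "fst p"] by (cases "c = 0") (auto simp: bilinear_lzero[OF bilinear_H])
  ultimately have "H (fst p) (fst ?a) (fst ?a) + H (fst p) (snd ?a) (snd ?a) > 0"
    using H_pos by (smt (verit))
  then show "tb_form A dev g p u (I p u) > 0"
    by (simp add: tb_form_eq frame_I \<Omega>_def split_beta bilinear_rneg[OF bilinear_H])
qed

end


section \<open>Groups of similarities acting on the tangent bundle\<close>

lemma affine_map_apply: "T x = linear_part T x + T 0"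
  by (simp add: linear_part_def)

lemma linear_part_comp:
  assumes "affine_map T"
  shows "linear_part (\<lambda>x. T (R x)) = (\<lambda>x. linear_part T (linear_part R x))"
proof
  fix x
  have l: "linear (linear_part T)" using assms by (simp add: affine_map_def)
  have "linear_part T (R x - R 0) = linear_part T (R x) - linear_part T (R 0)" by (rule linear_diff[OF l])
  then show "linear_part (\<lambda>x. T (R x)) x = linear_part T (linear_part R x)" by (simp add: linear_part_def)
qed

lemma affine_map_comp:
  assumes "affine_map T" "affine_map R"
  shows "affine_map (\<lambda>x. T (R x))"
proof -
  have "linear (linear_part T \<circ> linear_part R)"
    using assms unfolding affine_map_def by (intro linear_compose)
  moreover have "linear_part (\<lambda>x. T (R x)) = linear_part T \<circ> linear_part R"
    using linear_part_comp[OF assms(1), of R] by (simp only: comp_def)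
  ultimately show ?thesis unfolding affine_map_def by (rule ssubst[rotated])
qed

lemma linear_part_ident: "linear_part (\<lambda>x. x) = (\<lambda>x. x)"
  by (rule ext) (simp add: linear_part_def)

text \<open>A \<open>group_action\<close> is a homomorphism to the group of bijections; the inverse
  element witnesses that each map is bijective.\<close>

lemma group_action_UNIV_I:
  fixes G (structure)
  assumes "group G" and one: "\<psi> \<one> = (\<lambda>x. x)"
    and mult: "\<And>a b. a \<in> carrier G \<Longrightarrow> b \<in> carrier G \<Longrightarrow> \<psi> (a \<otimes> b) = (\<lambda>x. \<psi> a (\<psi> b x))"
  shows "group_action G UNIV \<psi>"
proof -
  interpret group G by fact
  have bij: "bij (\<psi> a)" if a: "a \<in> carrier G" for a
  proof (rule bij_betw_byWitness[of _ "\<psi> (inv a)"])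
    show "\<forall>x\<in>UNIV. \<psi> (inv a) (\<psi> a x) = x" "\<forall>x\<in>UNIV. \<psi> a (\<psi> (inv a) x) = x"
      using mult[of "inv a" a] mult[of a "inv a"] a one by (metis inv_closed l_inv r_inv)+
  qed auto
  then have B: "\<psi> a \<in> carrier (BijGroup UNIV)" if "a \<in> carrier G" for a
    using that by (simp add: BijGroup_def Bij_def)
  have "\<psi> \<in> hom G (BijGroup UNIV)"
  proof (rule homI)
    fix a b assume ab: "a \<in> carrier G" "b \<in> carrier G"
    then show "\<psi> (a \<otimes> b) = \<psi> a \<otimes>\<^bsub>BijGroup UNIV\<^esub> \<psi> b"
      using B[OF ab(1)] B[OF ab(2)] mult[OF ab]
      by (simp add: BijGroup_def compose_def restrict_def fun_eq_iff)
  qed (rule B)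
  then show ?thesis
    by (intro group_action.intro group_hom.intro group_hom_axioms.intro group_BijGroup is_group)
qed

locale selfsimilar_model = hessian_model A dev nabla g
  for A :: "('m::{t2_space,second_countable_topology}, 'e::euclidean_space) chart set"
    and dev :: "'m \<Rightarrow> 'e" and nabla g +
  fixes \<xi> :: "'m \<Rightarrow> 'e"
  assumes connected: "connected (UNIV :: 'm set)"
    and smooth_field: "smooth_field_on A UNIV \<xi>"
    and field_nonzero: "\<And>p. \<xi> p \<noteq> 0"
begin

text \<open>One notion for isometries and flow maps that is closed under composition. Affinity is
  stated in frame form, so that the matrix is at hand.\<close>

definition similarity :: "('m \<Rightarrow> 'm) \<Rightarrow> real \<Rightarrow> bool" where
  "similarity f c \<longleftrightarrow> c > 0 \<and> bij f \<and> smooth_map_on A A UNIV (inv_into UNIV f) \<and> (\<exists>S. intertwines f S) \<and>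
     (\<forall>p u v. g (f p) (tangent_map A A f p u) (tangent_map A A f p v) = c * g p u v) \<and>
     (\<forall>p. tangent_map A A f p (\<xi> p) = \<xi> (f p))"

lemma similarity_ident: "similarity (\<lambda>x. x) 1"
proof -
  have "inv_into UNIV (\<lambda>x. x) = (\<lambda>x::'m. x)" by (simp add: inv_into_def[abs_def])
  then show ?thesis
    unfolding similarity_def using intertwines_id smooth_map_on_ident[OF manifold]
    by (auto simp: tangent_map_ident[OF manifold] bij_id[unfolded id_def])
qed

lemma similarity_comp:
  assumes f: "similarity f c" and h: "similarity h d"
  shows "similarity (\<lambda>x. h (f x)) (c * d)"
proof -
  have s: "smooth_map_on A A UNIV f" "smooth_map_on A A UNIV h"
    using f h intertwines_smooth unfolding similarity_def by blast+
  have b: "bij f" "bij h" using f h unfolding similarity_def by auto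
  then have bc: "bij (\<lambda>x. h (f x))" using bij_comp[OF b] by (simp add: comp_def)
  have i: "inv_into UNIV (\<lambda>x. h (f x)) = (\<lambda>y. inv_into UNIV f (inv_into UNIV h y))"
    using o_inv_distrib[OF b(2,1)] by (simp add: comp_def fun_eq_iff)
  have si: "smooth_map_on A A UNIV (inv_into UNIV (\<lambda>x. h (f x)))"
    unfolding i by (rule smooth_comp_global) (use f h in \<open>auto simp: similarity_def\<close>)
  show ?thesis
    using f h bc si intertwines_comp[of f _ h] unfolding similarity_def tangent_map_comp_global[OF s]
    by (auto simp: mult.assoc mult.left_commute)
qed

lemma similarity_inverse:
  assumes f: "similarity f c"
  shows "similarity (inv_into UNIV f) (1 / c)"
proof -
  have f': "c > 0" "bij f" "smooth_map_on A A UNIV (inv_into UNIV f)" "\<exists>S. intertwines f S"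
    "\<And>p u v. g (f p) (tangent_map A A f p u) (tangent_map A A f p v) = c * g p u v"
    "\<And>p. tangent_map A A f p (\<xi> p) = \<xi> (f p)"
    using f unfolding similarity_def by auto
  have s: "smooth_map_on A A UNIV f" using f'(4) intertwines_smooth by blast
  let ?h = "inv_into UNIV f"
  have b: "?h (f p) = p" "f (?h p) = p" for p
    using f'(2) by (simp_all add: bij_is_inj bij_is_surj surj_f_inv_f)
  note t = bij_diffeo_tangent[OF f'(2) s f'(3)]
  have t': "tangent_map A A f (?h p) (tangent_map A A ?h p v) = v" for p v using t(1)[of "?h p" v] by (simp add: b)
  have bh: "bij ?h" by (rule bij_imp_bij_inv[OF f'(2)])
  have ih: "inv_into UNIV ?h = f" by (rule inv_inv_eq[OF f'(2)])
  have "g (?h p) (tangent_map A A ?h p u) (tangent_map A A ?h p v) = 1 / c * g p u v" for p u v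
    using f'(5)[of "?h p" "tangent_map A A ?h p u" "tangent_map A A ?h p v"] f'(1) by (simp add: t' b)
  moreover have "tangent_map A A ?h p (\<xi> p) = \<xi> (?h p)" for p
    using t(2)[of "?h p" "\<xi> (?h p)"] f'(6)[of "?h p"] by (simp add: b)
  moreover have "\<exists>S. intertwines ?h S" using intertwines_inv[OF f'(2,3)] f'(4) by blast
  ultimately show ?thesis unfolding similarity_def using f'(1) bh s by (simp add: ih)
qed

lemma similarity_affine:
  assumes "similarity f c"
  shows "affine_map (induced_affine dev f)" "dev (f p) = induced_affine dev f (dev p)"
    "intertwines f (linear_part (induced_affine dev f))"
proof -
  obtain S where S: "intertwines f S" using assms unfolding similarity_def by blast
  obtain T where T: "affine_map T" "linear_part T = S" "dev \<circ> f = T \<circ> dev"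
    by (rule intertwines_affine[OF connected S])
  have e: "induced_affine dev f = T" by (rule induced_affine_eq[OF T(1,3)])
  show "affine_map (induced_affine dev f)" unfolding e by (rule T(1))
  show "dev (f p) = induced_affine dev f (dev p)" using fun_cong[OF T(3), of p] by (simp add: e)
  show "intertwines f (linear_part (induced_affine dev f))" unfolding e T(2) by (rule S)
qed

abbreviation lift :: "('m \<Rightarrow> 'm) \<Rightarrow> 'e \<Rightarrow> 'm \<times> 'e \<Rightarrow> 'm \<times> 'e" where
  "lift f u \<equiv> \<lambda>(m, v). (f m, induced_affine dev f v + u)"

text \<open>The first component develops to the induced affine map at \<open>dev m\<close>, the
  second is the same affine map at \<open>v\<close> plus a translation, so both have linear part
  \<open>L\<close>.\<close>

lemma intertwines_lift:
  assumes f: "similarity f c"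
  defines "L \<equiv> linear_part (induced_affine dev f)"
  shows "TB.intertwines (lift f u) (map_prod L L)"
proof -
  let ?T = "induced_affine dev f"
  note T = similarity_affine[OF f, folded L_def]
  have lin: "linear L" by (rule intertwines_linear[OF T(3)])
  then have bL: "bounded_linear L" by (simp add: linear_conv_bounded_linear)
  have T': "?T v = L v + ?T 0" for v unfolding L_def by (rule affine_map_apply)
  have LL: "bounded_linear (map_prod L L)"
    unfolding map_prod_def case_prod_beta'
    by (intro bounded_linear_Pair bounded_linear_compose[OF bL] bounded_linear_fst bounded_linear_snd)
  have s1: "smooth_map_on (tb_atlas A) A UNIV (\<lambda>z. f (fst z))"
    by (rule smooth_map_on_compose[OF TB.manifold manifold manifold open_UNIV open_UNIV smooth_fst
          intertwines_smooth[OF T(3)]]) auto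
  have "smooth_map_on std_atlas std_atlas UNIV (\<lambda>v. L v + (?T 0 + u))"
    by (simp add: smooth_map_std_std_iff smooth_on_add smooth_on_linear[OF bL] smooth_on_const)
  then have "smooth_map_on std_atlas std_atlas UNIV (\<lambda>v. ?T v + u)" by (simp add: T'[of "_ :: 'e", symmetric] add.assoc[symmetric])
  from smooth_map_on_compose[OF TB.manifold smooth_manifold_std smooth_manifold_std open_UNIV open_UNIV smooth_snd this]
  have s2: "smooth_map_on (tb_atlas A) std_atlas UNIV (\<lambda>z. ?T (snd z) + u)" by simp
  have "smooth_map_on (tb_atlas A) (tb_atlas A) UNIV (\<lambda>z. (f (fst z), ?T (snd z) + u))"
    using smooth_map_on_Pair[OF TB.manifold manifold smooth_manifold_std open_UNIV s1 s2] by (simp add: tb_atlas_def)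
  then have sm: "smooth_map_on (tb_atlas A) (tb_atlas A) UNIV (lift f u)" by (simp add: case_prod_beta')
  let ?c = "(?T 0, ?T 0 + u)"
  \<comment> \<open>The constant is subtracted as its own negative, so that the rule for differences
    of maps applies.\<close>
  have e: "map_prod dev id (lift f u z) = map_prod L L (map_prod dev id z) - (- ?c)" for z
    using T(2)[of "fst z"] T'[of "dev (fst z)"] T'[of "snd z"] by (simp add: split_beta map_prod_def)
  have "TB.fd (\<lambda>z. map_prod dev id (lift f u z)) z a = map_prod L L a" for z a
    unfolding e
    using TB.fd_diff[OF open_UNIV TB.smooth_compose_linear[OF open_UNIV TB.smooth_model LL]
        smooth_map_on_const UNIV_I, of "- ?c" z a]
      TB.fd_linear[OF open_UNIV TB.smooth_model UNIV_I LL, of z a]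
    by (simp add: TB.fd_const TB.fd_model)
  then show ?thesis
    unfolding TB.intertwines_def using sm TB.frame_tangent[OF open_UNIV sm UNIV_I] by simp
qed

lemma similarity_H:
  assumes f: "similarity f c"
  defines "L \<equiv> linear_part (induced_affine dev f)"
  shows "H (f m) (L a) (L b) = c * H m a b"
proof -
  note T = similarity_affine(3)[OF f, folded L_def]
  have "coframe (f m) (L a) = tangent_map A A f m (coframe m a)" for a
    using intertwines_frame[OF T, of m "coframe m a"] by (metis coframe_frame frame_coframe)
  then show ?thesis using f by (simp add: H_def similarity_def)
qed

text \<open>The matrix \<open>map_prod L L\<close> commutes with \<open>J\<close> because both
  summands carry the same \<open>L\<close>. Positivity of \<open>c\<close> allows it to cancel in
  the quotient.\<close>

lemma lift_invariant:
  assumes f: "similarity f c"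
  shows "tangent_map (tb_atlas A) (tb_atlas A) (lift f u) z (I z w) = I (lift f u z) (tangent_map (tb_atlas A) (tb_atlas A) (lift f u) z w)"
    "pullback_form (tb_atlas A) (tb_atlas A) (lift f u) (tb_cK_form A dev g \<xi>) = tb_cK_form A dev g \<xi>"
proof -
  define L where "L = linear_part (induced_affine dev f)"
  note i = TB.intertwines_frame[OF intertwines_lift[OF f], folded L_def]
  have lin: "linear L" unfolding L_def by (rule intertwines_linear[OF similarity_affine(3)[OF f]])
  have LJ: "map_prod L L (J x) = J (map_prod L L x)" for x
    by (simp add: split_beta map_prod_def linear_neg[OF lin])
  show "tangent_map (tb_atlas A) (tb_atlas A) (lift f u) z (I z w) = I (lift f u z) (tangent_map (tb_atlas A) (tb_atlas A) (lift f u) z w)"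
    by (rule iffD1[OF TB.frame_inject[of "lift f u z"]]) (simp only: i frame_I LJ)
  have c: "c > 0" using f by (simp add: similarity_def)
  have \<xi>: "g (f m) (\<xi> (f m)) (\<xi> (f m)) = c * g m (\<xi> m) (\<xi> m)" for m
    using f unfolding similarity_def by metis
  have "\<Omega> (f m) (map_prod L L a) (map_prod L L b) = c * \<Omega> m a b" for m a b
    using similarity_H[OF f, folded L_def] by (simp add: \<Omega>_def right_diff_distrib)
  then show "pullback_form (tb_atlas A) (tb_atlas A) (lift f u) (tb_cK_form A dev g \<xi>) = tb_cK_form A dev g \<xi>"
    using c by (auto simp: fun_eq_iff pullback_form_def tb_cK_form_def tb_form_eq i \<xi>)
qed

text \<open>The conformal factor is smooth and positive because \<xi> has no zeros.\<close>

lemma conformally_kaehler_tb: "conformally_kaehler (tb_atlas A) I (tb_cK_form A dev g \<xi>)"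
proof -
  let ?n = "\<lambda>p. g p (\<xi> p) (\<xi> p)"
  have "smooth_map_on A std_atlas UNIV ?n"
    using smooth_metric smooth_field unfolding smooth_bilinear_field_def by blast
  note s = smooth_fst_compose[OF this]
  have pos: "?n p > 0" for p by (rule metric_pos[OF field_nonzero])
  then have nz: "?n p \<noteq> 0" for p by (metis less_irrefl)
  have "smooth_map_on (tb_atlas A) std_atlas UNIV (\<lambda>z. inverse (?n (fst z)))"
  proof (rule smooth_map_on_stdI[OF TB.manifold open_UNIV])
    fix C assume C: "C \<in> tb_atlas A"
    have "smooth_on (snd C ` (fst C \<inter> UNIV)) ((\<lambda>z. ?n (fst z)) \<circ> chart_inv C)"
      using s C unfolding smooth_map_on_std_iff by blast
    then have "smooth_on (snd C ` (fst C \<inter> UNIV)) (\<lambda>x. inverse (((\<lambda>z. ?n (fst z)) \<circ> chart_inv C) x))"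
      by (rule smooth_on_inverse[OF open_chart_restrict[OF TB.manifold C open_UNIV]]) (simp add: nz)
    then show "smooth_on (snd C ` (fst C \<inter> UNIV)) ((\<lambda>z. inverse (?n (fst z))) \<circ> chart_inv C)" by (simp add: comp_def)
  qed
  moreover have "tb_cK_form A dev g \<xi> = (\<lambda>z u v. inverse (?n (fst z)) * tb_form A dev g z u v)"
    by (intro ext) (simp add: tb_cK_form_def)
  ultimately show ?thesis
    unfolding conformally_kaehler_def using kaehler_tb_form pos
    by (intro exI[of _ "tb_form A dev g"] exI[of _ "\<lambda>z. inverse (?n (fst z))"]) auto
qed

section \<open>Semidirect products for an abstract group of similarities\<close>

context
  fixes K :: "'h monoid" (structure) and \<phi> :: "'h \<Rightarrow> 'm \<Rightarrow> 'm" and \<theta>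
  assumes K: "group K"
    and sim: "\<And>a. a \<in> carrier K \<Longrightarrow> \<exists>c. similarity (\<phi> a) c"
    and one: "\<phi> \<one> = (\<lambda>x. x)"
    and mult: "\<And>a b. a \<in> carrier K \<Longrightarrow> b \<in> carrier K \<Longrightarrow> \<phi> (a \<otimes> b) = (\<lambda>x. \<phi> a (\<phi> b x))"
  defines "\<theta> \<equiv> \<lambda>a. induced_affine dev (\<phi> a)"
begin

lemma induced_affine_action:
  assumes "a \<in> carrier K"
  shows "affine_map (\<theta> a)" "dev (\<phi> a p) = \<theta> a (dev p)"
  using sim[OF assms] similarity_affine unfolding \<theta>_def by blast+

lemma linear_action: "a \<in> carrier K \<Longrightarrow> linear (linear_part (\<theta> a))"
  using induced_affine_action(1) by (simp add: affine_map_def)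

lemma induced_one: "\<theta> \<one> = (\<lambda>x. x)"
  unfolding \<theta>_def one
  by (rule induced_affine_eq) (auto simp: affine_map_def linear_part_ident linear_id[unfolded id_def])

lemma induced_mult:
  assumes "a \<in> carrier K" "b \<in> carrier K"
  shows "\<theta> (a \<otimes> b) = (\<lambda>x. \<theta> a (\<theta> b x))"
proof -
  have "induced_affine dev (\<phi> (a \<otimes> b)) = (\<lambda>x. \<theta> a (\<theta> b x))"
    by (rule induced_affine_eq)
      (use affine_map_comp assms induced_affine_action mult[OF assms] in \<open>auto simp: fun_eq_iff\<close>)
  then show ?thesis unfolding \<theta>_def by simp
qed

text \<open>Multiplicativity of linear parts is what associativity of the semidirect product rests
  on.\<close>

lemma linear_mult:
  assumes "a \<in> carrier K" "b \<in> carrier K"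
  shows "linear_part (\<theta> (a \<otimes> b)) x = linear_part (\<theta> a) (linear_part (\<theta> b) x)"
  using fun_cong[OF linear_part_comp[OF induced_affine_action(1)[OF assms(1)], of "\<theta> b"], of x]
  by (simp only: induced_mult[OF assms])

lemma group_semidirect: "group (semidirect K \<theta>)"
proof -
  interpret group K by (rule K)
  show ?thesis
  proof (rule groupI)
    fix x y z assume "x \<in> carrier (semidirect K \<theta>)" "y \<in> carrier (semidirect K \<theta>)" "z \<in> carrier (semidirect K \<theta>)"
    then obtain a u b v c w where e: "x = (a, u)" "y = (b, v)" "z = (c, w)" "a \<in> carrier K" "b \<in> carrier K" "c \<in> carrier K"
      by (auto simp: semidirect_def)
    show "x \<otimes>\<^bsub>semidirect K \<theta>\<^esub> y \<otimes>\<^bsub>semidirect K \<theta>\<^esub> z = x \<otimes>\<^bsub>semidirect K \<theta>\<^esub> (y \<otimes>\<^bsub>semidirect K \<theta>\<^esub> z)"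
      using e by (simp add: semidirect_def linear_mult linear_add[OF linear_action] m_assoc add.assoc)
  next
    fix x assume "x \<in> carrier (semidirect K \<theta>)"
    then obtain a u where e: "x = (a, u)" "a \<in> carrier K" by (auto simp: semidirect_def)
    show "\<one>\<^bsub>semidirect K \<theta>\<^esub> \<otimes>\<^bsub>semidirect K \<theta>\<^esub> x = x"
      using e by (simp add: semidirect_def induced_one linear_part_ident)
    \<comment> \<open>A left inverse of \<open>(a, u)\<close> over \<open>inv a\<close> needs the
      translation that cancels the image of \<open>u\<close> under the linear part of
      \<open>\<theta> (inv a)\<close>.\<close>
    show "\<exists>y\<in>carrier (semidirect K \<theta>). y \<otimes>\<^bsub>semidirect K \<theta>\<^esub> x = \<one>\<^bsub>semidirect K \<theta>\<^esub>"
      by (rule bexI[of _ "(inv a, - linear_part (\<theta> (inv a)) u)"]) (use e in \<open>auto simp: semidirect_def\<close>)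
  qed (auto simp: semidirect_def)
qed

lemma semidirect_action_one: "semidirect_action \<phi> \<theta> \<one>\<^bsub>semidirect K \<theta>\<^esub> = (\<lambda>x. x)"
  by (simp add: semidirect_action_def semidirect_def one induced_one fun_eq_iff)

lemma semidirect_action_mult:
  assumes "x \<in> carrier (semidirect K \<theta>)" "y \<in> carrier (semidirect K \<theta>)"
  shows "semidirect_action \<phi> \<theta> (x \<otimes>\<^bsub>semidirect K \<theta>\<^esub> y) =
    (\<lambda>z. semidirect_action \<phi> \<theta> x (semidirect_action \<phi> \<theta> y z))"
proof -
  obtain a u b v where e: "x = (a, u)" "y = (b, v)" "a \<in> carrier K" "b \<in> carrier K"
    using assms by (auto simp: semidirect_def)
  \<comment> \<open>A translation passes through an affine map as its image under the linear part,
    which matches the second component of the product.\<close>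
  have "\<theta> a (w + v) = \<theta> a w + linear_part (\<theta> a) v" for w
    using affine_map_apply[of "\<theta> a" "w + v"] affine_map_apply[of "\<theta> a" w] linear_add[OF linear_action[OF e(3)], of w v]
    by simp
  then show ?thesis
    using e(3,4) by (simp add: e(1,2) semidirect_action_def semidirect_def mult induced_mult fun_eq_iff; simp add: add_ac)
qed

lemma group_action_semidirect: "group_action (semidirect K \<theta>) UNIV (semidirect_action \<phi> \<theta>)"
  by (rule group_action_UNIV_I[OF group_semidirect semidirect_action_one semidirect_action_mult])

lemma semidirect_action_lift: "semidirect_action \<phi> \<theta> (a, u) = lift (\<phi> a) u"
  by (simp add: semidirect_action_def \<theta>_def)

lemma invariant_semidirect:
  "invariant_structure (tb_atlas A) (semidirect K \<theta>) (semidirect_action \<phi> \<theta>) I (tb_cK_form A dev g \<xi>)"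
  unfolding invariant_structure_def
proof (intro conjI ballI group_action_semidirect)
  interpret group "semidirect K \<theta>" by (rule group_semidirect)
  interpret act: group_action "semidirect K \<theta>" UNIV "semidirect_action \<phi> \<theta>" by (rule group_action_semidirect)
  have sm: "smooth_map_on (tb_atlas A) (tb_atlas A) UNIV (semidirect_action \<phi> \<theta> h)"
    if "h \<in> carrier (semidirect K \<theta>)" for h
  proof -
    from that obtain a u where h: "h = (a, u)" "a \<in> carrier K" by (auto simp: semidirect_def)
    from sim[OF h(2)] obtain c where "similarity (\<phi> a) c" by blast
    from TB.intertwines_smooth[OF intertwines_lift[OF this]] show ?thesis by (simp only: h(1) semidirect_action_lift)
  qed
  fix h assume h: "h \<in> carrier (semidirect K \<theta>)"
  obtain a u where hau: "h = (a, u)" "a \<in> carrier K" using h by (auto simp: semidirect_def)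
  obtain c where c: "similarity (\<phi> a) c" using sim[OF hau(2)] by blast
  have r: "range (semidirect_action \<phi> \<theta> h) = UNIV" "inj (semidirect_action \<phi> \<theta> h)"
    using act.surj_prop[OF h] act.inj_prop[OF h] by auto
  \<comment> \<open>The inverse map is the action of the inverse element, so its smoothness is an
    instance of \<open>sm\<close>.\<close>
  have "inv_into UNIV (semidirect_action \<phi> \<theta> h) = semidirect_action \<phi> \<theta> (inv\<^bsub>semidirect K \<theta>\<^esub> h)"
  proof
    fix z
    have "semidirect_action \<phi> \<theta> h (semidirect_action \<phi> \<theta> (inv\<^bsub>semidirect K \<theta>\<^esub> h) z) = z"
      using semidirect_action_mult[OF h inv_closed[OF h]] semidirect_action_one r_inv[OF h] by (metis (no_types, lifting))
    then show "inv_into UNIV (semidirect_action \<phi> \<theta> h) z = semidirect_action \<phi> \<theta> (inv\<^bsub>semidirect K \<theta>\<^esub> h) z"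
      using r(2) by (rule inv_f_eq[rotated])
  qed
  then show "diffeo_on (tb_atlas A) (tb_atlas A) UNIV (semidirect_action \<phi> \<theta> h)"
    unfolding diffeo_on_def using sm[OF h] sm[OF inv_closed[OF h]] r by simp
  show "\<forall>p v. tangent_map (tb_atlas A) (tb_atlas A) (semidirect_action \<phi> \<theta> h) p (I p v) =
      I (semidirect_action \<phi> \<theta> h p) (tangent_map (tb_atlas A) (tb_atlas A) (semidirect_action \<phi> \<theta> h) p v)"
    unfolding hau(1) semidirect_action_lift using lift_invariant(1)[OF c] by blast
  show "pullback_form (tb_atlas A) (tb_atlas A) (semidirect_action \<phi> \<theta> h) (tb_cK_form A dev g \<xi>) = tb_cK_form A dev g \<xi>"
    unfolding hau(1) semidirect_action_lift by (rule lift_invariant(2)[OF c])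
qed

text \<open>Transitivity on the base suffices: after the base point is moved, a translation adjusts
  the fibre coordinate.\<close>

lemma transitive_semidirect:
  assumes "\<And>p q. \<exists>a\<in>carrier K. \<phi> a p = q"
  shows "transitive_action (semidirect K \<theta>) UNIV (semidirect_action \<phi> \<theta>)"
proof (intro transitive_action.intro transitive_action_axioms.intro group_action_semidirect)
  fix z w :: "'m \<times> 'e"
  obtain a where a: "a \<in> carrier K" "\<phi> a (fst z) = fst w" using assms by blast
  show "\<exists>h\<in>carrier (semidirect K \<theta>). semidirect_action \<phi> \<theta> h z = w"
    by (rule bexI[of _ "(a, snd w - \<theta> a (snd z))"])
      (use a in \<open>auto simp: semidirect_action_def semidirect_def split_beta prod_eq_iff\<close>)
qed

end

section \<open>The group of affine isometries preserving the field\<close>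

lemma isometry_group_iff: "f \<in> carrier (isometry_group A nabla g \<xi>) \<longleftrightarrow> similarity f 1"
proof
  assume "f \<in> carrier (isometry_group A nabla g \<xi>)"
  then have f: "surj f" "affine_diffeo_on A nabla A nabla UNIV f" "pullback_form A A f g = g"
    "\<And>p. tangent_map A A f p (\<xi> p) = \<xi> (f p)" by (auto simp: isometry_group_def)
  obtain S where "bij f" "smooth_map_on A A UNIV (inv_into UNIV f)" "intertwines f S"
    by (rule affine_diffeo_onD[OF connected f(2,1)])
  moreover have "g (f p) (tangent_map A A f p u) (tangent_map A A f p v) = g p u v" for p u v
    using f(3) by (metis pullback_form_def)
  ultimately show "similarity f 1" using f(4) by (auto simp: similarity_def)
next
  assume f: "similarity f 1"
  then obtain S where S: "bij f" "smooth_map_on A A UNIV (inv_into UNIV f)" "intertwines f S"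
    unfolding similarity_def by blast
  have "pullback_form A A f g = g"
    using f by (simp add: similarity_def pullback_form_def fun_eq_iff)
  then show "f \<in> carrier (isometry_group A nabla g \<xi>)"
    using f affine_diffeo_onI[OF S] S(1) by (simp add: similarity_def isometry_group_def bij_is_surj)
qed

lemma group_isometry_group: "group (isometry_group A nabla g \<xi>)"
proof (rule groupI)
  let ?G = "isometry_group A nabla g \<xi>"
  have m: "f \<otimes>\<^bsub>?G\<^esub> h = (\<lambda>x. f (h x))" and o: "\<one>\<^bsub>?G\<^esub> = (\<lambda>x. x)" for f h
    by (auto simp: isometry_group_def)
  show "x \<otimes>\<^bsub>?G\<^esub> y \<in> carrier ?G" if "x \<in> carrier ?G" "y \<in> carrier ?G" for x y
    using that similarity_comp[of y 1 x 1] by (simp add: m isometry_group_iff)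
  show "\<one>\<^bsub>?G\<^esub> \<in> carrier ?G" using similarity_ident by (simp add: o isometry_group_iff)
  fix x assume x: "x \<in> carrier ?G"
  have "inv_into UNIV x \<in> carrier ?G" using x similarity_inverse[of x 1] by (simp add: isometry_group_iff)
  moreover have "inv_into UNIV x \<otimes>\<^bsub>?G\<^esub> x = \<one>\<^bsub>?G\<^esub>"
    using x by (simp add: m o isometry_group_iff similarity_def bij_is_inj)
  ultimately show "\<exists>y\<in>carrier ?G. y \<otimes>\<^bsub>?G\<^esub> x = \<one>\<^bsub>?G\<^esub>" by blast
  show "\<one>\<^bsub>?G\<^esub> \<otimes>\<^bsub>?G\<^esub> x = x" by (simp add: m o)
qed (simp add: isometry_group_def comp_assoc)

end

text \<open>The constant loops at two points are homotopic as loops, and during the homotopy the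
  base point traces a path between them.\<close>

lemma simply_connected_imp_connected_topological:
  fixes S :: "'a::topological_space set"
  assumes "simply_connected S"
  shows "connected S"
proof -
  have "path_component S x y" if "x \<in> S" "y \<in> S" for x y
  proof -
    have "homotopic_loops S (\<lambda>t. x) (\<lambda>t. y)"
      using assms that unfolding simply_connected_def
      by (simp add: path_def pathfinish_def pathstart_def path_image_def image_subset_iff)
    from homotopic_loops_imp_path_component_value[OF this, of 0] show ?thesis by simp
  qed
  then show ?thesis
    by (intro path_connected_imp_connected) (simp add: path_connected_component)
qed

lemma group_real_add: "group real_add_group"
  proof (rule groupI)
  fix x assume "x \<in> carrier real_add_group"
  show "\<exists>y\<in>carrier real_add_group. y \<otimes>\<^bsub>real_add_group\<^esub> x = \<one>\<^bsub>real_add_group\<^esub>"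
    by (rule bexI[of _ "- x"]) (auto simp: real_add_group_def)
qed (auto simp: real_add_group_def)

theorem theorem4p9:
  fixes A :: "('m::{t2_space,second_countable_topology}, real^'n) chart set"
    and nabla :: "('m, real^'n) conn"
    and g :: "'m \<Rightarrow> real^'n \<Rightarrow> real^'n \<Rightarrow> real"
    and \<xi> :: "'m \<Rightarrow> real^'n"
    and dev :: "'m \<Rightarrow> real^'n"
  assumes "selfsimilar_hessian_manifold A nabla g \<xi>"
    and "simply_connected (UNIV :: 'm set)"
    and "\<forall>p. \<xi> p \<noteq> 0"
    and "development A nabla dev"
  shows
    "let G = isometry_group A nabla g \<xi>;
         RG = real_add_group \<times>\<times> G;
         \<theta> = (\<lambda>a. induced_affine dev a);
         \<theta>' = (\<lambda>h. induced_affine dev (flow_action A \<xi> h));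
         N = tb_atlas A;
         I = tb_complex A dev;
         \<omega>\<^sub>c\<^sub>K = tb_cK_form A dev g \<xi>;
         S = {p. g p (\<xi> p) (\<xi> p) = 1}
     in
       (conformally_kaehler N I \<omega>\<^sub>c\<^sub>K \<and>
        invariant_structure N (semidirect G \<theta>) (semidirect_action (\<lambda>a. a) \<theta>) I \<omega>\<^sub>c\<^sub>K) \<and>
       (complete_field A \<xi> \<longrightarrow>
        invariant_structure N (semidirect RG \<theta>') (semidirect_action (flow_action A \<xi>) \<theta>') I \<omega>\<^sub>c\<^sub>K) \<and>
       (complete_field A \<xi> \<and> (\<forall>p\<in>S. \<forall>q\<in>S. \<exists>a\<in>carrier G. a p = q) \<longrightarrow>
        homogeneous_conformally_kaehler N (semidirect RG \<theta>')
          (semidirect_action (flow_action A \<xi>) \<theta>') I \<omega>\<^sub>c\<^sub>K)"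
proof -
  note ss = assms(1)[unfolded selfsimilar_hessian_manifold_def]
  have con: "connected (UNIV :: 'm set)" by (rule simply_connected_imp_connected_topological[OF assms(2)])
  have man: "smooth_manifold A"
    using ss unfolding hessian_manifold_def flat_affine_manifold_def by blast
  have dev: "\<exists>U. p \<in> U \<and> affine_diffeo_on A nabla std_atlas std_connection U dev" for p
    using assms(4) unfolding development_def by blast
  have local: "\<exists>U. p \<in> U \<and> diffeo_on A std_atlas U dev" for p
    using dev[of p] unfolding affine_diffeo_on_def by blast
  have field: "smooth_field_on A UNIV \<xi>" using ss unfolding affine_field_def by blast
  interpret selfsimilar_model A dev nabla g \<xi>
    by unfold_locales (rule man local dev con field conjunct1[OF ss] assms(3)[rule_format])+
  let ?G = "isometry_group A nabla g \<xi>"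
  let ?RG = "real_add_group \<times>\<times> ?G"
  interpret G: group ?G by (rule group_isometry_group)
  have sG: "\<exists>c. similarity a c" if "a \<in> carrier ?G" for a using that isometry_group_iff by blast
  have inv1: "invariant_structure (tb_atlas A) (semidirect ?G (\<lambda>a. induced_affine dev a))
      (semidirect_action (\<lambda>a. a) (\<lambda>a. induced_affine dev a)) I (tb_cK_form A dev g \<xi>)"
    by (rule invariant_semidirect[of ?G "\<lambda>a. a", OF group_isometry_group sG])
      (auto simp: isometry_group_def fun_eq_iff)
  have RG: "group ?RG" by (rule DirProd_group[OF group_real_add group_isometry_group])
  have flow: "(\<forall>h\<in>carrier ?RG. \<exists>c. similarity (flow_action A \<xi> h) c) \<and> flow_action A \<xi> \<one>\<^bsub>?RG\<^esub> = (\<lambda>x. x) \<and>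
      (\<forall>h\<in>carrier ?RG. \<forall>k\<in>carrier ?RG. flow_action A \<xi> (h \<otimes>\<^bsub>?RG\<^esub> k) =
        (\<lambda>x. flow_action A \<xi> h (flow_action A \<xi> k x))) \<and>
      (\<forall>t p. g (exp_flow A \<xi> t p) (\<xi> (exp_flow A \<xi> t p)) (\<xi> (exp_flow A \<xi> t p)) = exp (2 * t) * g p (\<xi> p) (\<xi> p))"
    if comp: "complete_field A \<xi>"
  proof -
    interpret F: complete_affine_field A dev nabla \<xi>
      by unfold_locales (use con comp ss in auto)
    have lie: "lie_derivative A \<xi> g Y Z p = 2 * g p (Y p) (Z p)"
      if "smooth_field_on A UNIV Y" "smooth_field_on A UNIV Z" for Y Z p
      using ss that open_UNIV by blast
    note scale = F.flow_scales[OF smooth_metric lie]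
    have simF: "similarity (exp_flow A \<xi> t) (exp (2 * t))" for t
      unfolding similarity_def
      by (intro conjI allI exI[of _ "F.flow_linear t"])
        (simp_all add: F.bij_flow F.inv_flow F.smooth_flow F.intertwines_flow scale F.tangent_flow_field)
    have "\<exists>c. similarity (flow_action A \<xi> h) c" if "h \<in> carrier ?RG" for h
    proof -
      obtain t a where h: "h = (t, a)" "similarity a 1" using \<open>h \<in> carrier ?RG\<close> isometry_group_iff by (cases h) auto
      show ?thesis using similarity_comp[OF h(2) simF[of t]] by (auto simp: h(1) flow_action_def comp_def)
    qed
    moreover have "flow_action A \<xi> \<one>\<^bsub>?RG\<^esub> = (\<lambda>x. x)"
      by (simp add: flow_action_def real_add_group_def isometry_group_def F.flow_0 fun_eq_iff)
    moreover have "flow_action A \<xi> (h \<otimes>\<^bsub>?RG\<^esub> k) = (\<lambda>x. flow_action A \<xi> h (flow_action A \<xi> k x))"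
      if hk: "h \<in> carrier ?RG" "k \<in> carrier ?RG" for h k
    proof -
      obtain t a where h: "h = (t, a)" "similarity a 1" using hk(1) isometry_group_iff by (cases h) auto
      obtain s b where k: "k = (s, b)" by (cases k)
      have "smooth_map_on A A UNIV a" using h(2) intertwines_smooth unfolding similarity_def by blast
      \<comment> \<open>Multiplicativity of the combined action requires the flow to commute with
        \<open>a\<close>, which holds because \<open>a\<close> preserves \<xi>.\<close>
      from F.flow_commute[OF this] have "exp_flow A \<xi> s (a x) = a (exp_flow A \<xi> s x)" for x
        using h(2) unfolding similarity_def by blast
      then show ?thesis
        by (simp add: h(1) k flow_action_def real_add_group_def isometry_group_def fun_eq_iff F.flow_add)
    qed
    moreover have "g (exp_flow A \<xi> t p) (\<xi> (exp_flow A \<xi> t p)) (\<xi> (exp_flow A \<xi> t p)) = exp (2 * t) * g p (\<xi> p) (\<xi> p)" for t p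
      using scale[of t p "\<xi> p" "\<xi> p"] by (simp add: F.tangent_flow_field)
    ultimately show ?thesis by blast
  qed
  have inv2: "invariant_structure (tb_atlas A) (semidirect ?RG (\<lambda>h. induced_affine dev (flow_action A \<xi> h)))
      (semidirect_action (flow_action A \<xi>) (\<lambda>h. induced_affine dev (flow_action A \<xi> h))) I (tb_cK_form A dev g \<xi>)"
    if comp: "complete_field A \<xi>"
    by (rule invariant_semidirect[of ?RG "flow_action A \<xi>", OF RG]) (use flow[OF comp] in blast)+
  have trans: "transitive_action (semidirect ?RG (\<lambda>h. induced_affine dev (flow_action A \<xi> h))) UNIV
      (semidirect_action (flow_action A \<xi>) (\<lambda>h. induced_affine dev (flow_action A \<xi> h)))"
    if comp: "complete_field A \<xi>"
      and tr: "\<forall>p\<in>{p. g p (\<xi> p) (\<xi> p) = 1}. \<forall>q\<in>{p. g p (\<xi> p) (\<xi> p) = 1}. \<exists>a\<in>carrier ?G. a p = q"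
  proof (rule transitive_semidirect[of ?RG "flow_action A \<xi>", OF RG])
    note fl = flow[OF comp]
    let ?n = "\<lambda>p. g p (\<xi> p) (\<xi> p)"
    have carrier: "(t, a) \<in> carrier ?RG" if "a \<in> carrier ?G" for t a using that by (simp add: real_add_group_def)
    fix p q
    have pos: "?n p > 0" "?n q > 0" by (rule metric_pos[OF field_nonzero])+
    \<comment> \<open>The flow multiplies \<open>?n\<close> by the exponential of twice the time. So
      time \<open>t\<close> takes \<open>p\<close> to the level 1, and time \<open>s\<close> takes
      level 1 to the level of \<open>q\<close>.\<close>
    define t s where "t = - ln (?n p) / 2" and "s = ln (?n q) / 2"
    define q0 where "q0 = exp_flow A \<xi> (- s) q"
    have "?n (exp_flow A \<xi> t p) = 1" "?n q0 = 1"
      using fl pos by (simp_all add: t_def s_def q0_def exp_minus)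
    then obtain a where a: "a \<in> carrier ?G" "a (exp_flow A \<xi> t p) = q0" using tr by blast
    have id: "id \<in> carrier ?G" using G.one_closed by (simp add: isometry_group_def)
    interpret RG: group ?RG by (rule RG)
    have mult: "flow_action A \<xi> (h \<otimes>\<^bsub>?RG\<^esub> k) x = flow_action A \<xi> h (flow_action A \<xi> k x)"
      if "h \<in> carrier ?RG" "k \<in> carrier ?RG" for h k x using fl that by metis
    have one: "flow_action A \<xi> (0, id) x = x" for x
      using fl by (simp add: real_add_group_def isometry_group_def)
    have "(s, id) \<otimes>\<^bsub>?RG\<^esub> (- s, id) = (0, id)" by (simp add: real_add_group_def isometry_group_def)
    from mult[OF carrier[OF id, of s] carrier[OF id, of "- s"], of q, unfolded this one]
    have "exp_flow A \<xi> s q0 = q" by (simp add: flow_action_def q0_def)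
    moreover have "exp_flow A \<xi> 0 x = x" for x using one[of x] by (simp add: flow_action_def)
    \<comment> \<open>Three moves, read from the right: \<open>p\<close> flows to the level surface,
      \<open>a\<close> carries it there to \<open>q0\<close>, and \<open>q0\<close> flows to
      \<open>q\<close>.\<close>
    ultimately have "flow_action A \<xi> ((s, id) \<otimes>\<^bsub>?RG\<^esub> ((0, a) \<otimes>\<^bsub>?RG\<^esub> (t, id))) p = q"
      using mult[OF carrier[OF id, of s] RG.m_closed[OF carrier[OF a(1), of 0] carrier[OF id, of t]], of p]
        mult[OF carrier[OF a(1), of 0] carrier[OF id, of t], of p] a(2)
      by (simp add: flow_action_def)
    moreover have "(s, id) \<otimes>\<^bsub>?RG\<^esub> ((0, a) \<otimes>\<^bsub>?RG\<^esub> (t, id)) \<in> carrier ?RG"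
      by (intro RG.m_closed carrier id a(1))
    ultimately show "\<exists>h\<in>carrier ?RG. flow_action A \<xi> h p = q" by blast
  qed (use flow[OF comp] in blast)+
  show ?thesis
    unfolding Let_def homogeneous_conformally_kaehler_def
    using conformally_kaehler_tb inv1 inv2 trans by blast
qed


end
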